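(* Fix $T>0$ and $x_0\in\mathbb{S}^1$. For $k\in\mathbb{N}$ let $\mathbb{P}_k$ be the law on the Skorohod space $D[0,T]$ of the continuous time random walk $X_k=\{X_k(t)\}_{t\in[0,T]}$ on $\Gamma_k=\{0,\frac1k,\dots,\frac{k-1}{k}\}\subset\mathbb{S}^1$ with generator $k\mathcal{L}_k$ and initial measure the Dirac delta at $\lfloor kx_0\rfloor/k$. Define the rate function $I_T$ on $D[0,T]$ by $$I_T(\gamma)=\int_0^T\Big\{\gamma'(s)\log\Big(\frac{\gamma'(s)+\sqrt{(\gamma'(s))^2+4}}{2}\Big)-\sqrt{(\gamma'(s))^2+4}+2\Big\}\,ds$$ if $\gamma\in\mathcal{AC}[0,T]$, and $I_T(\gamma)=\infty$ otherwise. Then the sequence $\{\mathbb{P}_k\}_k$ satisfies: (Upper bound) for every closed set $\mathcal{C}\subset D[0,T]$, $$\limsup_{k\to\infty}\frac1k\log\mathbb{P}_k[X_k\in\mathcal{C}]\le-\inf_{\gamma\in\mathcal{C}}I_T(\gamma);$$ (Lower bound) for every open set $\mathcal{O}\subset D[0,T]$, $$\liminf_{k\to\infty}\frac1k\log\mathbb{P}_k[X_k\in\mathcal{O}]\ge-\inf_{\gamma\in\mathcal{O}}I_T(\gamma).$$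
   Context: $\mathbb{S}^1$ is the unit circle, identified with $[0,1)$, and $\Gamma_k=\{0,1/k,\dots,(k-1)/k\}$, with indices taken mod $k$. For $f:\Gamma_k\to\mathbb{R}$, $$(\mathcal{L}_kf)(\tfrac jk)=\big[f(\tfrac{j+1}k)-f(\tfrac jk)\big]+\big[f(\tfrac{j-1}k)-f(\tfrac jk)\big],$$ so the chain with generator $k\mathcal{L}_k$ jumps from $j/k$ to each of its two neighbours at rate $k$. $D[0,T]$ is the Skorohod space of càdlàg trajectories $[0,T]\to\mathbb{S}^1$. $\mathcal{AC}[0,T]$ is the set of all absolutely continuous functions $\gamma:[0,T]\to\mathbb{S}^1$: for every $\varepsilon>0$ there is $\delta>0$ such that for every finite family of (disjoint) intervals $(s_i,t_i)$ in $[0,T]$ with $\sum_i(t_i-s_i)<\delta$ one has $\sum_i|\gamma(t_i)-\gamma(s_i)|<\varepsilon$.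
   Formalization: The rate function is taken to be infinite also on absolutely continuous paths with γ(0) ≠ x_0; as printed, I_T ignores the starting point and the lower bound fails for the open set of paths starting near some y ≠ x_0. *)

theory Defs
  imports "HOL-Probability.Probability"
begin

section \<open>The circle\<close>

typedef circle = "{0..<1::real}"
  by (rule exI[of _ 0]) simp

definition circle_of_real :: "real \<Rightarrow> circle" where
  "circle_of_real r = Abs_circle (frac r)"

text \<open>The metric is the length of the shorter arc, for total circumference 1.\<close>

instantiation circle :: metric_space
begin

definition dist_circle :: "circle \<Rightarrow> circle \<Rightarrow> real" where
  "dist_circle x y =
     min \<bar>Rep_circle x - Rep_circle y\<bar> (1 - \<bar>Rep_circle x - Rep_circle y\<bar>)"

definition uniformity_circle :: "(circle \<times> circle) filter" where
  "uniformity_circle = (INF e\<in>{0<..}. principal {(x, y). dist x y < e})"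

definition open_circle :: "circle set \<Rightarrow> bool" where
  "open_circle U \<longleftrightarrow> (\<forall>x\<in>U. eventually (\<lambda>(x', y). x' = x \<longrightarrow> y \<in> U) uniformity)"

instance
proof
  fix x y z :: circle
  have rep: "0 \<le> Rep_circle u" "Rep_circle u < 1" for u
    using Rep_circle[of u] by auto
  show "dist x y = 0 \<longleftrightarrow> x = y"
    using rep[of x] rep[of y] Rep_circle_inject[of x y]
    by (auto simp: dist_circle_def min_def split: if_splits)
  show "dist x y \<le> dist x z + dist y z"
    using rep[of x] rep[of y] rep[of z]
    by (auto simp: dist_circle_def min_def abs_if split: if_splits)
qed (auto simp: uniformity_circle_def open_circle_def)

end

lemma dist_circle_le: "dist (x::circle) y \<le> 1"
  using Rep_circle[of x] Rep_circle[of y]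
  by (auto simp: dist_circle_def min_def)

lemma circle_of_real_eq_iff: "circle_of_real r = circle_of_real s \<longleftrightarrow> r - s \<in> \<int>"
proof -
  have "circle_of_real r = circle_of_real s \<longleftrightarrow> frac r = frac s"
    unfolding circle_of_real_def
    by (subst Abs_circle_inject) (auto simp: frac_lt_1)
  also have "\<dots> \<longleftrightarrow> r - s \<in> \<int>"
  proof
    assume "frac r = frac s"
    then have "r - s = of_int (\<lfloor>r\<rfloor> - \<lfloor>s\<rfloor>)" by (simp add: frac_def)
    then show "r - s \<in> \<int>" by (metis Ints_of_int)
  next
    assume "r - s \<in> \<int>"
    then obtain n where "r = s + of_int n" by (metis Ints_cases add.commute diff_add_cancel)
    then show "frac r = frac s" by (simp add: frac_def)
  qed
  finally show ?thesis .
qed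

definition circle_shift :: "real \<Rightarrow> circle \<Rightarrow> circle" where
  "circle_shift r x = circle_of_real (Rep_circle x + r)"

text \<open>The derivative of a circle-valued function is that of a local lift to the real line.\<close>

definition has_circle_derivative :: "(real \<Rightarrow> circle) \<Rightarrow> real \<Rightarrow> real \<Rightarrow> bool" where
  "has_circle_derivative \<gamma> v s \<longleftrightarrow>
     (\<exists>g. (\<forall>\<^sub>F u in nhds s. \<gamma> u = circle_of_real (g u)) \<and> (g has_real_derivative v) (at s))"

definition circle_deriv :: "(real \<Rightarrow> circle) \<Rightarrow> real \<Rightarrow> real" where
  "circle_deriv \<gamma> s = (THE v. has_circle_derivative \<gamma> v s)"

lemma has_circle_derivative_unique:
  assumes "has_circle_derivative \<gamma> v s" "has_circle_derivative \<gamma> w s"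
  shows "v = w"
proof -
  obtain g h where g: "\<forall>\<^sub>F u in nhds s. \<gamma> u = circle_of_real (g u)" "(g has_real_derivative v) (at s)"
    and h: "\<forall>\<^sub>F u in nhds s. \<gamma> u = circle_of_real (h u)" "(h has_real_derivative w) (at s)"
    using assms unfolding has_circle_derivative_def by blast
  define d where "d = (\<lambda>u. g u - h u)"
  have d: "(d has_real_derivative (v - w)) (at s)"
    unfolding d_def by (intro derivative_intros g h)
  then have "isCont d s" by (rule DERIV_isCont)
  then have "(d \<longlongrightarrow> d s) (nhds s)" by (simp add: isCont_def tendsto_at_iff_tendsto_nhds)
  then have close: "\<forall>\<^sub>F u in nhds s. dist (d u) (d s) < 1" by (rule tendstoD) simp
  have int: "\<forall>\<^sub>F u in nhds s. d u \<in> \<int>"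
    using g(1) h(1) by eventually_elim (simp add: d_def flip: circle_of_real_eq_iff)
  then have "d s \<in> \<int>" by (rule eventually_nhds_x_imp_x)
  have int_eq: "d u = d s" if "dist (d u) (d s) < 1" "d u \<in> \<int>" for u
    using that \<open>d s \<in> \<int>\<close> by (metis Ints_nonzero_abs_less1 Ints_diff dist_real_def eq_iff_diff_eq_0)
  from close int have "\<forall>\<^sub>F u in nhds s. d u = d s"
    by eventually_elim (rule int_eq)
  with d have "((\<lambda>_. d s) has_real_derivative (v - w)) (at s)"
    using DERIV_cong_ev[of s s d "\<lambda>_. d s"] by blast
  then show ?thesis using DERIV_unique[OF _ DERIV_const, of "d s" "v - w" s] by simp
qed

lemma circle_deriv_eq: "has_circle_derivative \<gamma> v s \<Longrightarrow> circle_deriv \<gamma> s = v"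
  unfolding circle_deriv_def by (blast intro: has_circle_derivative_unique)


section \<open>The Skorohod space\<close>

text \<open>Trajectories on \<open>[0,T]\<close> are functions that are \<^const>\<open>undefined\<close> outside \<open>{0..T}\<close>.\<close>

definition cadlag_paths :: "real \<Rightarrow> (real \<Rightarrow> 'b::metric_space) set" where
  "cadlag_paths T = {\<gamma> \<in> extensional {0..T}.
     (\<forall>t\<in>{0..<T}. (\<gamma> \<longlongrightarrow> \<gamma> t) (at_right t)) \<and>
     (\<forall>t\<in>{0<..T}. \<exists>l. (\<gamma> \<longlongrightarrow> l) (at_left t))}"

definition time_changes :: "real \<Rightarrow> (real \<Rightarrow> real) set" where
  "time_changes T =
     {\<tau>. strict_mono_on {0..T} \<tau> \<and> continuous_on {0..T} \<tau> \<and> \<tau> ` {0..T} = {0..T}}"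

definition skorohod_dist ::
    "real \<Rightarrow> (real \<Rightarrow> 'b::metric_space) \<Rightarrow> (real \<Rightarrow> 'b) \<Rightarrow> real" where
  "skorohod_dist T x y = (INF \<tau>\<in>time_changes T.
     max (SUP t\<in>{0..T}. \<bar>\<tau> t - t\<bar>) (SUP t\<in>{0..T}. dist (x t) (y (\<tau> t))))"

definition skorohod_topology :: "real \<Rightarrow> (real \<Rightarrow> circle) topology" where
  "skorohod_topology T = Metric_space.mtopology (cadlag_paths T) (skorohod_dist T)"

definition skorohod_borel :: "real \<Rightarrow> (real \<Rightarrow> circle) measure" where
  "skorohod_borel T = sigma (cadlag_paths T) {U. openin (skorohod_topology T) U}"

lemma time_changes_mem: "\<tau> \<in> time_changes T \<Longrightarrow> t \<in> {0..T} \<Longrightarrow> \<tau> t \<in> {0..T}"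
  by (auto simp: time_changes_def)

lemma time_changes_id: "(\<lambda>t. t) \<in> time_changes T"
  by (auto simp: time_changes_def strict_mono_on_def)

lemma time_changes_comp:
  assumes \<sigma>: "\<sigma> \<in> time_changes T" and \<tau>: "\<tau> \<in> time_changes T"
  shows "(\<lambda>t. \<sigma> (\<tau> t)) \<in> time_changes T"
proof -
  have "(\<lambda>t. \<sigma> (\<tau> t)) ` {0..T} = {0..T}"
    using assms unfolding time_changes_def by (simp flip: image_image)
  moreover have "continuous_on {0..T} (\<lambda>t. \<sigma> (\<tau> t))"
    by (rule continuous_on_compose2[of "{0..T}" \<sigma> "{0..T}" \<tau>])
      (use assms in \<open>simp_all add: time_changes_def\<close>)
  moreover have "strict_mono_on {0..T} (\<lambda>t. \<sigma> (\<tau> t))"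
  proof (rule strict_mono_onI)
    fix r s assume rs: "r \<in> {0..T}" "s \<in> {0..T}" "r < s"
    have "\<tau> r < \<tau> s"
      using \<tau> rs by (simp add: time_changes_def strict_mono_on_def)
    then show "\<sigma> (\<tau> r) < \<sigma> (\<tau> s)"
      using \<sigma> time_changes_mem[OF \<tau> rs(1)] time_changes_mem[OF \<tau> rs(2)]
      by (simp add: time_changes_def strict_mono_on_def)
  qed
  ultimately show ?thesis by (simp add: time_changes_def)
qed

lemma time_changes_inverse:
  assumes "\<tau> \<in> time_changes T"
  obtains \<sigma> where "\<sigma> \<in> time_changes T" "\<And>t. t \<in> {0..T} \<Longrightarrow> \<tau> (\<sigma> t) = t"
proof -
  have mono: "strict_mono_on {0..T} \<tau>" and cont: "continuous_on {0..T} \<tau>"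
    and img: "\<tau> ` {0..T} = {0..T}"
    using assms by (auto simp: time_changes_def)
  have inj: "inj_on \<tau> {0..T}" using mono by (rule strict_mono_on_imp_inj_on)
  define \<sigma> where "\<sigma> = inv_into {0..T} \<tau>"
  have inv1: "\<sigma> (\<tau> t) = t" if "t \<in> {0..T}" for t
    unfolding \<sigma>_def using inj that by simp
  have inv2: "\<tau> (\<sigma> t) = t" "\<sigma> t \<in> {0..T}" if "t \<in> {0..T}" for t
    unfolding \<sigma>_def using that img by (metis f_inv_into_f, metis inv_into_into)
  have "continuous_on (\<tau> ` {0..T}) \<sigma>"
    using cont inv1 by (intro continuous_on_inv) auto
  moreover have "\<sigma> ` {0..T} = {0..T}"
    using inv1 inv2(2) img by (auto simp: image_iff) (metis atLeastAtMost_iff imageI)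
  moreover have "strict_mono_on {0..T} \<sigma>"
  proof (rule strict_mono_onI)
    fix r s assume rs: "r \<in> {0..T}" "s \<in> {0..T}" "r < s"
    show "\<sigma> r < \<sigma> s"
    proof (rule ccontr)
      assume "\<not> \<sigma> r < \<sigma> s"
      then have "\<tau> (\<sigma> s) \<le> \<tau> (\<sigma> r)"
        using strict_mono_on_leD[OF mono inv2(2)[OF rs(2)] inv2(2)[OF rs(1)]] by simp
      then show False using inv2(1) rs by auto
    qed
  qed
  ultimately show ?thesis using img inv2(1) by (intro that[of \<sigma>]) (auto simp: time_changes_def)
qed

lemma skorohod_dist_less_iff:
  fixes x y :: "real \<Rightarrow> circle"
  assumes "0 \<le> T"
  shows "skorohod_dist T x y < e \<longleftrightarrow>
    (\<exists>\<tau>\<in>time_changes T. \<exists>e'<e. \<forall>t\<in>{0..T}. \<bar>\<tau> t - t\<bar> \<le> e' \<and> dist (x t) (y (\<tau> t)) \<le> e')"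
proof -
  define c where "c = (\<lambda>\<tau>. max (SUP t\<in>{0..T}. \<bar>\<tau> t - t\<bar>) (SUP t\<in>{0..T}. dist (x t) (y (\<tau> t))))"
  have bdd1: "bdd_above ((\<lambda>t. \<bar>\<tau> t - t\<bar>) ` {0..T})" if "\<tau> \<in> time_changes T" for \<tau>
    using time_changes_mem[OF that] by (intro bdd_aboveI[of _ T]) (fastforce simp: abs_if)
  have bdd2: "bdd_above ((\<lambda>t. dist (x t) (y (\<tau> t))) ` {0..T})" for \<tau>
    by (intro bdd_aboveI[of _ 1]) (auto intro: dist_circle_le)
  have ne: "{0..T} \<noteq> {}" using assms by simp
  have c_le: "c \<tau> \<le> e' \<longleftrightarrow> (\<forall>t\<in>{0..T}. \<bar>\<tau> t - t\<bar> \<le> e' \<and> dist (x t) (y (\<tau> t)) \<le> e')"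
    if "\<tau> \<in> time_changes T" for \<tau> e'
    unfolding c_def max.bounded_iff cSUP_le_iff[OF ne bdd1[OF that]] cSUP_le_iff[OF ne bdd2] by blast
  have "0 \<le> c \<tau>" if "\<tau> \<in> time_changes T" for \<tau>
    using c_le[OF that, of "c \<tau>"] assms by (smt (verit) atLeastAtMost_iff)
  then have "bdd_below (c ` time_changes T)" by (intro bdd_belowI[of _ 0]) auto
  then have "skorohod_dist T x y < e \<longleftrightarrow> (\<exists>\<tau>\<in>time_changes T. c \<tau> < e)"
    unfolding skorohod_dist_def c_def[symmetric]
    using time_changes_id by (subst cINF_less_iff) auto
  also have "\<dots> \<longleftrightarrow> (\<exists>\<tau>\<in>time_changes T. \<exists>e'<e. c \<tau> \<le> e')"
    by (meson order.refl le_less_trans)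
  finally show ?thesis using c_le by blast
qed

lemma Metric_space_skorohod:
  assumes "0 \<le> T"
  shows "Metric_space (cadlag_paths T :: (real \<Rightarrow> circle) set) (skorohod_dist T)"
proof
  note less_iff = skorohod_dist_less_iff[OF assms]
  fix x y z :: "real \<Rightarrow> circle"
  show nonneg: "0 \<le> skorohod_dist T x y" for x y :: "real \<Rightarrow> circle"
  proof (rule ccontr)
    assume "\<not> 0 \<le> skorohod_dist T x y"
    then obtain \<tau> e' where "e' < 0" "\<forall>t\<in>{0..T}. \<bar>\<tau> t - t\<bar> \<le> e'"
      using less_iff[of x y 0] by force
    then show False using assms by (metis abs_ge_zero atLeastAtMost_iff order.refl leD order_trans)
  qed
  have comm_less: "skorohod_dist T y x < e" if "skorohod_dist T x y < e" for x y :: "real \<Rightarrow> circle" and e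
  proof -
    obtain \<tau> e' where *: "\<tau> \<in> time_changes T" "e' < e"
      "\<And>t. t \<in> {0..T} \<Longrightarrow> \<bar>\<tau> t - t\<bar> \<le> e' \<and> dist (x t) (y (\<tau> t)) \<le> e'"
      using \<open>skorohod_dist T x y < e\<close> less_iff by blast
    obtain \<sigma> where \<sigma>: "\<sigma> \<in> time_changes T" "\<And>t. t \<in> {0..T} \<Longrightarrow> \<tau> (\<sigma> t) = t"
      using time_changes_inverse[OF *(1)] by blast
    have "\<bar>\<sigma> t - t\<bar> \<le> e' \<and> dist (y t) (x (\<sigma> t)) \<le> e'" if "t \<in> {0..T}" for t
      using *(3)[OF time_changes_mem[OF \<sigma>(1) that]] \<sigma>(2)[OF that]
      by (simp add: dist_commute abs_minus_commute)
    with \<sigma>(1) \<open>e' < e\<close> show ?thesis using less_iff by blast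
  qed
  show comm: "skorohod_dist T x y = skorohod_dist T y x" for x y :: "real \<Rightarrow> circle"
    using comm_less by (metis linorder_neqE_linordered_idom order_less_irrefl)
  show "skorohod_dist T x z \<le> skorohod_dist T x y + skorohod_dist T y z"
  proof (rule field_le_epsilon)
    fix e :: real assume "0 < e"
    obtain \<tau> a where 1: "\<tau> \<in> time_changes T" "a < skorohod_dist T x y + e/2"
      "\<And>t. t \<in> {0..T} \<Longrightarrow> \<bar>\<tau> t - t\<bar> \<le> a \<and> dist (x t) (y (\<tau> t)) \<le> a"
      using less_iff[of x y "skorohod_dist T x y + e/2"] \<open>0 < e\<close> by auto
    obtain \<sigma> b where 2: "\<sigma> \<in> time_changes T" "b < skorohod_dist T y z + e/2"
      "\<And>t. t \<in> {0..T} \<Longrightarrow> \<bar>\<sigma> t - t\<bar> \<le> b \<and> dist (y t) (z (\<sigma> t)) \<le> b"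
      using less_iff[of y z "skorohod_dist T y z + e/2"] \<open>0 < e\<close> by auto
    have "\<bar>\<sigma> (\<tau> t) - t\<bar> \<le> a + b \<and> dist (x t) (z (\<sigma> (\<tau> t))) \<le> a + b" if "t \<in> {0..T}" for t
      using 1(3)[OF that] 2(3)[OF time_changes_mem[OF 1(1) that]]
        dist_triangle[of "x t" "z (\<sigma> (\<tau> t))" "y (\<tau> t)"] by linarith
    moreover have "a + b < skorohod_dist T x y + skorohod_dist T y z + e"
      using 1(2) 2(2) by simp
    ultimately have "skorohod_dist T x z < skorohod_dist T x y + skorohod_dist T y z + e"
      unfolding less_iff by (intro bexI[OF _ time_changes_comp[OF 2(1) 1(1)]] exI[of _ "a + b"]) blast
    then show "skorohod_dist T x z \<le> skorohod_dist T x y + skorohod_dist T y z + e" by simp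
  qed
  assume x: "x \<in> cadlag_paths T" and y: "y \<in> cadlag_paths T"
  show "skorohod_dist T x y = 0 \<longleftrightarrow> x = y"
  proof
    assume "x = y"
    have "skorohod_dist T x x < e" if "0 < e" for e
      unfolding less_iff using that by (intro bexI[OF _ time_changes_id] exI[of _ 0]) auto
    then show "skorohod_dist T x y = 0"
      using nonneg[of x x] \<open>x = y\<close> by (metis less_irrefl order_le_imp_less_or_eq)
  next
    assume zero: "skorohod_dist T x y = 0"
    have near: "\<exists>u\<in>{0..T}. \<bar>u - t\<bar> < e \<and> dist (x t) (y u) < e" if "t \<in> {0..T}" "0 < e" for t e
    proof -
      obtain \<tau> e' where "\<tau> \<in> time_changes T" "e' < e"
        "\<And>t. t \<in> {0..T} \<Longrightarrow> \<bar>\<tau> t - t\<bar> \<le> e' \<and> dist (x t) (y (\<tau> t)) \<le> e'"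
        using less_iff[of x y e] zero \<open>0 < e\<close> by auto
      then show ?thesis
        using time_changes_mem[of \<tau> T t] \<open>t \<in> {0..T}\<close> by (meson le_less_trans)
    qed
    have before_T: "x t = y t" if t: "t \<in> {0..<T}" for t
    proof (rule ccontr)
      assume "x t \<noteq> y t"
      define e where "e = dist (x t) (y t) / 3"
      have "0 < e" using \<open>x t \<noteq> y t\<close> by (simp add: e_def)
      have "\<forall>\<^sub>F s in at_right t. dist (x s) (x t) < e" "\<forall>\<^sub>F s in at_right t. dist (y s) (y t) < e"
        using x y t \<open>0 < e\<close> by (auto simp: cadlag_paths_def intro: tendstoD)
      moreover have "\<forall>\<^sub>F s in at_right t. s < T"
        using t by (auto simp: eventually_at_right[of t T])
      ultimately have "\<forall>\<^sub>F s in at_right t. dist (x s) (x t) < e \<and> dist (y s) (y t) < e \<and> s < T"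
        by eventually_elim simp
      then obtain b where b: "b > t"
        "\<And>s. t < s \<Longrightarrow> s < b \<Longrightarrow> dist (x s) (x t) < e \<and> dist (y s) (y t) < e \<and> s < T"
        unfolding eventually_at_right_field by blast
      define s where "s = (t + b) / 2"
      have s: "t < s" "s < b" using b(1) by (auto simp: s_def)
      have "s \<in> {0..T}" using b(2)[OF s] s t by auto
      then obtain u where u: "\<bar>u - s\<bar> < min e (s - t)" "dist (x s) (y u) < min e (s - t)"
        using near[of s "min e (s - t)"] \<open>0 < e\<close> s by auto
      have "t < u" "u < b" using u(1) by (auto simp: s_def abs_if min_def field_simps split: if_splits)
      then have "dist (y u) (y t) < e" using b(2) by blast
      moreover have "dist (x s) (x t) < e" using b(2)[OF s] by simp
      moreover have "dist (x s) (y u) < e" using u(2) by simp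
      ultimately have "dist (x t) (y t) < 3 * e"
        using dist_triangle[of "x t" "y t" "x s"] dist_triangle[of "x s" "y t" "y u"]
        by (simp add: dist_commute)
      then show False by (simp add: e_def)
    qed
    have at_T: "x T = y T"
    proof (rule ccontr)
      assume "x T \<noteq> y T"
      then obtain \<tau> e' where \<tau>: "\<tau> \<in> time_changes T" "e' < dist (x T) (y T)"
        "\<And>t. t \<in> {0..T} \<Longrightarrow> dist (x t) (y (\<tau> t)) \<le> e'"
        using less_iff[of x y "dist (x T) (y T)"] zero by auto
      have "\<tau> T = T"
      proof -
        obtain s where s: "s \<in> {0..T}" "\<tau> s = T"
          using \<tau>(1) assms unfolding time_changes_def
          by (smt (verit) atLeastAtMost_iff imageE mem_Collect_eq)
        have "\<tau> s \<le> \<tau> T"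
          using \<tau>(1) s assms by (intro strict_mono_on_leD[of "{0..T}" \<tau>]) (auto simp: time_changes_def)
        then show ?thesis using s time_changes_mem[OF \<tau>(1), of T] assms by auto
      qed
      then show False using \<tau>(2) \<tau>(3)[of T] assms by auto
    qed
    show "x = y"
    proof
      fix t show "x t = y t"
        using x y before_T[of t] at_T
        by (cases "t \<in> {0..<T}"; cases "t = T") (auto simp: cadlag_paths_def extensional_def)
    qed
  qed
qed


section \<open>The random walk\<close>

definition grid :: "nat \<Rightarrow> circle set" where
  "grid k = (\<lambda>j. circle_of_real (real j / real k)) ` {..<k}"

definition grid_laplacian :: "nat \<Rightarrow> (circle \<Rightarrow> real) \<Rightarrow> circle \<Rightarrow> real" where
  "grid_laplacian k f x =
     (f (circle_shift (1 / real k) x) - f x) + (f (circle_shift (- 1 / real k) x) - f x)"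

definition markov_semigroup :: "'s set \<Rightarrow> (real \<Rightarrow> 's \<Rightarrow> 's \<Rightarrow> real) \<Rightarrow> bool" where
  "markov_semigroup S p \<longleftrightarrow>
     (\<forall>t\<ge>0. \<forall>x\<in>S. (\<forall>y\<in>S. 0 \<le> p t x y) \<and> (\<Sum>y\<in>S. p t x y) = 1) \<and>
     (\<forall>x\<in>S. \<forall>y\<in>S. p 0 x y = (if x = y then 1 else 0)) \<and>
     (\<forall>s\<ge>0. \<forall>t\<ge>0. \<forall>x\<in>S. \<forall>y\<in>S. p (s + t) x y = (\<Sum>z\<in>S. p s x z * p t z y))"

definition has_generator ::
    "'s set \<Rightarrow> (real \<Rightarrow> 's \<Rightarrow> 's \<Rightarrow> real) \<Rightarrow> (('s \<Rightarrow> real) \<Rightarrow> 's \<Rightarrow> real) \<Rightarrow> bool" where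
  "has_generator S p G \<longleftrightarrow>
     (\<forall>f. \<forall>x\<in>S. ((\<lambda>t. ((\<Sum>y\<in>S. p t x y * f y) - f x) / t) \<longlongrightarrow> G f x) (at_right 0))"

text \<open>The Markov property with transition probabilities \<open>p\<close>, for a process started at \<open>x\<close>.\<close>

definition markov_process_from ::
    "real \<Rightarrow> 's set \<Rightarrow> (real \<Rightarrow> 's \<Rightarrow> 's \<Rightarrow> real) \<Rightarrow> 's \<Rightarrow> 'a measure \<Rightarrow> ('a \<Rightarrow> real \<Rightarrow> 's) \<Rightarrow> bool"
  where
  "markov_process_from T S p x M X \<longleftrightarrow>
     (\<forall>n t a. t 0 = 0 \<and> (\<forall>i<n. t i \<le> t (Suc i)) \<and> t n \<le> T \<and> (\<forall>i\<le>n. a i \<in> S) \<longrightarrow>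
        measure M {\<omega> \<in> space M. \<forall>i\<le>n. X \<omega> (t i) = a i} =
        (if a 0 = x then \<Prod>i<n. p (t (Suc i) - t i) (a i) (a (Suc i)) else 0))"

definition random_walk ::
    "real \<Rightarrow> nat \<Rightarrow> circle \<Rightarrow> 'a measure \<Rightarrow> ('a \<Rightarrow> real \<Rightarrow> circle) \<Rightarrow> bool" where
  "random_walk T k x M X \<longleftrightarrow>
     prob_space M \<and> X \<in> measurable M (skorohod_borel T) \<and>
     (\<forall>\<omega>\<in>space M. \<forall>t\<in>{0..T}. X \<omega> t \<in> grid k) \<and>
     (\<exists>p. markov_semigroup (grid k) p \<and>
          has_generator (grid k) p (\<lambda>f y. real k * grid_laplacian k f y) \<and>
          markov_process_from T (grid k) p x M X)"


section \<open>The rate function\<close>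

definition abs_cont_paths :: "real \<Rightarrow> (real \<Rightarrow> circle) set" where
  "abs_cont_paths T = {\<gamma> \<in> extensional {0..T}.
     \<forall>\<epsilon>>0. \<exists>\<delta>>0. \<forall>n. \<forall>s t :: nat \<Rightarrow> real.
       (\<forall>i<n. 0 \<le> s i \<and> s i \<le> t i \<and> t i \<le> T) \<and>
       disjoint_family_on (\<lambda>i. {s i<..<t i}) {..<n} \<and>
       (\<Sum>i<n. t i - s i) < \<delta> \<longrightarrow>
       (\<Sum>i<n. dist (\<gamma> (t i)) (\<gamma> (s i))) < \<epsilon>}"

definition rate_density :: "real \<Rightarrow> real" where
  "rate_density v = v * ln ((v + sqrt (v\<^sup>2 + 4)) / 2) - sqrt (v\<^sup>2 + 4) + 2"

lemma rate_density_nonneg: "0 \<le> rate_density v"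
proof -
  define r where "r = sqrt (v\<^sup>2 + 4)"
  define w where "w = (v + r) / 2"
  have r2: "r\<^sup>2 = v\<^sup>2 + 4" by (simp add: r_def)
  have "\<bar>v\<bar> < r" unfolding r_def by (rule real_less_rsqrt) simp
  then have "0 < w" by (simp add: w_def abs_if split: if_splits)
  have "w * (r - v) = 2" using r2 by (simp add: w_def field_simps power2_eq_square)
  then have "1 / w = (r - v) / 2" using \<open>0 < w\<close> by (simp add: field_simps)
  then have v: "v = w - 1 / w" and r: "r = w + 1 / w" by (simp_all add: w_def field_simps)
  have eq: "rate_density v = v * ln w - r + 2" by (simp add: rate_density_def w_def r_def)
  show ?thesis
  proof (cases "1 \<le> w")
    case True
    have "ln (1 / w) \<le> 1 / w - 1" using \<open>0 < w\<close> by (intro ln_le_minus_one) simp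
    then have "1 - 1 / w \<le> ln w" using \<open>0 < w\<close> by (simp add: ln_div)
    moreover have "1 / w \<le> 1" using True by simp
    then have "0 \<le> v" using True v by linarith
    ultimately have "v * (1 - 1 / w) \<le> v * ln w" by (rule mult_left_mono)
    moreover have "v * (1 - 1 / w) - r + 2 = (1 - 1 / w)\<^sup>2"
      using \<open>0 < w\<close> unfolding v r by (simp add: power2_eq_square algebra_simps)
    ultimately show ?thesis using zero_le_power2[of "1 - 1 / w"] unfolding eq by linarith
  next
    case False
    have "ln w \<le> w - 1" using \<open>0 < w\<close> by (rule ln_le_minus_one)
    moreover have "1 \<le> 1 / w" using False \<open>0 < w\<close> by simp
    then have "v \<le> 0" using False v by linarith
    ultimately have "v * (w - 1) \<le> v * ln w" by (rule mult_left_mono_neg)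
    moreover have "v * (w - 1) - r + 2 = (w - 1)\<^sup>2"
      using \<open>0 < w\<close> unfolding v r by (simp add: power2_eq_square field_simps)
    ultimately show ?thesis using zero_le_power2[of "w - 1"] unfolding eq by linarith
  qed
qed

text \<open>The integrand is nonnegative by \<open>rate_density_nonneg\<close>, so \<^const>\<open>ennreal\<close> does not truncate it.\<close>

definition action :: "real \<Rightarrow> (real \<Rightarrow> circle) \<Rightarrow> ereal" where
  "action T \<gamma> =
     (if \<gamma> \<in> abs_cont_paths T
      then enn2ereal (\<integral>\<^sup>+s\<in>{0..T}. ennreal (rate_density (circle_deriv \<gamma> s)) \<partial>lebesgue)
      else \<infinity>)"

text \<open>
  A rate function for walks started near \<open>x\<^sub>0\<close> has to be infinite on paths that start elsewhere:
  \<^const>\<open>action\<close> vanishes on every constant path, but for \<open>y \<noteq> x\<^sub>0\<close> the open set of paths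
  whose starting point is close to \<open>y\<close> has probability zero for all large \<open>k\<close>.
\<close>

definition rate_function :: "real \<Rightarrow> circle \<Rightarrow> (real \<Rightarrow> circle) \<Rightarrow> ereal" where
  "rate_function T x\<^sub>0 \<gamma> = (if \<gamma> 0 = x\<^sub>0 then action T \<gamma> else \<infinity>)"

definition log_prob :: "real \<Rightarrow> ereal" where
  "log_prob p = (if 0 < p then ereal (ln p) else - \<infinity>)"

end

theory Submission
  imports Defs "HOL-Complex_Analysis.Great_Picard"
begin

text \<open>
  Put \<open>H q = 2 * cosh q - 2\<close> (\<open>cumulant\<close>). On the real line the generator of the walk multiplies
  \<open>exp (k * q * x)\<close> by \<open>k * H q\<close>, so over a time \<open>t\<close> the probability of a displacement \<open>d\<close> is at most
  \<open>exp (- k * (q * d - t * H q))\<close>, and the best \<open>q\<close> gives \<open>exp (- k * t * L (d / t))\<close>, where the Legendre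
  transform \<open>L\<close> of \<open>H\<close> is \<open>rate_density\<close>. On the circle \<open>cosh (k * q * dist x y)\<close> takes the place of the
  exponential (\<open>grid_laplacian_cosh_dist\<close>, \<open>transition_le\<close>). In the other direction the walk is
  displaced by \<open>a - b\<close> steps with at least the probability that two independent Poisson clocks of rate \<open>k\<close>
  ring \<open>a\<close> and \<open>b\<close> times, and suitable \<open>a\<close> and \<open>b\<close> give the same exponent (\<open>transition_ge\<close>,
  \<open>transition_lower_asymptotic\<close>).

  The rate function is handled through the inequalities
  \<open>q * (g t - g s) - (t - s) * H q \<le> A t - A s\<close>, for all \<open>q\<close> and \<open>s \<le> t\<close>, between a real lift \<open>g\<close> of a
  path and a function \<open>A\<close>, which is then called an action majorant. A path of finite action has the
  running action as such a majorant (\<open>action_self_majorant\<close>), and any majorant forces \<open>g\<close> to be absolutely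
  continuous with action at most \<open>A T - A 0\<close> (\<open>action_wrap_le\<close>). So action at most \<open>m\<close> means having a
  majorant of total increment at most \<open>m\<close>. The inequalities are linear in \<open>(g, A)\<close>, bound the modulus of
  continuity of \<open>g\<close>, and survive pointwise limits, and this makes the lifts from a fixed point with action at
  most \<open>m\<close> compact (\<open>action_majorant_compact\<close>). Derivatives enter only in
  comparing the integral with majorants; there it is needed that an absolutely continuous function is
  differentiable almost everywhere (\<open>abs_cont_differentiable\<close>) and is the integral of its derivative
  (\<open>abs_cont_has_integral\<close>).

  Upper bound. If \<open>m\<close> is less than the infimum of the rate function over the closed set \<open>C\<close>, then by
  compactness the paths in \<open>C\<close> stay uniformly at a positive distance from all lifts from \<open>x\<^sub>0\<close> of action
  at most \<open>m\<close> (\<open>closed_set_separated\<close>). Observe the walk at \<open>n\<close> equidistant times. Between these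
  times it moves by more than a given \<open>\<delta>\<close> with probability at most \<open>exp (- k * m)\<close> up to a factor, once the
  mesh is fine (\<open>rough_event_prob\<close>, from the maximal inequality \<open>hitting_prob_le\<close>). Otherwise it is close
  to the geodesic interpolation of its \<open>n + 1\<close> positions, so a path in \<open>C\<close> must have an interpolation of
  action more than \<open>m\<close>; each such skeleton has probability at most \<open>2 ^ n * exp (- k * m)\<close>, and there are
  at most \<open>k ^ (n + 1)\<close> of them (\<open>costly_paths\<close>).

  Lower bound. Around a path in the open set, prescribe the positions of the walk at the mesh times. The
  transition probabilities multiply to the exponent \<open>\<Sum> h * L (d / h)\<close>, which is at most the action by
  convexity, and between the mesh times the walk fluctuates little except with much smaller probability
  (\<open>prob_neighbourhood_ge\<close>).
\<close>

section \<open>Absolutely continuous functions\<close>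

definition clip :: "real \<Rightarrow> real \<Rightarrow> real \<Rightarrow> real" where
  "clip a b t = max a (min b t)"

lemma clip_mono: "s \<le> t \<Longrightarrow> clip a b s \<le> clip a b t"
  by (auto simp: clip_def)

lemma clip_between: "a \<le> b \<Longrightarrow> a \<le> clip a b t \<and> clip a b t \<le> b"
  by (auto simp: clip_def)

text \<open>
  Clipping to the pieces of a subdivision splits \<open>f (min t (u n)) - f (u 0)\<close> into one contribution per
  piece, wherever \<open>t\<close> lies relative to the subdivision points.
\<close>

lemma sum_clip:
  fixes f :: "real \<Rightarrow> real"
  assumes "\<And>i. i < n \<Longrightarrow> u i \<le> u (Suc i)" "u 0 \<le> t"
  shows "(\<Sum>i<n. f (clip (u i) (u (Suc i)) t) - f (u i)) = f (min t (u n)) - f (u 0)"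
  using assms
proof (induction n)
  case 0
  then show ?case by (simp add: min_absorb2)
next
  case (Suc n)
  have "u n \<le> u (Suc n)" using Suc.prems by simp
  then have "f (clip (u n) (u (Suc n)) t) - f (u n) = f (min t (u (Suc n))) - f (min t (u n))"
    by (cases "t \<le> u n"; cases "t \<le> u (Suc n)") (simp_all add: clip_def min_absorb1 min_absorb2 max_absorb1 max_absorb2)
  with Suc show ?case by simp
qed

text \<open>
  The condition that \<^const>\<open>abs_cont_paths\<close> imposes on circle-valued paths, for real functions.
\<close>

definition abs_cont :: "real \<Rightarrow> (real \<Rightarrow> real) \<Rightarrow> bool" where
  "abs_cont T f \<longleftrightarrow> (\<forall>\<epsilon>>0. \<exists>\<delta>>0. \<forall>n. \<forall>s t :: nat \<Rightarrow> real.
       (\<forall>i<n. 0 \<le> s i \<and> s i \<le> t i \<and> t i \<le> T) \<and>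
       disjoint_family_on (\<lambda>i. {s i<..<t i}) {..<n} \<and>
       (\<Sum>i<n. t i - s i) < \<delta> \<longrightarrow>
       (\<Sum>i<n. \<bar>f (t i) - f (s i)\<bar>) < \<epsilon>)"

lemma chain_mono:
  fixes u :: "nat \<Rightarrow> real"
  assumes "\<And>i. i < n \<Longrightarrow> u i \<le> u (Suc i)" "i \<le> j" "j \<le> n"
  shows "u i \<le> u j"
  using assms(2,3)
proof (induction j rule: dec_induct)
  case (step j)
  then show ?case using assms(1)[of j] by simp
qed simp

lemma chain_disjoint:
  fixes u :: "nat \<Rightarrow> real"
  assumes "\<And>i. i < n \<Longrightarrow> u i \<le> u (Suc i)"
  shows "disjoint_family_on (\<lambda>i. {u i<..<u (Suc i)}) {..<n}"
proof -
  have "{u i<..<u (Suc i)} \<inter> {u j<..<u (Suc j)} = {}" if "i < j" "j < n" for i j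
    using chain_mono[of n u "Suc i" j, OF assms] that by auto
  then show ?thesis
    unfolding disjoint_family_on_def by (metis Int_commute lessThan_iff nat_neq_iff)
qed

text \<open>
  A finite chain of points inside a short interval is a disjoint family of intervals of small total
  length. In this form the condition no longer mentions disjointness.
\<close>

lemma abs_cont_chain:
  assumes "abs_cont T f" "\<epsilon> > 0"
  shows "\<exists>\<delta>>0. \<forall>n u. (\<forall>i<n. u i \<le> u (Suc i)) \<and> 0 \<le> u 0 \<and> u n \<le> T \<and> u n - u 0 < \<delta> \<longrightarrow>
       (\<Sum>i<n. \<bar>f (u (Suc i)) - f (u i)\<bar>) < \<epsilon>"
proof -
  obtain \<delta> where "\<delta> > 0" and \<delta>: "\<forall>(n::nat) s t. (\<forall>i<n. 0 \<le> s i \<and> s i \<le> t i \<and> t i \<le> T) \<and>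
       disjoint_family_on (\<lambda>i. {s i<..<t i}) {..<n} \<and>
       (\<Sum>i<n. t i - s i) < \<delta> \<longrightarrow> (\<Sum>i<n. \<bar>f (t i) - f (s i)\<bar>) < \<epsilon>"
    using assms(1)[unfolded abs_cont_def, rule_format, OF assms(2)] by (elim exE conjE) (rule that)
  show ?thesis
  proof (intro exI[of _ \<delta>] conjI[OF \<open>\<delta> > 0\<close>] allI impI, elim conjE)
    fix n and u :: "nat \<Rightarrow> real"
    assume u: "\<forall>i<n. u i \<le> u (Suc i)" "0 \<le> u 0" "u n \<le> T" "u n - u 0 < \<delta>"
    have "0 \<le> u i \<and> u i \<le> u (Suc i) \<and> u (Suc i) \<le> T" if "i < n" for i
      using chain_mono[of n u 0 i, OF u(1)[rule_format]]
        chain_mono[of n u "Suc i" n, OF u(1)[rule_format]] u that by fastforce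
    moreover have "(\<Sum>i<n. u (Suc i) - u i) = u n - u 0" by (rule sum_lessThan_telescope)
    ultimately show "(\<Sum>i<n. \<bar>f (u (Suc i)) - f (u i)\<bar>) < \<epsilon>"
      using u(4) chain_disjoint[of n u, OF u(1)[rule_format]] by (intro \<delta>[rule_format] conjI) auto
  qed
qed

lemma abs_cont_continuous:
  assumes "abs_cont T f"
  shows "continuous_on {0..T} f"
  unfolding continuous_on_iff
proof (intro ballI allI impI)
  fix x \<epsilon> :: real assume x: "x \<in> {0..T}" "\<epsilon> > 0"
  obtain \<delta> where "\<delta> > 0" and \<delta>: "\<forall>n u. (\<forall>i<n. u i \<le> u (Suc i)) \<and> 0 \<le> u 0 \<and> u n \<le> T
      \<and> u n - u 0 < \<delta> \<longrightarrow> (\<Sum>i<n. \<bar>f (u (Suc i)) - f (u i)\<bar>) < \<epsilon>"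
    using abs_cont_chain[OF assms x(2)] by (elim exE conjE) (rule that)
  have "\<bar>f t - f s\<bar> < \<epsilon>" if "0 \<le> s" "s \<le> t" "t \<le> T" "t - s < \<delta>" for s t
    using \<delta>[rule_format, of 1 "\<lambda>i. if i = 0 then s else t"] that by simp
  from this[of x] this[of _ x]
  have "dist (f x') (f x) < \<epsilon>" if "x' \<in> {0..T}" "dist x' x < \<delta>" for x'
    using that x unfolding dist_real_def by (cases "x' \<le> x") (auto simp: abs_minus_commute[of "f x"])
  with \<open>\<delta> > 0\<close> show "\<exists>d>0. \<forall>x'\<in>{0..T}. dist x' x < d \<longrightarrow> dist (f x') (f x) < \<epsilon>"
    by blast
qed

lemma abs_cont_linear_minus:
  assumes "abs_cont T f"
  shows "abs_cont T (\<lambda>x. f x - c * x)"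
  unfolding abs_cont_def
proof (intro allI impI)
  fix \<epsilon> :: real assume "\<epsilon> > 0"
  obtain \<delta> where "\<delta> > 0" and \<delta>: "\<forall>(n::nat) s t. (\<forall>i<n. 0 \<le> s i \<and> s i \<le> t i \<and> t i \<le> T) \<and>
       disjoint_family_on (\<lambda>i. {s i<..<t i}) {..<n} \<and>
       (\<Sum>i<n. t i - s i) < \<delta> \<longrightarrow> (\<Sum>i<n. \<bar>f (t i) - f (s i)\<bar>) < \<epsilon> / 2"
    using assms[unfolded abs_cont_def, rule_format, OF half_gt_zero[OF \<open>\<epsilon> > 0\<close>]] by (elim exE conjE) (rule that)
  define \<delta>' where "\<delta>' = min \<delta> (\<epsilon> / (2 * (\<bar>c\<bar> + 1)))"
  have "\<delta>' > 0" using \<open>\<delta> > 0\<close> \<open>\<epsilon> > 0\<close> by (simp add: \<delta>'_def)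
  have "(\<Sum>i<n. \<bar>f (t i) - c * t i - (f (s i) - c * s i)\<bar>) < \<epsilon>"
    if *: "\<forall>i<n. 0 \<le> s i \<and> s i \<le> t i \<and> t i \<le> T" "disjoint_family_on (\<lambda>i. {s i<..<t i}) {..<n}"
      "(\<Sum>i<n. t i - s i) < \<delta>'" for n and s t :: "nat \<Rightarrow> real"
  proof -
    have "(\<Sum>i<n. \<bar>f (t i) - c * t i - (f (s i) - c * s i)\<bar>)
        \<le> (\<Sum>i<n. \<bar>f (t i) - f (s i)\<bar> + \<bar>c\<bar> * (t i - s i))"
    proof (rule sum_mono)
      fix i assume "i \<in> {..<n}"
      then have "s i \<le> t i" using * by auto
      then have "\<bar>c * (t i - s i)\<bar> = \<bar>c\<bar> * (t i - s i)" by (simp add: abs_mult)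
      then show "\<bar>f (t i) - c * t i - (f (s i) - c * s i)\<bar> \<le> \<bar>f (t i) - f (s i)\<bar> + \<bar>c\<bar> * (t i - s i)"
        by (simp add: algebra_simps)
    qed
    also have "\<dots> = (\<Sum>i<n. \<bar>f (t i) - f (s i)\<bar>) + \<bar>c\<bar> * (\<Sum>i<n. t i - s i)"
      by (simp add: sum.distrib sum_distrib_left)
    also have "(\<Sum>i<n. \<bar>f (t i) - f (s i)\<bar>) < \<epsilon> / 2"
      using * by (intro \<delta>[rule_format] conjI) (auto simp: \<delta>'_def)
    also have "\<bar>c\<bar> * (\<Sum>i<n. t i - s i) \<le> (\<bar>c\<bar> + 1) * (\<epsilon> / (2 * (\<bar>c\<bar> + 1)))"
      using * by (intro mult_mono sum_nonneg) (auto simp: \<delta>'_def)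
    also have "(\<bar>c\<bar> + 1) * (\<epsilon> / (2 * (\<bar>c\<bar> + 1))) = \<epsilon> / 2" by (simp add: field_simps)
    finally show ?thesis by simp
  qed
  with \<open>\<delta>' > 0\<close> show "\<exists>\<delta>>0. \<forall>n. \<forall>s t :: nat \<Rightarrow> real.
       (\<forall>i<n. 0 \<le> s i \<and> s i \<le> t i \<and> t i \<le> T) \<and>
       disjoint_family_on (\<lambda>i. {s i<..<t i}) {..<n} \<and>
       (\<Sum>i<n. t i - s i) < \<delta> \<longrightarrow>
       (\<Sum>i<n. \<bar>f (t i) - c * t i - (f (s i) - c * s i)\<bar>) < \<epsilon>" by blast
qed

text \<open>
  Cut \<open>[0,T]\<close> into \<open>N\<close> pieces so short that every chain within one piece has variation below 1. Clipping
  an arbitrary chain to each of the pieces shows that its variation is at most \<open>N\<close>.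
\<close>

lemma abs_cont_bounded_variation:
  assumes ac: "abs_cont T f" and "0 < T"
  shows "\<exists>B. \<forall>n u. (\<forall>i<n. u i \<le> u (Suc i)) \<and> 0 \<le> u 0 \<and> u n \<le> T \<longrightarrow>
       (\<Sum>i<n. \<bar>f (u (Suc i)) - f (u i)\<bar>) \<le> B"
proof -
  obtain \<delta> where "\<delta> > 0" and \<delta>: "\<forall>n u. (\<forall>i<n. u i \<le> u (Suc i)) \<and> 0 \<le> u 0 \<and> u n \<le> T
      \<and> u n - u 0 < \<delta> \<longrightarrow> (\<Sum>i<n. \<bar>f (u (Suc i)) - f (u i)\<bar>) < 1"
    using abs_cont_chain[OF ac zero_less_one] by (elim exE conjE) (rule that)
  obtain N where N: "T / \<delta> < real N" using reals_Archimedean2 by blast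
  then have "N > 0" using \<open>0 < T\<close> \<open>\<delta> > 0\<close> by (metis divide_pos_pos less_trans of_nat_0_less_iff)
  define v where "v l = real l * (T / real N)" for l
  have v: "v 0 = 0" "v N = T" "v l \<le> v (Suc l)" for l
    using \<open>N > 0\<close> \<open>0 < T\<close> by (auto simp: v_def field_simps)
  have v_step: "v (Suc l) - v l < \<delta>" for l
    using N \<open>N > 0\<close> \<open>\<delta> > 0\<close> by (simp add: v_def field_simps)
  show ?thesis
  proof (intro exI[of _ "real N"] allI impI, elim conjE)
    fix n and u :: "nat \<Rightarrow> real"
    assume u: "\<forall>i<n. u i \<le> u (Suc i)" "0 \<le> u 0" "u n \<le> T"
    define c where "c l x = clip (v l) (v (Suc l)) x" for l x
    have range: "0 \<le> u i \<and> u i \<le> T" if "i \<le> n" for i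
      using chain_mono[of n u 0 i, OF u(1)[rule_format]] chain_mono[of n u i n, OF u(1)[rule_format]] u that by simp
    have dec: "f x = f 0 + (\<Sum>l<N. f (c l x) - f (v l))" if "0 \<le> x \<and> x \<le> T" for x
      using sum_clip[of N v x f] v that by (simp add: c_def min_absorb1)
    have "(\<Sum>i<n. \<bar>f (u (Suc i)) - f (u i)\<bar>) \<le> (\<Sum>i<n. \<Sum>l<N. \<bar>f (c l (u (Suc i))) - f (c l (u i))\<bar>)"
    proof (rule sum_mono)
      fix i assume "i \<in> {..<n}"
      then have "f (u (Suc i)) - f (u i) = (\<Sum>l<N. f (c l (u (Suc i))) - f (c l (u i)))"
        using dec[of "u (Suc i)"] dec[of "u i"] range[of i] range[of "Suc i"]
        by (simp flip: sum_subtractf)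
      then show "\<bar>f (u (Suc i)) - f (u i)\<bar> \<le> (\<Sum>l<N. \<bar>f (c l (u (Suc i))) - f (c l (u i))\<bar>)"
        using sum_abs by metis
    qed
    also have "\<dots> = (\<Sum>l<N. \<Sum>i<n. \<bar>f (c l (u (Suc i))) - f (c l (u i))\<bar>)" by (rule sum.swap)
    also have "\<dots> \<le> (\<Sum>l<N. 1)"
    proof (rule sum_mono)
      fix l assume "l \<in> {..<N}"
      have b: "v l \<le> c l x \<and> c l x \<le> v (Suc l)" for x
        using clip_between v by (simp add: c_def)
      have "0 \<le> v l" using v \<open>0 < T\<close> by (simp add: v_def)
      moreover have "v (Suc l) \<le> T"
        using \<open>l \<in> {..<N}\<close> chain_mono[of N v "Suc l" N] v by auto
      ultimately have "(\<Sum>i<n. \<bar>f (c l (u (Suc i))) - f (c l (u i))\<bar>) < 1"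
        using b[of "u 0"] b[of "u n"] v_step[of l] u
        by (intro \<delta>[rule_format, of n "\<lambda>i. c l (u i)"]) (auto simp: c_def clip_mono)
      then show "(\<Sum>i<n. \<bar>f (c l (u (Suc i))) - f (c l (u i))\<bar>) \<le> 1" by simp
    qed
    finally show "(\<Sum>i<n. \<bar>f (u (Suc i)) - f (u i)\<bar>) \<le> real N" by simp
  qed
qed

text \<open>
  \<open>V t\<close> is the total variation on \<open>[0,t]\<close>. Besides dominating the increments of \<open>f\<close> it is nearly
  attained along a single subdivision, and this is what makes the variation not explained by that
  subdivision arbitrarily small in \<open>no_oscillating_slopes\<close>.
\<close>

lemma abs_cont_variation:
  assumes ac: "abs_cont T f" and "0 < T"
  shows "\<exists>V :: real \<Rightarrow> real. (\<forall>s t. 0 \<le> s \<and> s \<le> t \<and> t \<le> T \<longrightarrow> \<bar>f t - f s\<bar> \<le> V t - V s) \<and>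
    (\<forall>\<eta>>0. \<exists>n u. (\<forall>i<n. u i \<le> u (Suc i)) \<and> u 0 = 0 \<and> u n = T \<and>
        V T - V 0 - \<eta> < (\<Sum>i<n. \<bar>f (u (Suc i)) - f (u i)\<bar>))"
proof -
  obtain B where B: "\<forall>n u. (\<forall>i<n. u i \<le> u (Suc i)) \<and> 0 \<le> u 0 \<and> u n \<le> T \<longrightarrow>
       (\<Sum>i<n. \<bar>f (u (Suc i)) - f (u i)\<bar>) \<le> B"
    using abs_cont_bounded_variation[OF assms] by (elim exE conjE) (rule that)
  define S where "S t = {(\<Sum>i<n. \<bar>f (u (Suc i)) - f (u i)\<bar>) | (n::nat) u.
      (\<forall>i<n. u i \<le> u (Suc i)) \<and> u 0 = 0 \<and> u n = t}" for t
  define V where "V t = Sup (S t)" for t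
  have bdd: "bdd_above (S t)" if "t \<le> T" for t
  proof (rule bdd_aboveI[of _ B])
    fix x assume "x \<in> S t"
    then obtain n and u :: "nat \<Rightarrow> real" where "x = (\<Sum>i<n. \<bar>f (u (Suc i)) - f (u i)\<bar>)"
      "\<forall>i<n. u i \<le> u (Suc i)" "u 0 = 0" "u n = t"
      unfolding S_def by auto
    then show "x \<le> B" using B[rule_format, of n u] that by simp
  qed
  have ne: "S t \<noteq> {}" if "0 \<le> t" for t
  proof -
    have "\<bar>f t - f 0\<bar> \<in> S t"
      unfolding S_def using that
      by (intro CollectI exI[of _ "1::nat"] exI[of _ "\<lambda>i::nat. if i = 0 then 0 else t"]) auto
    then show ?thesis by blast
  qed
  have incr: "\<bar>f t - f s\<bar> \<le> V t - V s" if "0 \<le> s" "s \<le> t" "t \<le> T" for s t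
  proof -
    have "Sup (S s) \<le> V t - \<bar>f t - f s\<bar>"
    proof (rule cSup_least[OF ne[OF that(1)]])
      fix x assume "x \<in> S s"
      then obtain n and u :: "nat \<Rightarrow> real" where u: "x = (\<Sum>i<n. \<bar>f (u (Suc i)) - f (u i)\<bar>)"
        "\<forall>i<n. u i \<le> u (Suc i)" "u 0 = 0" "u n = s"
        unfolding S_def by auto
      define w where "w = u(Suc n := t)"
      have "(\<Sum>i<Suc n. \<bar>f (w (Suc i)) - f (w i)\<bar>) = x + \<bar>f t - f s\<bar>"
        using u by (simp add: w_def)
      moreover have "(\<forall>i<Suc n. w i \<le> w (Suc i)) \<and> w 0 = 0 \<and> w (Suc n) = t"
        using u that by (auto simp: w_def less_Suc_eq)
      ultimately have "x + \<bar>f t - f s\<bar> \<in> S t"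
        unfolding S_def by (intro CollectI exI[of _ "Suc n"] exI[of _ w]) simp
      then show "x \<le> V t - \<bar>f t - f s\<bar>"
        using cSup_upper[OF _ bdd[OF that(3)]] by (force simp: V_def)
    qed
    then show ?thesis by (simp add: V_def)
  qed
  have V0: "0 \<le> V 0"
  proof -
    have "0 \<in> S 0" unfolding S_def by (intro CollectI exI[of _ 0] exI[of _ "\<lambda>_. 0"]) simp
    then show ?thesis unfolding V_def using bdd \<open>0 < T\<close> by (intro cSup_upper) auto
  qed
  have near: "\<exists>n u. (\<forall>i<n. u i \<le> u (Suc i)) \<and> u 0 = 0 \<and> u n = T \<and>
        V T - V 0 - \<eta> < (\<Sum>i<n. \<bar>f (u (Suc i)) - f (u i)\<bar>)" if "\<eta> > 0" for \<eta>
  proof -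
    have "V T - \<eta> < Sup (S T)" using that by (simp add: V_def)
    then obtain x where "x \<in> S T" "V T - \<eta> < x"
      using less_cSupE[OF _ ne] \<open>0 < T\<close> by force
    then obtain n and u :: "nat \<Rightarrow> real" where "x = (\<Sum>i<n. \<bar>f (u (Suc i)) - f (u i)\<bar>)"
      "\<forall>i<n. u i \<le> u (Suc i)" "u 0 = 0" "u n = T"
      unfolding S_def by auto
    with \<open>V T - \<eta> < x\<close> V0 show ?thesis
      by (intro exI[of _ n] exI[of _ u]) simp
  qed
  show ?thesis using incr near by (intro exI[of _ V] conjI allI impI) simp_all
qed

section \<open>Differentiability almost everywhere\<close>

text \<open>
  Remove the interval with the largest right end: by disjointness all others end before it starts.
  Degenerate intervals contribute nothing and are discarded first, since an empty interval is disjoint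
  from everything.
\<close>

lemma sum_disjoint_increments_le:
  fixes A :: "real \<Rightarrow> real" and s t :: "'i \<Rightarrow> real"
  assumes "finite F" and mono: "\<And>x y. c \<le> x \<Longrightarrow> x \<le> y \<Longrightarrow> y \<le> d \<Longrightarrow> A x \<le> A y" and "c \<le> d"
    and st: "\<And>i. i \<in> F \<Longrightarrow> c \<le> s i \<and> s i \<le> t i \<and> t i \<le> d"
    and disj: "disjoint_family_on (\<lambda>i. {s i<..<t i}) F"
  shows "(\<Sum>i\<in>F. A (t i) - A (s i)) \<le> A d - A c"
proof -
  define G where "G = {i \<in> F. s i < t i}"
  have "finite G" using \<open>finite F\<close> by (simp add: G_def)
  have eq: "(\<Sum>i\<in>F. A (t i) - A (s i)) = (\<Sum>i\<in>G. A (t i) - A (s i))"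
    using st \<open>finite F\<close> by (intro sum.mono_neutral_right) (force simp: G_def not_less)+
  have sub: "(\<Sum>i\<in>H. A (t i) - A (s i)) \<le> A b - A c"
    if "finite H" "b \<le> d" "c \<le> b" "\<And>i. i \<in> H \<Longrightarrow> t i \<le> b" "H \<subseteq> G" for H b
    using that
  proof (induction H arbitrary: b rule: finite_ranking_induct[where f = t])
    case empty
    then show ?case using mono[of c b] by simp
  next
    case (insert j H)
    have j: "j \<in> F" "s j < t j" "t j \<le> b" using insert.prems by (auto simp: G_def)
    show ?case
    proof (cases "j \<in> H")
      case True
      then have "insert j H = H" by (rule insert_absorb)
      then show ?thesis using insert.IH[of b] insert.prems by auto
    next
      case False
      have "(\<Sum>i\<in>H. A (t i) - A (s i)) \<le> A (s j) - A c"
      proof (rule insert.IH)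
        show "s j \<le> d" "c \<le> s j" using st[OF j(1)] by auto
        show "H \<subseteq> G" using insert.prems by auto
        fix i assume "i \<in> H"
        then have i: "i \<in> F" "s i < t i" "t i \<le> t j" "i \<noteq> j"
          using insert.prems insert.hyps(2)[of i] False by (auto simp: G_def)
        then have "{s i<..<t i} \<inter> {s j<..<t j} = {}"
          using j by (intro disjoint_family_onD[OF disj]) auto
        moreover have "(max (s i) (s j) + t i) / 2 \<in> {s i<..<t i} \<inter> {s j<..<t j}" if "s j < t i"
          using that i j by (auto simp: max_def)
        ultimately have "\<not> s j < t i" by (simp only: empty_iff) blast
        then show "t i \<le> s j" by simp
      qed
      moreover have "A (t j) \<le> A b" using mono[of "t j" b] st[OF j(1)] j insert.prems(1) by auto
      ultimately show ?thesis using False insert.hyps(1) by simp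
    qed
  qed
  have "t i \<le> d" if "i \<in> G" for i using st that by (simp add: G_def)
  then show ?thesis unfolding eq by (intro sub \<open>finite G\<close> order_refl \<open>c \<le> d\<close>)
qed

text \<open>
  A maximal inequality for a nondecreasing function. By Vitali's lemma, disjoint steep intervals can be chosen
  whose fivefold enlargements cover \<open>E\<close>, and the increments of \<open>w\<close> over them add up to at most
  \<open>w d - w c\<close>.
\<close>

lemma steep_points_measure_le:
  fixes w :: "real \<Rightarrow> real"
  assumes mono: "\<And>s t. c \<le> s \<Longrightarrow> s \<le> t \<Longrightarrow> t \<le> d \<Longrightarrow> w s \<le> w t" and "c \<le> d" "\<beta> > 0"
    and steep: "\<And>x. x \<in> E \<Longrightarrow>
      \<exists>s t. c \<le> s \<and> s < t \<and> t \<le> d \<and> x \<in> {s..t} \<and> \<beta> * (t - s) \<le> w t - w s"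
  obtains U where "E \<subseteq> U" "U \<in> lmeasurable" "measure lebesgue U \<le> 5 * (w d - w c) / \<beta>"
proof -
  define K where "K = {(s, t). c \<le> s \<and> s < t \<and> t \<le> d \<and> \<beta> * (t - s) \<le> w t - w s}"
  define a where "a = (\<lambda>I::real\<times>real. (fst I + snd I) / 2)"
  define r where "r = (\<lambda>I::real\<times>real. (snd I - fst I) / 2)"
  have cb: "cball (a I) (r I) = {fst I..snd I}" for I
    unfolding a_def r_def cball_eq_atLeastAtMost by (simp add: field_simps)
  have cov: "E \<subseteq> (\<Union>I\<in>K. cball (a I) (r I))"
  proof
    fix x assume "x \<in> E"
    then obtain s t where "c \<le> s" "s < t" "t \<le> d" "x \<in> {s..t}" "\<beta> * (t - s) \<le> w t - w s"
      using steep by blast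
    then show "x \<in> (\<Union>I\<in>K. cball (a I) (r I))"
      unfolding cb K_def by (intro UN_I[of "(s, t)"]) simp_all
  qed
  have rad: "0 < r I \<and> r I \<le> (d - c) / 2" if "I \<in> K" for I
    using that by (auto simp: K_def r_def)
  obtain C where C: "countable C" "C \<subseteq> K"
     "pairwise (\<lambda>i j. disjnt (cball (a i) (r i)) (cball (a j) (r j))) C"
     "E \<subseteq> (\<Union>i\<in>C. cball (a i) (5 * r i))"
    by (rule Vitali_covering_lemma_cballs[OF cov rad])
  define U where "U = (\<Union>i\<in>C. cball (a i) (5 * r i))"
  have bound: "(\<Sum>i\<in>F. measure lebesgue (cball (a i) (5 * r i))) \<le> 5 * (w d - w c) / \<beta>"
    if "F \<subseteq> C" "finite F" for F
  proof -
    have FK: "I \<in> K" if "I \<in> F" for I using that \<open>F \<subseteq> C\<close> C(2) by blast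
    have "measure lebesgue (cball (a I) (5 * r I)) \<le> 5 / \<beta> * (w (snd I) - w (fst I))" if "I \<in> F" for I
    proof -
      have "measure lebesgue (cball (a I) (5 * r I)) = 5 * (snd I - fst I)"
        using rad[OF FK[OF that]] by (simp add: cball_eq_atLeastAtMost r_def field_simps)
      also have "\<beta> * (snd I - fst I) \<le> w (snd I) - w (fst I)" using FK[OF that] by (auto simp: K_def)
      then have "5 * (snd I - fst I) \<le> 5 / \<beta> * (w (snd I) - w (fst I))"
        using \<open>\<beta> > 0\<close> by (simp add: field_simps)
      finally show ?thesis .
    qed
    then have "(\<Sum>i\<in>F. measure lebesgue (cball (a i) (5 * r i))) \<le> 5 / \<beta> * (\<Sum>I\<in>F. w (snd I) - w (fst I))"
      unfolding sum_distrib_left by (rule sum_mono)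
    moreover have "(\<Sum>I\<in>F. w (snd I) - w (fst I)) \<le> w d - w c"
    proof (rule sum_disjoint_increments_le[where A = w and s = fst and t = snd])
      show "w s \<le> w t" if "c \<le> s" "s \<le> t" "t \<le> d" for s t using that by (rule mono)
      show "c \<le> fst I \<and> fst I \<le> snd I \<and> snd I \<le> d" if "I \<in> F" for I
        using FK[OF that] by (auto simp: K_def)
      show "disjoint_family_on (\<lambda>I. {fst I<..<snd I}) F"
        unfolding disjoint_family_on_def
      proof (intro ballI impI)
        fix I J assume IJ: "I \<in> F" "J \<in> F" "I \<noteq> J"
        then have "disjnt (cball (a I) (r I)) (cball (a J) (r J))"
          using C(3) \<open>F \<subseteq> C\<close> by (meson pairwiseD subsetD)
        then have "{fst I..snd I} \<inter> {fst J..snd J} = {}" unfolding cb disjnt_def .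
        moreover have "{fst I<..<snd I} \<inter> {fst J<..<snd J} \<subseteq> {fst I..snd I} \<inter> {fst J..snd J}" by auto
        ultimately show "{fst I<..<snd I} \<inter> {fst J<..<snd J} = {}" by blast
      qed
    qed (fact \<open>finite F\<close> \<open>c \<le> d\<close>)+
    then have "5 / \<beta> * (\<Sum>I\<in>F. w (snd I) - w (fst I)) \<le> 5 / \<beta> * (w d - w c)"
      using \<open>\<beta> > 0\<close> by (intro mult_left_mono) auto
    ultimately show ?thesis by simp
  qed
  have ubound: "measure lebesgue (\<Union>i\<in>F. cball (a i) (5 * r i)) \<le> 5 * (w d - w c) / \<beta>"
    if "F \<subseteq> C" "finite F" for F
  proof -
    have "measure lebesgue (\<Union>i\<in>F. cball (a i) (5 * r i)) \<le> (\<Sum>i\<in>F. measure lebesgue (cball (a i) (5 * r i)))"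
      using that by (intro measure_UNION_le) auto
    then show ?thesis using bound[OF that] by linarith
  qed
  have "U \<in> lmeasurable"
    unfolding U_def by (rule fmeasurable_UN_bound[OF C(1) _ ubound]) simp_all
  moreover have "measure lebesgue U \<le> 5 * (w d - w c) / \<beta>"
    unfolding U_def by (rule measure_UN_bound[OF C(1) _ ubound]) simp_all
  ultimately show ?thesis using C(4) by (intro that[of U]) (simp_all add: U_def)
qed

text \<open>
  Take a subdivision along which \<open>f\<close> has almost all of its variation. On each piece let \<open>w\<close> be \<open>V\<close> minus
  or plus \<open>f\<close>, with the sign chosen so that the net increment of \<open>f\<close> is subtracted; then \<open>w\<close> is nondecreasing
  and its increments over all pieces add up to less than \<open>\<eta>\<close>. At a point of the set there are short steep
  intervals in the direction opposed to the net increment; on these \<open>V\<close> and the signed \<open>f\<close> both contribute, so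
  \<open>w\<close> has slope at least \<open>2 * \<alpha>\<close>, and the maximal inequality applies.
\<close>

lemma no_oscillating_slopes:
  assumes ac: "abs_cont T f" and "0 < T" "0 < \<alpha>"
  shows "negligible {x \<in> {0<..<T}. \<forall>e>0.
     (\<exists>s t. 0 \<le> s \<and> s < t \<and> t \<le> T \<and> x \<in> {s..t} \<and> t - s < e \<and> \<alpha> * (t - s) \<le> f t - f s) \<and>
     (\<exists>s t. 0 \<le> s \<and> s < t \<and> t \<le> T \<and> x \<in> {s..t} \<and> t - s < e \<and> \<alpha> * (t - s) \<le> f s - f t)}"
  (is "negligible ?N")
  unfolding negligible_outer_le
proof (intro allI impI)
  fix e :: real assume "e > 0"
  obtain V :: "real \<Rightarrow> real" where
    V': "\<forall>s t. 0 \<le> s \<and> s \<le> t \<and> t \<le> T \<longrightarrow> \<bar>f t - f s\<bar> \<le> V t - V s" and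
    near: "\<forall>\<eta>>0. \<exists>n u. (\<forall>i<n. u i \<le> u (Suc i)) \<and> u 0 = 0 \<and> u n = T \<and>
        V T - V 0 - \<eta> < (\<Sum>i<n. \<bar>f (u (Suc i)) - f (u i)\<bar>)"
    using abs_cont_variation[OF ac \<open>0 < T\<close>] by (elim exE conjE) (rule that)
  have V: "\<bar>f t - f s\<bar> \<le> V t - V s" if "0 \<le> s" "s \<le> t" "t \<le> T" for s t
    using V' that by simp
  \<comment> \<open>The maximal inequality with slope \<open>2 * \<alpha>\<close> turns variation \<open>\<eta>\<close> into measure \<open>5 * \<eta> / (2 * \<alpha>) = e\<close>.\<close>
  define \<eta> where "\<eta> = 2 * \<alpha> * e / 5"
  have "\<eta> > 0" using \<open>e > 0\<close> \<open>0 < \<alpha>\<close> by (simp add: \<eta>_def)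
  obtain n u where u: "\<forall>i<n. u i \<le> u (Suc i)" "u 0 = 0" "u n = T"
        "V T - V 0 - \<eta> < (\<Sum>i<n. \<bar>f (u (Suc i)) - f (u i)\<bar>)"
    using near[rule_format, OF \<open>\<eta> > 0\<close>] by (elim exE conjE) (rule that)
  have range: "0 \<le> u i \<and> u i \<le> u (Suc i) \<and> u (Suc i) \<le> T" if "i < n" for i
    using chain_mono[of n u 0 i, OF u(1)[rule_format]]
      chain_mono[of n u "Suc i" n, OF u(1)[rule_format]] u that by fastforce
  define sg where "sg i = (if f (u i) \<le> f (u (Suc i)) then 1 else - 1 :: real)" for i
  define w where "w i x = V x - sg i * f x" for i x
  have w_mono: "w i s \<le> w i t" if "0 \<le> s" "s \<le> t" "t \<le> T" for i s t
    using V[OF that] by (auto simp: w_def sg_def)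
  define E where "E i = {x \<in> ?N. u i < x \<and> x < u (Suc i)}" for i
  have "\<exists>U. E i \<subseteq> U \<and> U \<in> lmeasurable \<and>
      measure lebesgue U \<le> 5 * (w i (u (Suc i)) - w i (u i)) / (2 * \<alpha>)" if "i < n" for i
  proof (rule steep_points_measure_le[of "u i" "u (Suc i)" "w i" "2 * \<alpha>" "E i"])
    show "w i s \<le> w i t" if "u i \<le> s" "s \<le> t" "t \<le> u (Suc i)" for s t
      using that range[OF \<open>i < n\<close>] by (intro w_mono) auto
    fix x assume "x \<in> E i"
    then have x: "x \<in> ?N" "u i < x" "x < u (Suc i)" by (auto simp: E_def)
    \<comment> \<open>Intervals around \<open>x\<close> shorter than \<open>d\<close> stay within the piece that contains \<open>x\<close>.\<close>
    define d where "d = min (x - u i) (u (Suc i) - x)"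
    have "d > 0" using x by (simp add: d_def)
    have slopes: "\<exists>s t. 0 \<le> s \<and> s < t \<and> t \<le> T \<and> x \<in> {s..t} \<and> t - s < d \<and> \<alpha> * (t - s) \<le> f t - f s"
      "\<exists>s t. 0 \<le> s \<and> s < t \<and> t \<le> T \<and> x \<in> {s..t} \<and> t - s < d \<and> \<alpha> * (t - s) \<le> f s - f t"
      using x(1) \<open>d > 0\<close> by blast+
    obtain s t where st: "0 \<le> s" "s < t" "t \<le> T" "x \<in> {s..t}" "t - s < d"
      "\<alpha> * (t - s) \<le> - sg i * (f t - f s)"
    proof (cases "f (u i) \<le> f (u (Suc i))")
      case True
      then show ?thesis using slopes(2) that by (auto simp: sg_def)
    next
      case False
      then show ?thesis using slopes(1) that by (auto simp: sg_def)
    qed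
    have "\<alpha> * (t - s) \<le> \<bar>f t - f s\<bar>"
      using st(6) by (auto simp: sg_def split: if_splits)
    then have "2 * \<alpha> * (t - s) \<le> w i t - w i s"
      using V[of s t] st by (simp add: w_def algebra_simps)
    moreover have "u i \<le> s" "t \<le> u (Suc i)" using st(4,5) by (auto simp: d_def)
    ultimately show "\<exists>s t. u i \<le> s \<and> s < t \<and> t \<le> u (Suc i) \<and> x \<in> {s..t} \<and> 2 * \<alpha> * (t - s) \<le> w i t - w i s"
      using st by blast
  next
    fix U assume "E i \<subseteq> U" "U \<in> lmeasurable"
      "measure lebesgue U \<le> 5 * (w i (u (Suc i)) - w i (u i)) / (2 * \<alpha>)"
    then show ?thesis by blast
  qed (use range[OF that] \<open>0 < \<alpha>\<close> in auto)
  then obtain U where U: "\<And>i. i < n \<Longrightarrow> E i \<subseteq> U i" "\<And>i. i < n \<Longrightarrow> U i \<in> lmeasurable"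
      "\<And>i. i < n \<Longrightarrow> measure lebesgue (U i) \<le> 5 * (w i (u (Suc i)) - w i (u i)) / (2 * \<alpha>)"
    by metis
  define W where "W = (\<Union>i<n. U i) \<union> u ` {..n}"
  have "W \<in> lmeasurable"
    unfolding W_def using U(2)
    by (intro fmeasurable.Un fmeasurable.finite_UN) (auto intro!: negligible_imp_measurable negligible_finite)
  moreover have "?N \<subseteq> W"
  proof
    fix x assume x: "x \<in> ?N"
    have "\<exists>i<n. u i \<le> x \<and> x < u (Suc i)"
    proof (rule ccontr)
      assume no: "\<not> (\<exists>i<n. u i \<le> x \<and> x < u (Suc i))"
      have "u i \<le> x" if "i \<le> n" for i
        using that
      proof (induction i)
        case 0
        then show ?case using x u by simp
      next
        case (Suc i)
        then show ?case using no by (meson Suc_le_eq less_imp_le not_le)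
      qed
      then show False using x u(3) by fastforce
    qed
    then obtain i where i: "i < n" "u i \<le> x" "x < u (Suc i)" by blast
    show "x \<in> W"
    proof (cases "u i = x")
      case True
      then show ?thesis using i by (auto simp: W_def)
    next
      case False
      then have "x \<in> E i" using i x by (simp add: E_def)
      then show ?thesis using U(1)[OF i(1)] i(1) by (auto simp: W_def)
    qed
  qed
  moreover have "measure lebesgue W \<le> e"
  proof -
    have neg: "negligible (u ` {..n})" by (intro negligible_finite) simp
    have "measure lebesgue W = measure lebesgue (\<Union>i<n. U i)"
      unfolding W_def using neg by (intro measure_negligible_symdiff) (auto intro!: fmeasurableD2 U negligible_subset[OF neg] fmeasurable.finite_UN simp: fmeasurableD)
    also have "\<dots> \<le> (\<Sum>i<n. measure lebesgue (U i))"
      using U(2) by (intro measure_UNION_le) auto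
    also have "\<dots> \<le> (\<Sum>i<n. 5 / (2 * \<alpha>) * ((V (u (Suc i)) - V (u i)) - \<bar>f (u (Suc i)) - f (u i)\<bar>))"
    proof (rule sum_mono)
      fix i assume "i \<in> {..<n}"
      then have "measure lebesgue (U i) \<le> 5 * (w i (u (Suc i)) - w i (u i)) / (2 * \<alpha>)" using U(3) by simp
      also have "w i (u (Suc i)) - w i (u i) = (V (u (Suc i)) - V (u i)) - \<bar>f (u (Suc i)) - f (u i)\<bar>"
        by (auto simp: w_def sg_def)
      finally show "measure lebesgue (U i)
          \<le> 5 / (2 * \<alpha>) * ((V (u (Suc i)) - V (u i)) - \<bar>f (u (Suc i)) - f (u i)\<bar>)" by simp
    qed
    also have "\<dots> = 5 / (2 * \<alpha>) * (V T - V 0 - (\<Sum>i<n. \<bar>f (u (Suc i)) - f (u i)\<bar>))"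
      using sum_lessThan_telescope[of "\<lambda>i. V (u i)" n] u
      unfolding sum_distrib_left[symmetric] by (simp only: sum_subtractf)
    also have "\<dots> \<le> 5 / (2 * \<alpha>) * \<eta>"
      using u(4) \<open>0 < \<alpha>\<close> by (intro mult_left_mono) auto
    also have "\<dots> = e" using \<open>0 < \<alpha>\<close> by (simp add: \<eta>_def)
    finally show ?thesis .
  qed
  ultimately show "\<exists>W. ?N \<subseteq> W \<and> W \<in> lmeasurable \<and> measure lebesgue W \<le> e" by blast
qed

text \<open>
  The maximal inequality for the total variation \<open>V\<close> at a slope \<open>K\<close> of size \<open>(V T - V 0) / e\<close>.
\<close>

lemma no_infinite_slopes:
  assumes ac: "abs_cont T f" and "0 < T"
  shows "negligible {x \<in> {0<..<T}. \<forall>K>0.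
     \<exists>s t. 0 \<le> s \<and> s < t \<and> t \<le> T \<and> x \<in> {s..t} \<and> K * (t - s) \<le> \<bar>f t - f s\<bar>}"
  (is "negligible ?N")
  unfolding negligible_outer_le
proof (intro allI impI)
  fix e :: real assume "e > 0"
  obtain V :: "real \<Rightarrow> real" where
    V': "\<forall>s t. 0 \<le> s \<and> s \<le> t \<and> t \<le> T \<longrightarrow> \<bar>f t - f s\<bar> \<le> V t - V s"
    using abs_cont_variation[OF ac \<open>0 < T\<close>] by (elim exE conjE) (rule that)
  have V: "\<bar>f t - f s\<bar> \<le> V t - V s" if "0 \<le> s" "s \<le> t" "t \<le> T" for s t
    using V' that by simp
  define K where "K = 5 * (V T - V 0 + 1) / e"
  have "V T - V 0 \<ge> 0" using V[of 0 T] \<open>0 < T\<close> by simp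
  then have "K > 0" using \<open>e > 0\<close> by (simp add: K_def)
  show "\<exists>U. ?N \<subseteq> U \<and> U \<in> lmeasurable \<and> measure lebesgue U \<le> e"
  proof (rule steep_points_measure_le[of 0 T V K ?N])
    show "V s \<le> V t" if "0 \<le> s" "s \<le> t" "t \<le> T" for s t using V[OF that] by simp
    fix x assume "x \<in> ?N"
    then obtain s t where st: "0 \<le> s" "s < t" "t \<le> T" "x \<in> {s..t}" "K * (t - s) \<le> \<bar>f t - f s\<bar>"
      using \<open>K > 0\<close> by blast
    then show "\<exists>s t. 0 \<le> s \<and> s < t \<and> t \<le> T \<and> x \<in> {s..t} \<and> K * (t - s) \<le> V t - V s"
      using V[of s t] by (intro exI[of _ s] exI[of _ t]) simp
  next
    fix U assume U: "?N \<subseteq> U" "U \<in> lmeasurable" "measure lebesgue U \<le> 5 * (V T - V 0) / K"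
    have "5 * (V T - V 0) / K \<le> e"
      using \<open>e > 0\<close> \<open>V T - V 0 \<ge> 0\<close> by (simp add: K_def field_simps)
    then show ?thesis using U by (meson order_trans)
  qed (use \<open>0 < T\<close> \<open>K > 0\<close> in auto)
qed

lemma slope_between:
  assumes "x \<noteq> y"
  shows "(f (max x y) - f (min x y)) = (f y - f x) / (y - x) * (max x y - min x y :: real)"
  using assms by (auto simp: max_def min_def field_simps)

text \<open>
  If the difference quotients at \<open>x\<close> stay bounded but do not converge, rational numbers \<open>p1 < p2\<close> fit between
  their lower and upper limits. After subtracting the linear function with slope \<open>c = (p1 + p2) / 2\<close>, the point
  \<open>x\<close> lies in arbitrarily short intervals of slope at least \<open>\<alpha>\<close> and at most \<open>- \<alpha>\<close>, where
  \<open>\<alpha> = (p2 - p1) / 2\<close>. For each of the countably many pairs \<open>(c, \<alpha>)\<close> these points are negligible (\<open>no_oscillating_slopes\<close>),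
  and so are those with unbounded difference quotients (\<open>no_infinite_slopes\<close>).
\<close>

lemma abs_cont_differentiable:
  assumes ac: "abs_cont T f" and "0 < T"
  shows "\<exists>N. negligible N \<and> (\<forall>x\<in>{0<..<T} - N. \<exists>D. (f has_real_derivative D) (at x))"
proof -
  define osc where "osc c \<alpha> = {x \<in> {0<..<T}. \<forall>e>0.
     (\<exists>s t. 0 \<le> s \<and> s < t \<and> t \<le> T \<and> x \<in> {s..t} \<and> t - s < e \<and> \<alpha> * (t - s) \<le> (f t - c * t) - (f s - c * s)) \<and>
     (\<exists>s t. 0 \<le> s \<and> s < t \<and> t \<le> T \<and> x \<in> {s..t} \<and> t - s < e \<and> \<alpha> * (t - s) \<le> (f s - c * s) - (f t - c * t))}"
    for c \<alpha>
  define ninf where "ninf = {x \<in> {0<..<T}. \<forall>K>0.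
     \<exists>s t. 0 \<le> s \<and> s < t \<and> t \<le> T \<and> x \<in> {s..t} \<and> K * (t - s) \<le> \<bar>f t - f s\<bar>}"
  define N where "N = ninf \<union> (\<Union>p\<in>\<rat> \<times> (\<rat> \<inter> {0<..}). osc (fst p) (snd p))"
  have osc: "osc c \<alpha> \<in> null_sets lebesgue" if "\<alpha> > 0" for c \<alpha>
    using no_oscillating_slopes[OF abs_cont_linear_minus[OF ac] \<open>0 < T\<close> that]
    unfolding osc_def negligible_iff_null_sets .
  have *: "(\<Union>p\<in>\<rat> \<times> (\<rat> \<inter> {0<..}). osc (fst p) (snd p)) \<in> null_sets lebesgue"
  proof (rule null_sets_UN')
    show "countable (\<rat> \<times> (\<rat> \<inter> {0<..}) :: (real \<times> real) set)"
      by (intro countable_SIGMA countable_rat countable_Int1)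
  qed (use osc in auto)
  have "ninf \<in> null_sets lebesgue"
    using no_infinite_slopes[OF ac \<open>0 < T\<close>] unfolding ninf_def negligible_iff_null_sets .
  then have "negligible N"
    unfolding N_def negligible_iff_null_sets using * by (simp add: null_sets.Un)
  moreover have "\<exists>D. (f has_real_derivative D) (at x)" if x: "x \<in> {0<..<T} - N" for x
  proof -
    define q where "q y = (f y - f x) / (y - x)" for y
    have near: "\<forall>\<^sub>F y in at x. y \<in> {0<..<T} \<and> \<bar>y - x\<bar> < e" if "e > 0" for e
    proof -
      have "\<forall>\<^sub>F y in at x. y \<in> {0<..<T}"
        using x by (intro eventually_at_in_open'[OF open_greaterThanLessThan]) simp
      moreover have "\<forall>\<^sub>F y in at x. dist y x < e"
        using \<open>e > 0\<close> by (auto simp: eventually_at)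
      ultimately show ?thesis by eventually_elim (simp add: dist_real_def)
    qed
    obtain K where "K > 0" and K: "\<And>s t. 0 \<le> s \<Longrightarrow> s < t \<Longrightarrow> t \<le> T \<Longrightarrow> x \<in> {s..t} \<Longrightarrow> \<bar>f t - f s\<bar> < K * (t - s)"
    proof -
      have "\<not> (\<forall>K>0. \<exists>s t. 0 \<le> s \<and> s < t \<and> t \<le> T \<and> x \<in> {s..t} \<and> K * (t - s) \<le> \<bar>f t - f s\<bar>)"
        using x by (simp add: N_def ninf_def)
      then obtain K where "K > 0"
        "\<not> (\<exists>s t. 0 \<le> s \<and> s < t \<and> t \<le> T \<and> x \<in> {s..t} \<and> K * (t - s) \<le> \<bar>f t - f s\<bar>)" by blast
      then have "\<bar>f t - f s\<bar> < K * (t - s)" if "0 \<le> s" "s < t" "t \<le> T" "x \<in> {s..t}" for s t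
        using that by (meson not_le)
      with \<open>K > 0\<close> show ?thesis by (intro that[of K])
    qed
    have bounded: "\<forall>\<^sub>F y in at x. - K \<le> q y \<and> q y \<le> K"
    proof -
      have "\<forall>\<^sub>F y in at x. y \<noteq> x" by (auto simp: eventually_at_filter)
      with near[OF zero_less_one] show ?thesis
      proof eventually_elim
        case (elim y)
        then have "\<bar>f (max x y) - f (min x y)\<bar> < K * (max x y - min x y)"
          using x by (intro K) (auto simp: min_def max_def)
        then have "\<bar>q y\<bar> * (max x y - min x y) < K * (max x y - min x y)"
          using slope_between[of x y f] elim(2) by (simp add: q_def abs_mult)
        then have "\<bar>q y\<bar> < K" by (simp add: mult_less_cancel_right_disj max_def min_def split: if_splits)
        then show ?case by linarith
      qed
    qed
    define L where "L = Limsup (at x) (\<lambda>y. ereal (q y))"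
    define l where "l = Liminf (at x) (\<lambda>y. ereal (q y))"
    have "l \<le> L" unfolding l_def L_def by (intro Liminf_le_Limsup) simp
    have "ereal (- K) \<le> l" unfolding l_def
      by (intro Liminf_bounded eventually_mono[OF bounded]) simp
    have "L \<le> ereal K" unfolding L_def
      by (intro Limsup_bounded eventually_mono[OF bounded]) simp
    have "l = L"
    proof (rule ccontr)
      assume "l \<noteq> L"
      then have "l < L" using \<open>l \<le> L\<close> by simp
      obtain r where r: "l < ereal r" "ereal r < L" using ereal_dense2[OF \<open>l < L\<close>] by blast
      obtain r' where r': "l < ereal r'" "ereal r' < ereal r" using ereal_dense2[OF r(1)] by blast
      obtain p1 where p1: "p1 \<in> \<rat>" "r' < p1" "p1 < r" using Rats_dense_in_real[of r' r] r'(2) by auto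
      obtain p2 where p2: "p2 \<in> \<rat>" "p1 < p2" "p2 < r" using Rats_dense_in_real[of p1 r] p1 by auto
      define c \<alpha> where "c = (p1 + p2) / 2" and "\<alpha> = (p2 - p1) / 2"
      have "l < ereal p1" "ereal p2 < L"
        using r' p1 p2 r by (meson ereal_less_eq(3) less_ereal.simps(1) less_trans)+
      have f1: "\<exists>\<^sub>F y in at x. q y < p1"
      proof (rule ccontr)
        assume "\<not> (\<exists>\<^sub>F y in at x. q y < p1)"
        then have "\<forall>\<^sub>F y in at x. ereal p1 \<le> ereal (q y)" by (simp add: not_frequently not_less)
        then have "ereal p1 \<le> l" unfolding l_def by (rule Liminf_bounded)
        with \<open>l < ereal p1\<close> show False by simp
      qed
      have f2: "\<exists>\<^sub>F y in at x. p2 < q y"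
      proof (rule ccontr)
        assume "\<not> (\<exists>\<^sub>F y in at x. p2 < q y)"
        then have "\<forall>\<^sub>F y in at x. ereal (q y) \<le> ereal p2" by (simp add: not_frequently not_less)
        then have "L \<le> ereal p2" unfolding L_def by (rule Limsup_bounded)
        with \<open>ereal p2 < L\<close> show False by simp
      qed
      have "x \<in> osc c \<alpha>"
        unfolding osc_def
      proof (intro CollectI conjI allI impI)
        show "x \<in> {0<..<T}" using x by simp
        fix e :: real assume "e > 0"
        have ne: "\<forall>\<^sub>F y in at x. y \<noteq> x" by (auto simp: eventually_at_filter)
        obtain y where y: "p2 < q y" "y \<in> {0<..<T}" "\<bar>y - x\<bar> < e" "y \<noteq> x"
          using frequently_eventually_conj[OF f2 eventually_conj[OF near[OF \<open>e > 0\<close>] ne]]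
          by (auto dest!: frequently_ex)
        define s t where "s = min x y" and "t = max x y"
        have st: "0 \<le> s" "s < t" "t \<le> T" "x \<in> {s..t}" "t - s < e"
          using y x by (auto simp: s_def t_def min_def max_def abs_if split: if_splits)
        have "f t - f s = q y * (t - s)" using slope_between[of x y f] y(4) by (simp add: s_def t_def q_def)
        moreover have "p2 * (t - s) \<le> q y * (t - s)" using y(1) st by (intro mult_right_mono) auto
        moreover have p: "p2 = c + \<alpha>" by (simp add: c_def \<alpha>_def field_simps)
        ultimately have "(c + \<alpha>) * (t - s) \<le> f t - f s" unfolding p by linarith
        then have "\<alpha> * (t - s) \<le> (f t - c * t) - (f s - c * s)"
          by (simp add: algebra_simps)
        with st show "\<exists>s t. 0 \<le> s \<and> s < t \<and> t \<le> T \<and> x \<in> {s..t} \<and> t - s < e \<and> \<alpha> * (t - s) \<le> (f t - c * t) - (f s - c * s)"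
          by blast
      next
        fix e :: real assume "e > 0"
        have ne: "\<forall>\<^sub>F y in at x. y \<noteq> x" by (auto simp: eventually_at_filter)
        obtain y where y: "q y < p1" "y \<in> {0<..<T}" "\<bar>y - x\<bar> < e" "y \<noteq> x"
          using frequently_eventually_conj[OF f1 eventually_conj[OF near[OF \<open>e > 0\<close>] ne]]
          by (auto dest!: frequently_ex)
        define s t where "s = min x y" and "t = max x y"
        have st: "0 \<le> s" "s < t" "t \<le> T" "x \<in> {s..t}" "t - s < e"
          using y x by (auto simp: s_def t_def min_def max_def abs_if split: if_splits)
        have "f t - f s = q y * (t - s)" using slope_between[of x y f] y(4) by (simp add: s_def t_def q_def)
        moreover have "q y * (t - s) \<le> p1 * (t - s)" using y(1) st by (intro mult_right_mono) auto
        moreover have p: "p1 = c - \<alpha>" by (simp add: c_def \<alpha>_def field_simps)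
        ultimately have "f t - f s \<le> (c - \<alpha>) * (t - s)" unfolding p by linarith
        then have "\<alpha> * (t - s) \<le> (f s - c * s) - (f t - c * t)"
          by (simp add: algebra_simps)
        with st show "\<exists>s t. 0 \<le> s \<and> s < t \<and> t \<le> T \<and> x \<in> {s..t} \<and> t - s < e \<and> \<alpha> * (t - s) \<le> (f s - c * s) - (f t - c * t)"
          by blast
      qed
      moreover have "c \<in> \<rat>" "\<alpha> \<in> \<rat>" "\<alpha> > 0"
        using p1 p2 by (auto simp: c_def \<alpha>_def intro!: Rats_divide Rats_add Rats_diff)
      ultimately have "x \<in> N" unfolding N_def by (intro UnI2 UN_I[of "(c, \<alpha>)"]) simp_all
      then show False using x by simp
    qed
    obtain D where D: "l = ereal D"
      using \<open>ereal (- K) \<le> l\<close> \<open>L \<le> ereal K\<close> \<open>l = L\<close> by (cases l) auto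
    have "((\<lambda>y. ereal (q y)) \<longlongrightarrow> ereal D) (at x)"
      using \<open>l = L\<close> D unfolding l_def L_def by (subst tendsto_iff_Liminf_eq_Limsup) simp_all
    then have "(q \<longlongrightarrow> D) (at x)" by simp
    then show ?thesis unfolding has_field_derivative_iff q_def by blast
  qed
  ultimately show ?thesis by blast
qed

section \<open>The fundamental theorem of calculus\<close>

text \<open>
  A gauge argument. Tags outside the exceptional set get intervals on which the increment is close to the
  derivative times the length. Tags inside it get intervals within an open set of measure less than \<open>\<delta>\<close>,
  where absolute continuity bounds the sum of the increments.
\<close>

lemma abs_cont_has_integral:
  assumes ac: "abs_cont T F" and "negligible N"
    and deriv: "\<And>x. x \<in> {0<..<T} - N \<Longrightarrow> (F has_real_derivative \<phi> x) (at x)"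
    and ab: "0 \<le> a" "a \<le> b" "b \<le> T"
  shows "(\<phi> has_integral (F b - F a)) {a..b}"
proof -
  define N' where "N' = N \<union> {0, T}"
  have "negligible N'" using \<open>negligible N\<close> by (simp add: N'_def negligible_Un negligible_insert)
  define \<psi> where "\<psi> x = (if x \<in> N' then 0 else \<phi> x)" for x
  have "(\<psi> has_integral (F b - F a)) (cbox a b)"
    unfolding has_integral
  proof (intro allI impI)
    fix e :: real assume "e > 0"
    obtain \<delta> where "\<delta> > 0" and \<delta>: "\<forall>(n::nat) s t. (\<forall>i<n. 0 \<le> s i \<and> s i \<le> t i \<and> t i \<le> T) \<and>
       disjoint_family_on (\<lambda>i. {s i<..<t i}) {..<n} \<and>
       (\<Sum>i<n. t i - s i) < \<delta> \<longrightarrow> (\<Sum>i<n. \<bar>F (t i) - F (s i)\<bar>) < e / 2"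
      using ac[unfolded abs_cont_def, rule_format, OF half_gt_zero[OF \<open>e > 0\<close>]] by (elim exE conjE) (rule that)
    have "N' \<in> sets lebesgue" using \<open>negligible N'\<close> by (simp add: negligible_imp_sets)
    then obtain Q where Q: "open Q" "N' \<subseteq> Q" "Q - N' \<in> lmeasurable" "emeasure lebesgue (Q - N') < ennreal \<delta>"
      using sets_lebesgue_outer_open \<open>\<delta> > 0\<close> by metis
    have neg: "negligible (sym_diff (Q - N') Q)"
      using \<open>negligible N'\<close> by (rule negligible_subset) auto
    have Qm: "Q \<in> lmeasurable" using Q(3) neg by (rule lmeasurable_negligible_symdiff)
    have "measure lebesgue Q = measure lebesgue (Q - N')"
      using measure_negligible_symdiff[of "Q - N'" Q] Q(3) neg by auto
    also have "\<dots> < \<delta>"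
      using Q(3,4) \<open>\<delta> > 0\<close> by (simp add: emeasure_eq_measure2 ennreal_less_iff)
    finally have Q\<delta>: "measure lebesgue Q < \<delta>" .
    \<comment> \<open>The regular tags contribute at most \<open>e' * (b - a)\<close>; the added 1 allows \<open>a = b\<close>.\<close>
    define e' where "e' = e / (2 * (b - a + 1))"
    have "e' > 0" using \<open>e > 0\<close> ab by (simp add: e'_def)
    have "\<exists>d>0. \<forall>y. \<bar>y - x\<bar> < d \<longrightarrow> \<bar>F y - F x - \<phi> x * (y - x)\<bar> \<le> e' * \<bar>y - x\<bar>" if "x \<in> {a..b} - N'" for x
    proof -
      have "(F has_derivative (\<lambda>h. \<phi> x * h)) (at x)"
        using deriv[of x] that ab by (auto simp: N'_def has_field_derivative_def)
      then show ?thesis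
        using \<open>e' > 0\<close> unfolding has_derivative_at_alt by (fastforce simp: real_norm_def)
    qed
    then obtain d where d: "\<And>x. x \<in> {a..b} - N' \<Longrightarrow> d x > 0"
      "\<And>x y. x \<in> {a..b} - N' \<Longrightarrow> \<bar>y - x\<bar> < d x \<Longrightarrow> \<bar>F y - F x - \<phi> x * (y - x)\<bar> \<le> e' * \<bar>y - x\<bar>"
      by metis
    define \<gamma> where "\<gamma> x = (if x \<in> N' then Q else if x \<in> {a..b} then ball x (d x) else ball x 1)" for x
    have "gauge \<gamma>"
      unfolding gauge_def \<gamma>_def using Q(1,2) d(1) by auto
    have small: "norm ((\<Sum>(x, K)\<in>p. measure lborel K *\<^sub>R \<psi> x) - (F b - F a)) < e"
      if p: "p tagged_division_of cbox a b" "\<gamma> fine p" for p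
    proof -
      note pD = tagged_division_ofD[OF p(1)]
      have K: "K = {Inf K..Sup K} \<and> a \<le> Inf K \<and> Inf K \<le> x \<and> x \<le> Sup K \<and> Sup K \<le> b
          \<and> measure lborel K = Sup K - Inf K" if xK: "(x, K) \<in> p" for x K
      proof -
        obtain u v where uv: "K = cbox u v" using pD(4)[OF xK] by blast
        have "x \<in> K" "K \<subseteq> cbox a b" using pD(2,3)[OF xK] by auto
        then show ?thesis by (auto simp: uv)
      qed
      define B where "B = {I \<in> p. fst I \<in> N'}"
      have "finite p" by (rule pD(1))
      then have "finite B" "B \<subseteq> p" by (auto simp: B_def)
      have inc: "(\<Sum>(x, K)\<in>p. F (Sup K) - F (Inf K)) = F b - F a"
        using additive_tagged_division_1[of a b p F] p(1) ab by simp
      have "(\<Sum>(x, K)\<in>p. measure lborel K *\<^sub>R \<psi> x) - (F b - F a)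
          = (\<Sum>(x, K)\<in>p. measure lborel K * \<psi> x - (F (Sup K) - F (Inf K)))"
        unfolding inc[symmetric] by (simp add: sum_subtractf split_def)
      also have "\<bar>\<dots>\<bar> \<le> (\<Sum>(x, K)\<in>p. \<bar>measure lborel K * \<psi> x - (F (Sup K) - F (Inf K))\<bar>)"
        unfolding split_def by (rule sum_abs)
      also have "\<dots> \<le> (\<Sum>(x, K)\<in>p. e' * measure lborel K + (if x \<in> N' then \<bar>F (Sup K) - F (Inf K)\<bar> else 0))"
      proof (rule sum_mono, clarify)
        fix x K assume xK: "(x, K) \<in> p"
        note KK = K[OF xK]
        show "\<bar>measure lborel K * \<psi> x - (F (Sup K) - F (Inf K))\<bar>
            \<le> e' * measure lborel K + (if x \<in> N' then \<bar>F (Sup K) - F (Inf K)\<bar> else 0)"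
        proof (cases "x \<in> N'")
          case True
          then show ?thesis using KK \<open>e' > 0\<close> by (simp add: \<psi>_def abs_minus_commute[of "F (Inf K)"])
        next
          case False
          have "x \<in> {a..b} - N'" using KK False by auto
          have "K \<subseteq> ball x (d x)"
            using fineD[OF p(2) xK] False KK by (auto simp: \<gamma>_def)
          moreover have "Sup K \<in> K" "Inf K \<in> K" using KK by (metis atLeastAtMost_iff order_refl order_trans)+
          ultimately have "\<bar>Sup K - x\<bar> < d x" "\<bar>Inf K - x\<bar> < d x"
            by (auto simp: dist_real_def abs_minus_commute)
          then have "\<bar>F (Sup K) - F x - \<phi> x * (Sup K - x)\<bar> \<le> e' * \<bar>Sup K - x\<bar>"
            "\<bar>F (Inf K) - F x - \<phi> x * (Inf K - x)\<bar> \<le> e' * \<bar>Inf K - x\<bar>"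
            using d(2)[OF \<open>x \<in> {a..b} - N'\<close>] by auto
          moreover have "e' * \<bar>Sup K - x\<bar> + e' * \<bar>Inf K - x\<bar> = e' * measure lborel K"
          proof -
            have "\<bar>Sup K - x\<bar> + \<bar>Inf K - x\<bar> = measure lborel K"
              using conjunct1[OF conjunct2[OF KK]] KK by linarith
            then show ?thesis by (simp flip: distrib_left)
          qed
          moreover have "measure lborel K * \<psi> x - (F (Sup K) - F (Inf K))
             = (F (Inf K) - F x - \<phi> x * (Inf K - x)) - (F (Sup K) - F x - \<phi> x * (Sup K - x))"
          proof -
            have cK: "measure lborel K = Sup K - Inf K" using KK by blast
            show ?thesis unfolding cK using False by (simp add: \<psi>_def algebra_simps)
          qed
          ultimately show ?thesis using False by auto
        qed
      qed
      also have "\<dots> = e' * (b - a) + (\<Sum>(x, K)\<in>B. \<bar>F (Sup K) - F (Inf K)\<bar>)"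
      proof -
        have "(\<Sum>(x, K)\<in>p. e' * measure lborel K) = e' * (b - a)"
          using additive_content_tagged_division[OF p(1)] ab by (simp add: split_def flip: sum_distrib_left)
        moreover have "(\<Sum>(x, K)\<in>p. if x \<in> N' then \<bar>F (Sup K) - F (Inf K)\<bar> else 0)
            = (\<Sum>(x, K)\<in>B. \<bar>F (Sup K) - F (Inf K)\<bar>)"
          unfolding B_def using \<open>finite p\<close> by (simp add: split_def sum.inter_filter)
        ultimately show ?thesis by (simp add: split_def sum.distrib)
      qed
      also have "(\<Sum>(x, K)\<in>B. \<bar>F (Sup K) - F (Inf K)\<bar>) < e / 2"
      proof -
        obtain h where h: "bij_betw h {..<card B} B"
          using ex_bij_betw_nat_finite[OF \<open>finite B\<close>] by (auto simp: atLeast0LessThan)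
        define s t where "s i = Inf (snd (h i))" and "t i = Sup (snd (h i))" for i
        have hB: "h i \<in> B" if "i < card B" for i using h that by (auto simp: bij_betw_def)
        have hp: "(fst (h i), snd (h i)) \<in> p" if "i < card B" for i
          using hB[OF that] \<open>B \<subseteq> p\<close> by auto
        have inter: "interior (snd (h i)) = {s i<..<t i}" if "i < card B" for i
        proof -
          have "snd (h i) = {s i..t i}" using K[OF hp[OF that]] by (simp add: s_def t_def)
          then show ?thesis by simp
        qed
        have disj: "disjoint_family_on (\<lambda>i. {s i<..<t i}) {..<card B}"
          unfolding disjoint_family_on_def
        proof (intro ballI impI)
          fix i j assume ij: "i \<in> {..<card B}" "j \<in> {..<card B}" "i \<noteq> j"
          then have "h i \<noteq> h j" using h by (auto simp: bij_betw_def inj_on_def)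
          then have "interior (snd (h i)) \<inter> interior (snd (h j)) = {}"
            using pD(5)[of "fst (h i)" "snd (h i)" "fst (h j)" "snd (h j)"] hp ij by auto
          then show "{s i<..<t i} \<inter> {s j<..<t j} = {}" using inter ij by simp
        qed
        have st: "0 \<le> s i \<and> s i \<le> t i \<and> t i \<le> T" if "i < card B" for i
          using K[OF hp[OF that]] ab by (auto simp: s_def t_def)
        have "(\<Sum>i<card B. t i - s i) = (\<Sum>i<card B. measure lebesgue {s i<..<t i})"
          using st by (intro sum.cong) auto
        also have "\<dots> = measure lebesgue (\<Union>i<card B. {s i<..<t i})"
          using disj emeasure_bounded_finite[of "{s i<..<t i}" for i]
          by (intro measure_finite_Union[symmetric]) (auto simp: less_top)
        also have "\<dots> \<le> measure lebesgue Q"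
        proof (rule measure_mono_fmeasurable)
          show "(\<Union>i<card B. {s i<..<t i}) \<subseteq> Q"
          proof (rule UN_least)
            fix i assume "i \<in> {..<card B}"
            then have i: "i < card B" by simp
            have "snd (h i) \<subseteq> \<gamma> (fst (h i))" using fineD[OF p(2) hp[OF i]] .
            also have "\<gamma> (fst (h i)) = Q" using hB[OF i] by (simp add: B_def \<gamma>_def)
            finally show "{s i<..<t i} \<subseteq> Q" using inter[OF i] interior_subset[of "snd (h i)"] by simp
          qed
        qed (use Qm in auto)
        also note Q\<delta>
        finally have "(\<Sum>i<card B. \<bar>F (t i) - F (s i)\<bar>) < e / 2"
          using \<delta> disj st by blast
        also have "(\<Sum>i<card B. \<bar>F (t i) - F (s i)\<bar>) = (\<Sum>(x, K)\<in>B. \<bar>F (Sup K) - F (Inf K)\<bar>)"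
          unfolding s_def t_def split_def by (rule sum.reindex_bij_betw[OF h])
        finally show ?thesis .
      qed
      also have "e' * (b - a) \<le> e / 2"
        using \<open>e > 0\<close> ab by (simp add: e'_def field_simps)
      finally show ?thesis by (simp add: real_norm_def)
    qed
    show "\<exists>\<gamma>. gauge \<gamma> \<and> (\<forall>p. p tagged_division_of cbox a b \<and> \<gamma> fine p \<longrightarrow>
        norm ((\<Sum>(x, K)\<in>p. measure lborel K *\<^sub>R \<psi> x) - (F b - F a)) < e)"
      by (intro exI[of _ \<gamma>] conjI[OF \<open>gauge \<gamma>\<close>] allI impI, elim conjE, rule small)
  qed
  then show ?thesis
    unfolding interval_cbox using \<open>negligible N'\<close>
    by (rule has_integral_spike[rotated 2]) (auto simp: \<psi>_def)
qed

section \<open>The rate density as a Legendre transform\<close>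

text \<open>
  The exponential \<open>exp (k * q * x)\<close> on the real line is an eigenfunction of the generator
  \<open>k * (f (x + 1/k) + f (x - 1/k) - 2 * f x)\<close>, with eigenvalue \<open>k * cumulant q\<close>.
\<close>

definition cumulant :: "real \<Rightarrow> real" where
  "cumulant p = 2 * cosh p - 2"

text \<open>
  The inverse of \<open>q \<mapsto> 2 * sinh q\<close>, the derivative of \<^term>\<open>cumulant\<close>: the point at which
  \<open>q * v - cumulant q\<close> is largest.
\<close>

definition optimal_tilt :: "real \<Rightarrow> real" where
  "optimal_tilt v = ln ((v + sqrt (v\<^sup>2 + 4)) / 2)"

lemma cumulant_nonneg: "0 \<le> cumulant p"
  using cosh_real_ge_1[of p] by (simp add: cumulant_def)

lemma optimal_tilt:
  shows sinh_optimal_tilt: "2 * sinh (optimal_tilt v) = v"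
    and cosh_optimal_tilt: "2 * cosh (optimal_tilt v) = sqrt (v\<^sup>2 + 4)"
    and exp_optimal_tilt: "exp (optimal_tilt v) - exp (- optimal_tilt v) = v"
proof -
  define r where "r = sqrt (v\<^sup>2 + 4)"
  define w where "w = (v + r) / 2"
  have r2: "r\<^sup>2 = v\<^sup>2 + 4" by (simp add: r_def)
  have "\<bar>v\<bar> < r" unfolding r_def by (rule real_less_rsqrt) simp
  then have "0 < w" by (simp add: w_def abs_if split: if_splits)
  have "w * (r - v) = 2" using r2 by (simp add: w_def field_simps power2_eq_square)
  then have w': "inverse w = (r - v) / 2" using \<open>0 < w\<close> by (simp add: field_simps)
  have e: "exp (optimal_tilt v) = w" "exp (- optimal_tilt v) = (r - v) / 2"
    using \<open>0 < w\<close> by (simp_all add: optimal_tilt_def w_def r_def exp_minus flip: w'[unfolded w_def r_def])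
  show "2 * sinh (optimal_tilt v) = v" "2 * cosh (optimal_tilt v) = sqrt (v\<^sup>2 + 4)"
    "exp (optimal_tilt v) - exp (- optimal_tilt v) = v"
    unfolding r_def[symmetric] sinh_field_def cosh_field_def e by (simp_all add: w_def field_simps)
qed

lemma rate_density_eq: "rate_density v = optimal_tilt v * v - cumulant (optimal_tilt v)"
  by (simp add: rate_density_def cumulant_def cosh_optimal_tilt flip: optimal_tilt_def)

text \<open>
  The tangent line of the convex function \<^const>\<open>cosh\<close> at the optimal tilt lies below its graph.
\<close>

lemma rate_density_ge: "p * v - cumulant p \<le> rate_density v"
proof -
  define q where "q = optimal_tilt v"
  have "exp q * (1 + (p - q)) \<le> exp q * exp (p - q)" "exp (- q) * (1 + (q - p)) \<le> exp (- q) * exp (q - p)"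
    by (intro mult_left_mono exp_ge_add_one_self; simp)+
  then have "exp q * (1 + (p - q)) \<le> exp p" "exp (- q) * (1 + (q - p)) \<le> exp (- p)"
    by (simp_all flip: exp_add)
  then have "2 * cosh q + (p - q) * (2 * sinh q) \<le> 2 * cosh p"
    by (simp add: cosh_def sinh_def algebra_simps)
  then show ?thesis
    using sinh_optimal_tilt[of v]
    by (simp add: rate_density_eq cumulant_def q_def algebra_simps)
qed

text \<open>
  With \<open>rate_density_ge\<close> this says that \<^const>\<open>rate_density\<close> is the Legendre transform of
  \<^term>\<open>cumulant\<close>.
\<close>

lemma rate_density_leI: "(\<And>p. p * v - cumulant p \<le> c) \<Longrightarrow> rate_density v \<le> c"
  by (simp add: rate_density_eq)

lemma optimal_tilt_minus: "optimal_tilt (- v) = - optimal_tilt v"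
proof -
  have "sinh (optimal_tilt (- v)) = sinh (- optimal_tilt v)"
    using sinh_optimal_tilt[of v] sinh_optimal_tilt[of "- v"] by simp
  then show ?thesis by (metis arsinh_sinh_real)
qed

lemma rate_density_minus: "rate_density (- v) = rate_density v"
  by (simp add: rate_density_eq optimal_tilt_minus cumulant_def)

lemma rate_density_abs: "rate_density \<bar>v\<bar> = rate_density v"
  by (simp add: abs_if rate_density_minus)

lemma continuous_rate_density: "continuous_on UNIV rate_density"
proof -
  have pos: "v + sqrt (v\<^sup>2 + 4) > 0" for v :: real
  proof -
    have "\<bar>v\<bar> < sqrt (v\<^sup>2 + 4)" by (rule real_less_rsqrt) simp
    then show ?thesis by linarith
  qed
  have "v + sqrt (v\<^sup>2 + 4) \<noteq> 0" for v :: real using pos[of v] by simp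
  then show ?thesis unfolding rate_density_def
    by (intro continuous_intros) (auto simp: pos)
qed

section \<open>Distances and displacements on the circle\<close>

lemma Rep_circle_of_real: "Rep_circle (circle_of_real r) = frac r"
  unfolding circle_of_real_def by (rule Abs_circle_inverse) (simp add: frac_lt_1)

lemma circle_of_real_Rep: "circle_of_real (Rep_circle x) = x"
proof -
  have "frac (Rep_circle x) = Rep_circle x" using Rep_circle[of x] by (simp add: frac_eq)
  then show ?thesis by (simp add: circle_of_real_def Rep_circle_inverse)
qed

lemma circle_shift_of_real: "circle_shift r (circle_of_real s) = circle_of_real (s + r)"
proof -
  have "frac s + r - (s + r) \<in> \<int>" by (simp add: frac_def)
  then show ?thesis unfolding circle_shift_def Rep_circle_of_real circle_of_real_eq_iff .
qed

lemma dist_circle_of_real_le: "dist (circle_of_real r) (circle_of_real s) \<le> \<bar>r - s\<bar>"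
proof -
  have "frac r - frac s = (r - s) - of_int (\<lfloor>r\<rfloor> - \<lfloor>s\<rfloor>)" by (simp add: frac_def)
  moreover define n where "n = \<lfloor>r\<rfloor> - \<lfloor>s\<rfloor>"
  ultimately have e: "frac r - frac s = (r - s) - of_int n" by simp
  have b: "0 \<le> frac r" "frac r < 1" "0 \<le> frac s" "frac s < 1" by (simp_all add: frac_lt_1)
  consider "n = 0" | "n \<ge> 1" | "n \<le> - 1" by linarith
  then show ?thesis
  proof cases
    case 1
    then show ?thesis using e by (simp add: dist_circle_def Rep_circle_of_real)
  next
    case 2
    then have "of_int n \<ge> (1::real)" by simp
    then show ?thesis using e b unfolding dist_circle_def Rep_circle_of_real by linarith
  next
    case 3
    then have "of_int n \<le> (- 1::real)" by simp
    then show ?thesis using e b unfolding dist_circle_def Rep_circle_of_real by linarith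
  qed
qed

lemma circle_displacement:
  obtains d where "\<bar>d\<bar> = dist x y" "circle_shift d x = y"
proof -
  define a where "a = Rep_circle y - Rep_circle x"
  have y: "y = circle_of_real (Rep_circle x + a)" by (simp add: a_def circle_of_real_Rep)
  have b: "\<bar>a\<bar> < 1" using Rep_circle[of x] Rep_circle[of y] by (auto simp: a_def)
  have "\<bar>Rep_circle x - Rep_circle y\<bar> = \<bar>a\<bar>" unfolding a_def by (rule abs_minus_commute)
  then have d: "dist x y = min \<bar>a\<bar> (1 - \<bar>a\<bar>)" unfolding dist_circle_def by (rule arg_cong)
  consider "\<bar>a\<bar> \<le> 1 - \<bar>a\<bar>" | "\<bar>a\<bar> > 1 - \<bar>a\<bar>" "a > 0" | "\<bar>a\<bar> > 1 - \<bar>a\<bar>" "a \<le> 0" by linarith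
  then show ?thesis
  proof cases
    case 1
    have "circle_shift a x = y" unfolding y circle_shift_def ..
    moreover have "\<bar>a\<bar> = dist x y" using 1 unfolding d by linarith
    ultimately show ?thesis by (rule that[rotated])
  next
    case 2
    have "circle_shift (a - 1) x = y"
      unfolding y circle_shift_def circle_of_real_eq_iff by simp
    moreover have "\<bar>a - 1\<bar> = dist x y" using 2 b unfolding d by linarith
    ultimately show ?thesis by (rule that[rotated])
  next
    case 3
    have "circle_shift (a + 1) x = y"
      unfolding y circle_shift_def circle_of_real_eq_iff by simp
    moreover have "\<bar>a + 1\<bar> = dist x y" using 3 b unfolding d by linarith
    ultimately show ?thesis by (rule that[rotated])
  qed
qed

text \<open>
  The covering map is isometric on intervals of length 1/2, so that a lift inherits absolute continuity
  from its path.
\<close>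

lemma dist_circle_of_real_eq:
  assumes "\<bar>r - s\<bar> \<le> 1 / 2"
  shows "dist (circle_of_real r) (circle_of_real s) = \<bar>r - s\<bar>"
proof -
  obtain d where d: "\<bar>d\<bar> = dist (circle_of_real s) (circle_of_real r)"
    "circle_shift d (circle_of_real s) = circle_of_real r"
    by (rule circle_displacement)
  then have "s + d - r \<in> \<int>" by (simp add: circle_shift_of_real circle_of_real_eq_iff)
  then obtain n where n: "s + d - r = of_int n" by (metis Ints_cases)
  have le: "\<bar>d\<bar> \<le> \<bar>r - s\<bar>" using d dist_circle_of_real_le[of s r] by simp
  have "\<bar>d\<bar> \<ge> \<bar>r - s\<bar>"
  proof (cases "n = 0")
    case False
    then have "\<bar>of_int n\<bar> \<ge> (1::real)" by linarith
    then show ?thesis using n assms by linarith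
  qed (use n in linarith)
  then show ?thesis using le d by (simp add: dist_commute)
qed

section \<open>Action majorants\<close>

text \<open>
  For smooth \<open>g\<close> and \<open>A\<close> the inequality with \<open>t\<close> tending to \<open>s\<close> and the supremum over \<open>q\<close> say that
  the derivative of \<open>A\<close> is at least the rate density of the derivative of \<open>g\<close>. This form has no
  derivatives, is additive over adjacent intervals and is preserved by pointwise limits.
\<close>

definition action_majorant :: "real \<Rightarrow> (real \<Rightarrow> real) \<Rightarrow> (real \<Rightarrow> real) \<Rightarrow> bool" where
  "action_majorant T g A \<longleftrightarrow> (\<forall>q s t. 0 \<le> s \<and> s \<le> t \<and> t \<le> T \<longrightarrow>
     q * (g t - g s) - (t - s) * cumulant q \<le> A t - A s)"

lemma action_majorantD:
  "action_majorant T g A \<Longrightarrow> 0 \<le> s \<Longrightarrow> s \<le> t \<Longrightarrow> t \<le> T \<Longrightarrow>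
     q * (g t - g s) - (t - s) * cumulant q \<le> A t - A s"
  unfolding action_majorant_def by blast

lemma cumulant_zero: "cumulant 0 = 0"
  by (simp add: cumulant_def)

lemma cumulant_minus: "cumulant (- q) = cumulant q"
  by (simp add: cumulant_def)

lemma action_majorant_mono:
  "action_majorant T g A \<Longrightarrow> 0 \<le> s \<Longrightarrow> s \<le> t \<Longrightarrow> t \<le> T \<Longrightarrow> A s \<le> A t"
  using action_majorantD[of T g A s t 0] by (simp add: cumulant_zero)

text \<open>
  Jensen's inequality for the action on an interval, through the supremum over \<open>q\<close>.
\<close>

lemma action_majorant_rate_density:
  assumes "action_majorant T g A" "0 \<le> s" "s < t" "t \<le> T"
  shows "(t - s) * rate_density ((g t - g s) / (t - s)) \<le> A t - A s"
proof -
  have "rate_density ((g t - g s) / (t - s)) \<le> (A t - A s) / (t - s)"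
  proof (rule rate_density_leI)
    fix q
    have "q * (g t - g s) - (t - s) * cumulant q \<le> A t - A s"
      using assms by (intro action_majorantD) auto
    then have "(q * (g t - g s) - (t - s) * cumulant q) / (t - s) \<le> (A t - A s) / (t - s)"
      using assms(3) by (intro divide_right_mono) auto
    moreover have "q * ((g t - g s) / (t - s)) - cumulant q = (q * (g t - g s) - (t - s) * cumulant q) / (t - s)"
      unfolding diff_divide_distrib[of "q * (g t - g s)" "(t - s) * cumulant q"] using assms(3) by simp
    ultimately show "q * ((g t - g s) / (t - s)) - cumulant q \<le> (A t - A s) / (t - s)" by simp
  qed
  then show ?thesis using assms(3) by (simp add: field_simps)
qed

lemma action_majorant_abs:
  assumes "action_majorant T g A" "0 \<le> s" "s \<le> t" "t \<le> T" "0 \<le> q"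
  shows "q * \<bar>g t - g s\<bar> \<le> (A t - A s) + (t - s) * cumulant q"
  using action_majorantD[OF assms(1-4), of q] action_majorantD[OF assms(1-4), of "- q"]
  by (auto simp: abs_if cumulant_minus algebra_simps)

text \<open>
  The superlinear growth of the rate density: with \<open>q\<close> of size \<open>(A T - A 0) / e\<close> the increments of
  \<open>A\<close> contribute less than \<open>e\<close>, and the term \<open>(t - s) * cumulant q\<close> is small for families of small total length.
\<close>

lemma action_majorant_abs_cont:
  assumes maj: "action_majorant T g A" and "0 \<le> T"
  shows "abs_cont T g"
  unfolding abs_cont_def
proof (intro allI impI)
  fix e :: real assume "e > 0"
  define m where "m = A T - A 0"
  have "m \<ge> 0" using action_majorant_mono[OF maj, of 0 T] \<open>0 \<le> T\<close> by (simp add: m_def)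
  define q where "q = 2 * (m + 1) / e"
  have "q > 0" using \<open>e > 0\<close> \<open>m \<ge> 0\<close> by (simp add: q_def)
  define d where "d = 1 / (cumulant q + 1)"
  have "d > 0" using cumulant_nonneg[of q] by (simp add: d_def)
  have "(\<Sum>i<n. \<bar>g (t i) - g (s i)\<bar>) < e"
    if st: "\<forall>i<n. 0 \<le> s i \<and> s i \<le> t i \<and> t i \<le> T"
      and disj: "disjoint_family_on (\<lambda>i. {s i<..<t i}) {..<n}"
      and small: "(\<Sum>i<n. t i - s i) < d" for n and s t :: "nat \<Rightarrow> real"
  proof -
    have "q * (\<Sum>i<n. \<bar>g (t i) - g (s i)\<bar>) \<le> (\<Sum>i<n. (A (t i) - A (s i)) + (t i - s i) * cumulant q)"
      unfolding sum_distrib_left using st \<open>q > 0\<close>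
      by (intro sum_mono action_majorant_abs[OF maj]) auto
    also have "\<dots> = (\<Sum>i<n. A (t i) - A (s i)) + cumulant q * (\<Sum>i<n. t i - s i)"
      by (simp add: sum.distrib sum_distrib_left mult.commute)
    also have "(\<Sum>i<n. A (t i) - A (s i)) \<le> m"
      unfolding m_def using st disj
      by (intro sum_disjoint_increments_le action_majorant_mono[OF maj] \<open>0 \<le> T\<close>) auto
    also have "cumulant q * (\<Sum>i<n. t i - s i) \<le> cumulant q * d"
      using small cumulant_nonneg by (intro mult_left_mono) auto
    also have "cumulant q * d < 1"
      using cumulant_nonneg[of q] by (simp add: d_def)
    finally have "q * (\<Sum>i<n. \<bar>g (t i) - g (s i)\<bar>) < m + 1" by simp
    then have "(\<Sum>i<n. \<bar>g (t i) - g (s i)\<bar>) < (m + 1) / q"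
      using \<open>q > 0\<close> by (simp add: field_simps)
    also have "(m + 1) / q = e / 2" using \<open>m \<ge> 0\<close> \<open>e > 0\<close> by (simp add: q_def field_simps)
    also have "e / 2 < e" using \<open>e > 0\<close> by simp
    finally show ?thesis .
  qed
  with \<open>d > 0\<close> show "\<exists>\<delta>>0. \<forall>n. \<forall>s t :: nat \<Rightarrow> real.
       (\<forall>i<n. 0 \<le> s i \<and> s i \<le> t i \<and> t i \<le> T) \<and>
       disjoint_family_on (\<lambda>i. {s i<..<t i}) {..<n} \<and>
       (\<Sum>i<n. t i - s i) < \<delta> \<longrightarrow> (\<Sum>i<n. \<bar>g (t i) - g (s i)\<bar>) < e"
    by (intro exI[of _ d]) simp
qed

section \<open>Circle-valued paths and their lifts\<close>

text \<open>
  The path covered by \<open>g\<close>; it is restricted because trajectories are \<^const>\<open>undefined\<close> outside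
  \<open>{0..T}\<close>.
\<close>

definition wrap :: "real \<Rightarrow> (real \<Rightarrow> real) \<Rightarrow> real \<Rightarrow> circle" where
  "wrap T g = restrict (\<lambda>t. circle_of_real (g t)) {0..T}"

lemma wrap_apply: "t \<in> {0..T} \<Longrightarrow> wrap T g t = circle_of_real (g t)"
  by (simp add: wrap_def)

lemma wrap_abs_cont:
  assumes "abs_cont T g"
  shows "wrap T g \<in> abs_cont_paths T"
  unfolding abs_cont_paths_def
proof (intro CollectI conjI allI impI)
  show "wrap T g \<in> extensional {0..T}" by (simp add: wrap_def)
  fix e :: real assume "e > 0"
  obtain \<delta> where "\<delta> > 0" and \<delta>: "\<forall>(n::nat) s t. (\<forall>i<n. 0 \<le> s i \<and> s i \<le> t i \<and> t i \<le> T) \<and>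
       disjoint_family_on (\<lambda>i. {s i<..<t i}) {..<n} \<and>
       (\<Sum>i<n. t i - s i) < \<delta> \<longrightarrow> (\<Sum>i<n. \<bar>g (t i) - g (s i)\<bar>) < e"
    using assms[unfolded abs_cont_def, rule_format, OF \<open>e > 0\<close>] by (elim exE conjE) (rule that)
  have "(\<Sum>i<n. dist (wrap T g (t i)) (wrap T g (s i))) < e"
    if st: "\<forall>i<n. 0 \<le> s i \<and> s i \<le> t i \<and> t i \<le> T"
      and disj: "disjoint_family_on (\<lambda>i. {s i<..<t i}) {..<n}"
      and small: "(\<Sum>i<n. t i - s i) < \<delta>" for n and s t :: "nat \<Rightarrow> real"
  proof -
    have "(\<Sum>i<n. dist (wrap T g (t i)) (wrap T g (s i))) \<le> (\<Sum>i<n. \<bar>g (t i) - g (s i)\<bar>)"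
    proof (rule sum_mono)
      fix i assume "i \<in> {..<n}"
      then have "t i \<in> {0..T}" "s i \<in> {0..T}" using st by force+
      then show "dist (wrap T g (t i)) (wrap T g (s i)) \<le> \<bar>g (t i) - g (s i)\<bar>"
        by (simp add: wrap_apply dist_circle_of_real_le)
    qed
    also have "\<dots> < e" using \<delta> st disj small by simp
    finally show ?thesis .
  qed
  with \<open>\<delta> > 0\<close> show "\<exists>\<delta>>0. \<forall>n. \<forall>s t :: nat \<Rightarrow> real.
       (\<forall>i<n. 0 \<le> s i \<and> s i \<le> t i \<and> t i \<le> T) \<and>
       disjoint_family_on (\<lambda>i. {s i<..<t i}) {..<n} \<and>
       (\<Sum>i<n. t i - s i) < \<delta> \<longrightarrow> (\<Sum>i<n. dist (wrap T g (t i)) (wrap T g (s i))) < e"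
    by (intro exI[of _ \<delta>]) simp
qed

lemma circle_deriv_lift:
  assumes "\<And>t. t \<in> {0..T} \<Longrightarrow> \<gamma> t = circle_of_real (g t)"
    and "s \<in> {0<..<T}" "(g has_real_derivative v) (at s)"
  shows "circle_deriv \<gamma> s = v"
proof (rule circle_deriv_eq)
  have "\<forall>\<^sub>F u in nhds s. u \<in> {0<..<T}"
    using assms(2) by (intro eventually_nhds_in_open) auto
  then have "\<forall>\<^sub>F u in nhds s. \<gamma> u = circle_of_real (g u)"
    by eventually_elim (simp add: assms(1))
  with assms(3) show "has_circle_derivative \<gamma> v s"
    unfolding has_circle_derivative_def by blast
qed

lemma wrap_cadlag:
  assumes "continuous_on {0..T} g"
  shows "wrap T g \<in> cadlag_paths T"
proof -
  have lim: "(wrap T g \<longlongrightarrow> wrap T g t) (at t within {0..T})" if "t \<in> {0..T}" for t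
  proof -
    have g: "(g \<longlongrightarrow> g t) (at t within {0..T})"
      using assms that by (simp add: continuous_on)
    have "((\<lambda>u. dist (wrap T g u) (wrap T g t)) \<longlongrightarrow> 0) (at t within {0..T})"
    proof (rule Lim_null_comparison)
      show "((\<lambda>u. \<bar>g u - g t\<bar>) \<longlongrightarrow> 0) (at t within {0..T})"
        using g by (intro tendsto_rabs_zero) (simp add: LIM_zero_iff)
      show "\<forall>\<^sub>F u in at t within {0..T}. norm (dist (wrap T g u) (wrap T g t)) \<le> \<bar>g u - g t\<bar>"
        unfolding eventually_at_filter
        using that by (intro always_eventually) (simp add: wrap_apply dist_circle_of_real_le)
    qed
    then show ?thesis by (rule tendsto_dist_iff[THEN iffD2])
  qed
  have "(wrap T g \<longlongrightarrow> wrap T g t) (at_right t)" if "t \<in> {0..<T}" for t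
  proof -
    have "at_right t = at t within {t..T}"
      using that by (simp add: at_within_Icc_at_right)
    also have "\<dots> \<le> at t within {0..T}" using that by (intro at_le) auto
    finally show ?thesis by (rule tendsto_mono) (use that in \<open>simp add: lim\<close>)
  qed
  moreover have "(wrap T g \<longlongrightarrow> wrap T g t) (at_left t)" if "t \<in> {0<..T}" for t
  proof -
    have "at_left t = at t within {0..t}"
      using that by (simp add: at_within_Icc_at_left)
    also have "\<dots> \<le> at t within {0..T}" using that by (intro at_le) auto
    finally show ?thesis by (rule tendsto_mono) (use that in \<open>simp add: lim\<close>)
  qed
  moreover have "wrap T g \<in> extensional {0..T}" by (simp add: wrap_def)
  ultimately show ?thesis unfolding cadlag_paths_def by blast
qed

text \<open>
  The function \<open>exp (2 * pi * \<i> * \<gamma> t)\<close> has a continuous logarithm on the interval, whose imaginary part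
  divided by \<open>2 * pi\<close> differs from \<open>Rep_circle (\<gamma> t)\<close> by an integer. Shifting it by its integer offset at
  time 0 fixes the starting point.
\<close>

lemma abs_cont_lift:
  assumes \<gamma>: "\<gamma> \<in> abs_cont_paths T" and "0 < T"
  obtains g where "abs_cont T g" "\<And>t. t \<in> {0..T} \<Longrightarrow> \<gamma> t = circle_of_real (g t)" "g 0 = Rep_circle (\<gamma> 0)"
proof -
  have ac: "\<exists>\<delta>>0. \<forall>n. \<forall>s t :: nat \<Rightarrow> real.
       (\<forall>i<n. 0 \<le> s i \<and> s i \<le> t i \<and> t i \<le> T) \<and>
       disjoint_family_on (\<lambda>i. {s i<..<t i}) {..<n} \<and>
       (\<Sum>i<n. t i - s i) < \<delta> \<longrightarrow> (\<Sum>i<n. dist (\<gamma> (t i)) (\<gamma> (s i))) < e" if "e > 0" for e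
    using \<gamma> that by (simp add: abs_cont_paths_def)
  have near: "\<exists>\<delta>>0. \<forall>s\<in>{0..T}. \<forall>t\<in>{0..T}. \<bar>t - s\<bar> < \<delta> \<longrightarrow> dist (\<gamma> s) (\<gamma> t) < e" if e: "e > 0" for e
  proof -
    obtain \<delta> where "\<delta> > 0" and \<delta>: "\<forall>n. \<forall>s t :: nat \<Rightarrow> real.
       (\<forall>i<n. 0 \<le> s i \<and> s i \<le> t i \<and> t i \<le> T) \<and>
       disjoint_family_on (\<lambda>i. {s i<..<t i}) {..<n} \<and>
       (\<Sum>i<n. t i - s i) < \<delta> \<longrightarrow> (\<Sum>i<n. dist (\<gamma> (t i)) (\<gamma> (s i))) < e"
      using ac[OF e] by (elim exE conjE) (rule that)
    have *: "dist (\<gamma> t) (\<gamma> s) < e" if "0 \<le> s" "s \<le> t" "t \<le> T" "t - s < \<delta>" for s t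
      using \<delta>[rule_format, of 1 "\<lambda>_. s" "\<lambda>_. t"] that by (simp add: disjoint_family_on_def)
    have "dist (\<gamma> s) (\<gamma> t) < e" if "s \<in> {0..T}" "t \<in> {0..T}" "\<bar>t - s\<bar> < \<delta>" for s t
    proof (cases "s \<le> t")
      case True
      then show ?thesis using *[of s t] that by (simp add: dist_commute)
    next
      case False
      then show ?thesis using *[of t s] that by simp
    qed
    with \<open>\<delta> > 0\<close> show ?thesis by blast
  qed
  define F where "F t = exp (\<i> * of_real (2 * pi * Rep_circle (\<gamma> t)))" for t
  have "continuous_on {0..T} F"
    unfolding continuous_on
  proof
    fix t assume t: "t \<in> {0..T}"
    \<comment> \<open>Near \<open>t\<close> the exponential is a function of the displacement from \<open>\<gamma> t\<close>, which is continuous although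
      \<^const>\<open>Rep_circle\<close> is not.\<close>
    have "\<exists>d. \<bar>d\<bar> = dist (\<gamma> t) (\<gamma> s) \<and> circle_shift d (\<gamma> t) = \<gamma> s" for s
      using circle_displacement[of "\<gamma> t" "\<gamma> s"] by metis
    then obtain d where d: "\<And>s. \<bar>d s\<bar> = dist (\<gamma> t) (\<gamma> s)" "\<And>s. circle_shift (d s) (\<gamma> t) = \<gamma> s" by metis
    have F_eq: "F s = F t * exp (\<i> * of_real (2 * pi * d s))" for s
    proof -
      have "circle_of_real (Rep_circle (\<gamma> t) + d s) = circle_of_real (Rep_circle (\<gamma> s))"
        using d(2)[of s] by (simp add: circle_shift_def circle_of_real_Rep)
      then obtain n where n: "Rep_circle (\<gamma> t) + d s - Rep_circle (\<gamma> s) = of_int n"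
        unfolding circle_of_real_eq_iff by (rule Ints_cases)
      have "F t * exp (\<i> * of_real (2 * pi * d s)) = exp (\<i> * of_real (2 * pi * (Rep_circle (\<gamma> t) + d s)))"
        by (simp add: F_def algebra_simps flip: exp_add)
      also have "\<dots> = F s"
      proof -
        have r: "Rep_circle (\<gamma> t) + d s = Rep_circle (\<gamma> s) + of_int n" using n by simp
        show ?thesis unfolding F_def exp_eq r by (intro exI[of _ n]) (simp add: algebra_simps)
      qed
      finally show ?thesis ..
    qed
    have "(d \<longlongrightarrow> 0) (at t within {0..T})"
    proof (rule tendstoI)
      fix e :: real assume "e > 0"
      then obtain \<delta> where "\<delta> > 0" and \<delta>: "\<forall>s\<in>{0..T}. \<forall>t\<in>{0..T}. \<bar>t - s\<bar> < \<delta> \<longrightarrow> dist (\<gamma> s) (\<gamma> t) < e"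
        using near by blast
      show "\<forall>\<^sub>F s in at t within {0..T}. dist (d s) 0 < e"
        unfolding eventually_at
      proof (intro exI[of _ \<delta>] conjI[OF \<open>\<delta> > 0\<close>] ballI impI, elim conjE)
        fix s assume "s \<in> {0..T}" "dist s t < \<delta>"
        then show "dist (d s) 0 < e" using \<delta> t d(1)[of s] by (simp add: dist_real_def)
      qed
    qed
    then have "((\<lambda>s. F t * exp (\<i> * of_real (2 * pi * d s))) \<longlongrightarrow> F t * exp (\<i> * of_real (2 * pi * 0))) (at t within {0..T})"
      by (intro tendsto_intros)
    then show "(F \<longlongrightarrow> F t) (at t within {0..T})"
      unfolding F_eq[symmetric] by simp
  qed
  moreover have "contractible {0..T}" by (intro convex_imp_contractible) simp
  ultimately obtain L where L: "continuous_on {0..T} L" "\<And>t. t \<in> {0..T} \<Longrightarrow> F t = exp (L t)"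
    by (rule continuous_logarithm_on_contractible) (auto simp: F_def)
  define g0 where "g0 t = Im (L t) / (2 * pi)" for t
  have int: "g0 t - Rep_circle (\<gamma> t) \<in> \<int>" if t: "t \<in> {0..T}" for t
  proof -
    have "exp (L t) = exp (\<i> * of_real (2 * pi * Rep_circle (\<gamma> t)))" using L(2)[OF t] by (simp add: F_def)
    then obtain n where n: "L t = \<i> * of_real (2 * pi * Rep_circle (\<gamma> t)) + (of_int (2 * n) * pi) * \<i>"
      unfolding exp_eq by blast
    have "Im (L t) = 2 * pi * Rep_circle (\<gamma> t) + 2 * of_int n * pi" unfolding n by simp
    then have "g0 t = Rep_circle (\<gamma> t) + of_int n" by (simp add: g0_def field_simps)
    then show ?thesis by simp
  qed
  define g where "g t = g0 t - (g0 0 - Rep_circle (\<gamma> 0))" for t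
  have "0 \<in> {0..T}" using \<open>0 < T\<close> by simp
  have lift: "\<gamma> t = circle_of_real (g t)" if "t \<in> {0..T}" for t
  proof -
    have "Rep_circle (\<gamma> t) - g t = - (g0 t - Rep_circle (\<gamma> t)) + (g0 0 - Rep_circle (\<gamma> 0))"
      by (simp add: g_def)
    also have "\<dots> \<in> \<int>" using int[OF that] int[OF \<open>0 \<in> {0..T}\<close>] by (intro Ints_add Ints_minus)
    finally have "circle_of_real (Rep_circle (\<gamma> t)) = circle_of_real (g t)" unfolding circle_of_real_eq_iff .
    then show ?thesis by (simp add: circle_of_real_Rep)
  qed
  have "continuous_on {0..T} g" unfolding g_def g0_def by (intro continuous_intros L(1)) simp
  then have "uniformly_continuous_on {0..T} g" by (intro compact_uniformly_continuous) auto
  then obtain \<delta>1 where "\<delta>1 > 0" and \<delta>1: "\<And>s t. s \<in> {0..T} \<Longrightarrow> t \<in> {0..T} \<Longrightarrow> dist t s < \<delta>1 \<Longrightarrow> dist (g t) (g s) < 1/2"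
    unfolding uniformly_continuous_on_def by (metis half_gt_zero_iff zero_less_one)
  have "abs_cont T g"
    unfolding abs_cont_def
  proof (intro allI impI)
    fix e :: real assume "e > 0"
    obtain \<delta> where "\<delta> > 0" and \<delta>: "\<forall>n. \<forall>s t :: nat \<Rightarrow> real.
       (\<forall>i<n. 0 \<le> s i \<and> s i \<le> t i \<and> t i \<le> T) \<and>
       disjoint_family_on (\<lambda>i. {s i<..<t i}) {..<n} \<and>
       (\<Sum>i<n. t i - s i) < \<delta> \<longrightarrow> (\<Sum>i<n. dist (\<gamma> (t i)) (\<gamma> (s i))) < e"
      using ac[OF \<open>e > 0\<close>] by (elim exE conjE) (rule that)
    have "(\<Sum>i<n. \<bar>g (t i) - g (s i)\<bar>) < e"
      if st: "\<forall>i<n. 0 \<le> s i \<and> s i \<le> t i \<and> t i \<le> T"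
        and disj: "disjoint_family_on (\<lambda>i. {s i<..<t i}) {..<n}"
        and small: "(\<Sum>i<n. t i - s i) < min \<delta> \<delta>1" for n and s t :: "nat \<Rightarrow> real"
    proof -
      have "(\<Sum>i<n. \<bar>g (t i) - g (s i)\<bar>) = (\<Sum>i<n. dist (\<gamma> (t i)) (\<gamma> (s i)))"
      proof (rule sum.cong[OF refl])
        fix i assume i: "i \<in> {..<n}"
        then have T: "t i \<in> {0..T}" "s i \<in> {0..T}" "s i \<le> t i" using st by force+
        have "t i - s i \<le> (\<Sum>i<n. t i - s i)" using st i by (intro member_le_sum) auto
        then have "dist (t i) (s i) < \<delta>1" using small T by (simp add: dist_real_def)
        then have "\<bar>g (t i) - g (s i)\<bar> < 1 / 2" using \<delta>1[OF T(2,1)] by (simp add: dist_real_def)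
        then show "\<bar>g (t i) - g (s i)\<bar> = dist (\<gamma> (t i)) (\<gamma> (s i))"
          unfolding lift[OF T(1)] lift[OF T(2)] by (intro dist_circle_of_real_eq[symmetric]) simp
      qed
      also have "\<dots> < e" using \<delta> st disj small by simp
      finally show ?thesis .
    qed
    with \<open>\<delta> > 0\<close> \<open>\<delta>1 > 0\<close> show "\<exists>\<delta>>0. \<forall>n. \<forall>s t :: nat \<Rightarrow> real.
       (\<forall>i<n. 0 \<le> s i \<and> s i \<le> t i \<and> t i \<le> T) \<and>
       disjoint_family_on (\<lambda>i. {s i<..<t i}) {..<n} \<and>
       (\<Sum>i<n. t i - s i) < \<delta> \<longrightarrow> (\<Sum>i<n. \<bar>g (t i) - g (s i)\<bar>) < e"
      by (intro exI[of _ "min \<delta> \<delta>1"]) simp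
  qed
  moreover have "g 0 = Rep_circle (\<gamma> 0)" by (simp add: g_def)
  ultimately show ?thesis using lift by (intro that)
qed

section \<open>The action as the least majorant\<close>

lemma negligible_AE: "negligible N \<Longrightarrow> AE x in lebesgue. x \<notin> N"
  unfolding negligible_iff_null_sets by (rule AE_not_in)

lemma difference_quotient_tendsto:
  fixes G :: "real \<Rightarrow> real"
  assumes "(G has_real_derivative D) (at s)" "h \<longlonglongrightarrow> 0" "\<And>n. h n \<noteq> 0"
  shows "(\<lambda>n. (G (s + h n) - G s) / h n) \<longlonglongrightarrow> D"
proof -
  have lim: "(\<lambda>k. (G (s + k) - G s) / k) \<midarrow>0\<rightarrow> D" using assms(1) by (simp add: DERIV_def)
  have h: "filterlim h (at 0) sequentially" using assms(2,3) by (simp add: filterlim_at)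
  show ?thesis by (rule filterlim_compose[OF lim h])
qed

text \<open>
  The function \<open>g\<close> is extended by constants, so that its difference quotients make sense up to time \<open>T\<close>; they
  make the density of the action a limit of measurable functions.
\<close>

lemma rate_density_difference_quotient:
  assumes ac: "abs_cont T g" and "0 < T"
  defines "G \<equiv> \<lambda>t. g (max 0 (min T t))"
  shows rate_density_difference_quotient_measurable:
      "0 < h \<Longrightarrow> (\<lambda>s. rate_density ((G (s + h) - G s) / h)) \<in> borel_measurable lebesgue"
    and rate_density_difference_quotient_tendsto:
      "s \<in> {0<..<T} \<Longrightarrow> (g has_real_derivative D) (at s) \<Longrightarrow>
        (\<lambda>n. rate_density ((G (s + 1 / real (Suc n)) - G s) / (1 / real (Suc n)))) \<longlonglongrightarrow> rate_density D"
proof -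
  have contG: "continuous_on UNIV G"
    unfolding G_def
    by (rule continuous_on_compose2[OF abs_cont_continuous[OF ac]]) (auto intro!: continuous_intros, use \<open>0 < T\<close> in auto)
  show "(\<lambda>s. rate_density ((G (s + h) - G s) / h)) \<in> borel_measurable lebesgue" if "0 < h"
  proof -
    have "continuous_on UNIV (\<lambda>s. rate_density ((G (s + h) - G s) / h))"
      using that
      by (intro continuous_on_compose2[OF continuous_rate_density] continuous_intros
          continuous_on_compose2[OF contG]) auto
    then have "(\<lambda>s. rate_density ((G (s + h) - G s) / h)) \<in> borel_measurable borel"
      by (rule borel_measurable_continuous_onI)
    then have "(\<lambda>s. rate_density ((G (s + h) - G s) / h)) \<in> borel_measurable lborel" by simp
    then show ?thesis by (rule measurable_completion)
  qed
  assume s: "s \<in> {0<..<T}" and D: "(g has_real_derivative D) (at s)"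
  define h where "h n = 1 / real (Suc n)" for n
  have "(G has_real_derivative D) (at s)"
  proof -
    have "\<forall>\<^sub>F x in nhds s. x \<in> {0<..<T}"
      using s by (intro eventually_nhds_in_open) auto
    then have "\<forall>\<^sub>F x in nhds s. g x = G x"
      by eventually_elim (simp add: G_def)
    then show ?thesis using D by (subst (asm) DERIV_cong_ev[OF refl _ refl, of g G]) auto
  qed
  moreover have "h \<longlonglongrightarrow> 0" unfolding h_def using LIMSEQ_inverse_real_of_nat by (simp add: inverse_eq_divide)
  moreover have "h n \<noteq> 0" for n by (simp add: h_def)
  ultimately have "(\<lambda>n. (G (s + h n) - G s) / h n) \<longlonglongrightarrow> D"
    by (rule difference_quotient_tendsto)
  then have "(\<lambda>n. rate_density ((G (s + h n) - G s) / h n)) \<longlonglongrightarrow> rate_density D"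
    using continuous_rate_density by (intro isCont_tendsto_compose[of _ rate_density]) (auto simp: continuous_on_eq_continuous_at)
  then show "(\<lambda>n. rate_density ((G (s + 1 / real (Suc n)) - G s) / (1 / real (Suc n)))) \<longlonglongrightarrow> rate_density D"
    unfolding h_def .
qed

text \<open>
  Fatou's lemma for the difference quotients of \<open>g\<close>. The rate density of a quotient is at most the
  quotient \<open>(B (s + h) - B s) / h\<close> of the majorant, and the integral of the latter over \<open>[0,T]\<close> is at most
  \<open>A T - A 0\<close> because the integrals of \<open>B\<close> and of its shift differ only near the two ends.
\<close>

lemma action_wrap_le:
  assumes maj: "action_majorant T g A" and "0 < T"
  shows "action T (wrap T g) \<le> ereal (A T - A 0)"
proof -
  have ac: "abs_cont T g" using action_majorant_abs_cont[OF maj] \<open>0 < T\<close> by simp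
  \<comment> \<open>Extension of \<open>g\<close> and \<open>A\<close> by constants.\<close>
  define cl where "cl t = max 0 (min T t)" for t :: real
  have cl: "cl t \<in> {0..T}" "s \<le> t \<Longrightarrow> cl s \<le> cl t" "s \<le> t \<Longrightarrow> cl t - cl s \<le> t - s" for s t
    using \<open>0 < T\<close> by (auto simp: cl_def)
  have cl_id: "t \<in> {0..T} \<Longrightarrow> cl t = t" for t by (simp add: cl_def)
  define G where "G t = g (cl t)" for t
  define B where "B t = A (cl t)" for t
  have B_mono: "B s \<le> B t" if "s \<le> t" for s t
    unfolding B_def using cl[of s] cl[of t] cl(2)[OF that] by (intro action_majorant_mono[OF maj]) auto
  have slope: "rate_density ((G (s + h) - G s) / h) \<le> (B (h + s) - B s) / h" if "0 < h" for s h
  proof (rule rate_density_leI)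
    fix q
    have "q * (G (s + h) - G s) - (cl (s + h) - cl s) * cumulant q \<le> B (s + h) - B s"
      unfolding G_def B_def using cl(1)[of s] cl(1)[of "s + h"] cl(2)[of s "s + h"] that
      by (intro action_majorantD[OF maj]) auto
    moreover have "(cl (s + h) - cl s) * cumulant q \<le> h * cumulant q"
      using cl(3)[of s "s + h"] that cumulant_nonneg by (intro mult_right_mono) auto
    ultimately have "q * (G (s + h) - G s) \<le> B (h + s) - B s + h * cumulant q" by (simp add: add.commute)
    then have "q * (G (s + h) - G s) / h \<le> (B (h + s) - B s + h * cumulant q) / h"
      using that by (intro divide_right_mono) auto
    also have "\<dots> = (B (h + s) - B s) / h + cumulant q"
      using that by (simp add: add_divide_distrib)
    finally show "q * ((G (s + h) - G s) / h) - cumulant q \<le> (B (h + s) - B s) / h" by simp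
  qed
  have B_int: "B integrable_on {a..b}" for a b
    by (rule integrable_on_mono_on) (auto intro!: mono_onI B_mono)
  have incr: "\<exists>J. ((\<lambda>s. (B (h + s) - B s) / h) has_integral J) {0..T} \<and> J \<le> A T - A 0" if "0 < h" for h
  proof -
    have shift: "((\<lambda>s. B (h + s)) has_integral integral {h..T + h} B) {0..T}"
      using has_integral_shift_Icc_real[of B h "integral {h..T + h} B" 0 T] B_int
      by (simp add: o_def has_integral_integral[symmetric])
    have "((\<lambda>s. (B (h + s) - B s) / h) has_integral (integral {h..T + h} B - integral {0..T} B) / h) {0..T}"
      by (intro has_integral_divide has_integral_diff shift integrable_integral B_int)
    moreover have "integral {0..T} B + integral {T..T + h} B = integral {0..T + h} B"
      using \<open>0 < T\<close> that B_int by (intro Henstock_Kurzweil_Integration.integral_combine) auto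
    moreover have "integral {0..h} B + integral {h..T + h} B = integral {0..T + h} B"
      using \<open>0 < T\<close> that B_int by (intro Henstock_Kurzweil_Integration.integral_combine) auto
    moreover have "integral {T..T + h} B \<le> integral {T..T + h} (\<lambda>_. A T)"
      using \<open>0 < T\<close> by (intro integral_le B_int) (auto simp: B_def cl_def)
    moreover have "integral {0..h} (\<lambda>_. A 0) \<le> integral {0..h} B"
      using B_mono[of 0] cl_id[of 0] \<open>0 < T\<close> by (intro integral_le B_int) (auto simp: B_def)
    ultimately have "(integral {h..T + h} B - integral {0..T} B) / h \<le> (h * (A T - A 0)) / h"
      using that by (intro divide_right_mono) (auto simp: algebra_simps)
    with \<open>((\<lambda>s. (B (h + s) - B s) / h) has_integral (integral {h..T + h} B - integral {0..T} B) / h) {0..T}\<close>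
    show ?thesis using that by auto
  qed
  define h where "h n = 1 / real (Suc n)" for n
  have h: "h n > 0" for n by (simp add: h_def)
  define u where "u n s = ennreal (rate_density ((G (s + h n) - G s) / h n)) * indicator {0..T} s" for n s
  have u_le: "(\<integral>\<^sup>+s. u n s \<partial>lebesgue) \<le> ennreal (A T - A 0)" for n
  proof -
    obtain J where J: "((\<lambda>s. (B (h n + s) - B s) / h n) has_integral J) {0..T}" "J \<le> A T - A 0"
      using incr[OF h] by blast
    have "(\<integral>\<^sup>+s. u n s \<partial>lebesgue) \<le> (\<integral>\<^sup>+s. ennreal ((B (h n + s) - B s) / h n) * indicator {0..T} s \<partial>lebesgue)"
      unfolding u_def using slope[OF h] by (intro nn_integral_mono mult_right_mono ennreal_leI) auto
    also have "\<dots> = ennreal J"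
      unfolding nn_integral_completion using h[of n] B_mono
      by (intro nn_integral_has_integral_lebesgue'[OF _ J(1)]) (auto intro!: divide_nonneg_pos)
    also have "\<dots> \<le> ennreal (A T - A 0)" using J(2) by (rule ennreal_leI)
    finally show ?thesis .
  qed
  have u_meas: "u n \<in> borel_measurable lebesgue" for n
  proof -
    have "(\<lambda>s. rate_density ((G (s + h n) - G s) / h n)) \<in> borel_measurable lebesgue"
      unfolding G_def[abs_def] cl_def
      by (rule rate_density_difference_quotient_measurable[OF ac \<open>0 < T\<close> h])
    then have "(\<lambda>s. ennreal (rate_density ((G (s + h n) - G s) / h n))) \<in> borel_measurable lebesgue"
      by (rule measurable_compose[OF _ measurable_ennreal])
    then show ?thesis unfolding u_def
      by (intro borel_measurable_times_ennreal borel_measurable_indicator) auto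
  qed
  obtain N where N: "negligible N" "\<And>x. x \<in> {0<..<T} - N \<Longrightarrow> \<exists>D. (g has_real_derivative D) (at x)"
    using abs_cont_differentiable[OF ac \<open>0 < T\<close>] by blast
  have lim: "ennreal (rate_density (circle_deriv (wrap T g) s)) * indicator {0..T} s = liminf (\<lambda>n. u n s)"
    if s: "s \<notin> N \<union> {0, T}" for s
  proof (cases "s \<in> {0..T}")
    case False
    then show ?thesis by (simp add: u_def Liminf_const)
  next
    case True
    then have s': "s \<in> {0<..<T} - N" using s by auto
    then obtain D where D: "(g has_real_derivative D) (at s)" using N(2) by blast
    have cd: "circle_deriv (wrap T g) s = D"
      using s' by (intro circle_deriv_lift[OF _ _ D, of T]) (auto simp: wrap_apply)
    have "(\<lambda>n. rate_density ((G (s + h n) - G s) / h n)) \<longlonglongrightarrow> rate_density D"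
      unfolding G_def[abs_def] cl_def h_def
      using s' by (intro rate_density_difference_quotient_tendsto[OF ac \<open>0 < T\<close> _ D]) simp
    then have "(\<lambda>n. u n s) \<longlonglongrightarrow> ennreal (rate_density D)"
      using True by (simp add: u_def)
    then show ?thesis using True by (simp add: cd lim_imp_Liminf)
  qed
  have "negligible (N \<union> {0, T})" using N(1) by (simp add: negligible_Un negligible_insert)
  then have "(\<integral>\<^sup>+s\<in>{0..T}. ennreal (rate_density (circle_deriv (wrap T g) s)) \<partial>lebesgue)
      = (\<integral>\<^sup>+s. liminf (\<lambda>n. u n s) \<partial>lebesgue)"
    by (intro nn_integral_cong_AE eventually_mono[OF negligible_AE] lim)
  also have "\<dots> \<le> liminf (\<lambda>n. \<integral>\<^sup>+s. u n s \<partial>lebesgue)"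
    using u_meas by (rule nn_integral_liminf)
  also have "\<dots> \<le> limsup (\<lambda>n. \<integral>\<^sup>+s. u n s \<partial>lebesgue)"
    by (intro Liminf_le_Limsup) simp
  also have "\<dots> \<le> ennreal (A T - A 0)"
    using u_le by (intro Limsup_bounded) simp
  finally have "(\<integral>\<^sup>+s\<in>{0..T}. ennreal (rate_density (circle_deriv (wrap T g) s)) \<partial>lebesgue) \<le> ennreal (A T - A 0)" .
  moreover have "0 \<le> A T - A 0" using action_majorant_mono[OF maj, of 0 T] \<open>0 < T\<close> by simp
  ultimately have "enn2ereal (\<integral>\<^sup>+s\<in>{0..T}. ennreal (rate_density (circle_deriv (wrap T g) s)) \<partial>lebesgue) \<le> ereal (A T - A 0)"
    by (metis enn2ereal_ennreal less_eq_ennreal.rep_eq)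
  then show ?thesis using wrap_abs_cont[OF ac] by (simp add: action_def)
qed

text \<open>
  Young's inequality \<open>q * v - cumulant q \<le> rate_density v\<close> is integrated over \<open>[s,t]\<close>, where \<open>g\<close> is the
  integral of its derivative and \<open>A\<close> is the running action.
\<close>

lemma action_self_majorant:
  assumes "abs_cont T g" "0 < T" and lift: "\<And>t. t \<in> {0..T} \<Longrightarrow> \<gamma> t = circle_of_real (g t)"
    and fin: "action T \<gamma> = ereal a"
  shows "\<exists>A. action_majorant T g A \<and> A 0 = 0 \<and> A T = a"
proof -
  note ac = assms(1)
  have "\<gamma> \<in> abs_cont_paths T" using fin by (auto simp: action_def split: if_splits)
  then have act: "enn2ereal (\<integral>\<^sup>+s\<in>{0..T}. ennreal (rate_density (circle_deriv \<gamma> s)) \<partial>lebesgue) = ereal a"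
    using fin by (simp add: action_def)
  obtain N where N: "negligible N" "\<And>x. x \<in> {0<..<T} - N \<Longrightarrow> \<exists>D. (g has_real_derivative D) (at x)"
    using abs_cont_differentiable[OF ac \<open>0 < T\<close>] by blast
  \<comment> \<open>Both functions are 0 where \<open>g\<close> may fail to be differentiable, so that \<open>\<psi>\<close> is a limit of measurable functions at every point.\<close>
  define \<phi> where "\<phi> s = (if s \<in> {0<..<T} - N then circle_deriv \<gamma> s else 0)" for s
  define \<psi> where "\<psi> s = (if s \<in> {0<..<T} - N then rate_density (\<phi> s) else 0)" for s
  have der: "(g has_real_derivative \<phi> s) (at s)" if s: "s \<in> {0<..<T} - N" for s
  proof -
    obtain D where D: "(g has_real_derivative D) (at s)" using N(2)[OF s] by blast
    have "circle_deriv \<gamma> s = D" using s by (intro circle_deriv_lift[OF lift _ D]) auto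
    then show ?thesis using D s by (simp add: \<phi>_def)
  qed
  have sets: "{0<..<T} - N \<in> sets lebesgue" using negligible_imp_sets[OF N(1)] by auto
  have "\<psi> \<in> borel_measurable lebesgue"
  proof (rule borel_measurable_LIMSEQ_real)
    define v where "v n s = (if s \<in> {0<..<T} - N then rate_density
      ((g (max 0 (min T (s + 1 / real (Suc n)))) - g (max 0 (min T s))) / (1 / real (Suc n))) else 0)" for n s
    show "v n \<in> borel_measurable lebesgue" for n
      unfolding v_def using sets rate_density_difference_quotient_measurable[OF ac \<open>0 < T\<close>, of "1 / real (Suc n)"]
      by (intro measurable_If_set) auto
    show "(\<lambda>n. v n s) \<longlonglongrightarrow> \<psi> s" for s
    proof (cases "s \<in> {0<..<T} - N")
      case False
      then show ?thesis by (simp only: v_def \<psi>_def if_False) simp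
    next
      case True
      then have "s \<in> {0<..<T}" by simp
      from rate_density_difference_quotient_tendsto[OF ac \<open>0 < T\<close> this der[OF True]]
      show ?thesis unfolding v_def \<psi>_def using True by (simp only: if_True)
    qed
  qed
  moreover have \<psi>0: "0 \<le> \<psi> s" for s by (simp add: \<psi>_def rate_density_nonneg)
  moreover have "integral\<^sup>N lebesgue \<psi> = ennreal a"
  proof -
    have "negligible (N \<union> {0, T})" using N(1) by (simp add: negligible_Un negligible_insert)
    moreover have "ennreal (\<psi> s) = ennreal (rate_density (circle_deriv \<gamma> s)) * indicator {0..T} s"
      if "s \<notin> N \<union> {0, T}" for s
      using that by (auto simp: \<psi>_def \<phi>_def indicator_def)
    ultimately have "integral\<^sup>N lebesgue \<psi> = (\<integral>\<^sup>+s\<in>{0..T}. ennreal (rate_density (circle_deriv \<gamma> s)) \<partial>lebesgue)"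
      by (intro nn_integral_cong_AE eventually_mono[OF negligible_AE])
    also have "\<dots> = ennreal a"
      using act by (metis e2ennreal_enn2ereal e2ennreal_ereal)
    finally show ?thesis .
  qed
  moreover have "0 \<le> a" using act by (metis enn2ereal_nonneg ereal_less_eq(5))
  ultimately have \<psi>_int: "(\<psi> has_integral a) UNIV"
    using has_integral_iff_nn_integral_lebesgue[of \<psi> a, OF \<psi>0] by simp
  then have "\<psi> absolutely_integrable_on UNIV"
    using \<psi>0 by (intro nonnegative_absolutely_integrable_1) (auto simp: integrable_on_def)
  then have \<psi>_on: "\<psi> integrable_on {s..t}" for s t
  proof -
    have "\<psi> absolutely_integrable_on cbox s t"
      by (rule set_integrable_subset[OF \<open>\<psi> absolutely_integrable_on UNIV\<close>]) simp_all
    then have "\<psi> integrable_on cbox s t" by (rule set_lebesgue_integral_eq_integral(1))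
    then show ?thesis by simp
  qed
  define A where "A t = integral {0..t} \<psi>" for t
  have "A T = a"
  proof -
    have "(\<psi> has_integral a) {0..T}"
    proof -
      have "(\<lambda>x. if x \<in> {0..T} then \<psi> x else 0) = \<psi>" by (auto simp: \<psi>_def fun_eq_iff)
      then show ?thesis using \<psi>_int has_integral_restrict_UNIV[of "{0..T}" \<psi> a] by simp
    qed
    then show ?thesis unfolding A_def by (rule integral_unique)
  qed
  moreover have "A 0 = 0" by (simp add: A_def)
  moreover have "action_majorant T g A"
    unfolding action_majorant_def
  proof (intro allI impI, elim conjE)
    fix q s t :: real assume st: "0 \<le> s" "s \<le> t" "t \<le> T"
    have "(\<phi> has_integral (g t - g s)) {s..t}"
      by (rule abs_cont_has_integral[OF ac N(1) der st])
    then have "((\<lambda>x. q * \<phi> x - cumulant q) has_integral (q * (g t - g s) - (t - s) * cumulant q)) {s..t}"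
      using has_integral_const_real[of "cumulant q" s t] st
      by (intro has_integral_diff has_integral_mult_right) auto
    moreover have "(\<psi> has_integral (A t - A s)) {s..t}"
    proof -
      have "integral {0..s} \<psi> + integral {s..t} \<psi> = integral {0..t} \<psi>"
        using st \<psi>_on by (intro Henstock_Kurzweil_Integration.integral_combine) auto
      then show ?thesis using \<psi>_on[of s t] unfolding A_def by (metis add_diff_cancel_left' integrable_integral)
    qed
    moreover have "q * \<phi> x - cumulant q \<le> \<psi> x" for x
      using rate_density_ge[of q "\<phi> x"] cumulant_nonneg[of q] by (auto simp: \<psi>_def \<phi>_def)
    ultimately show "q * (g t - g s) - (t - s) * cumulant q \<le> A t - A s"
      by (rule has_integral_le)
  qed
  ultimately show ?thesis by blast
qed

section \<open>Limits and compactness of majorised lifts\<close>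

text \<open>
  The upper limit \<open>B\<close> of the majorants serves: the left hand sides
  converge, and adding a convergent sequence commutes with the upper limit.
\<close>

lemma action_majorant_limit:
  assumes maj: "\<And>j. action_majorant T (g j) (A j)" and "0 \<le> T"
    and A0: "\<And>j. A j 0 = 0" and AT: "\<And>j. A j T \<le> m"
    and lim: "\<And>t. t \<in> {0..T} \<Longrightarrow> (\<lambda>j. g j t) \<longlonglongrightarrow> h t"
  shows "\<exists>B. action_majorant T h B \<and> B 0 = 0 \<and> B T \<le> m"
proof -
  define L where "L t = limsup (\<lambda>j. ereal (A j t))" for t
  have range: "0 \<le> A j t \<and> A j t \<le> m" if "t \<in> {0..T}" for j t
    using action_majorant_mono[OF maj[of j], of 0 t] action_majorant_mono[OF maj[of j], of t T]
      A0[of j] AT[of j] that by auto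
  have "0 \<le> L t \<and> L t \<le> ereal m" if "t \<in> {0..T}" for t
  proof
    show "L t \<le> ereal m" unfolding L_def using range[OF that] by (intro Limsup_bounded) auto
    have "0 \<le> liminf (\<lambda>j. ereal (A j t))" using range[OF that] by (intro Liminf_bounded) auto
    also have "\<dots> \<le> L t" unfolding L_def by (intro Liminf_le_Limsup) simp
    finally show "0 \<le> L t" .
  qed
  then have L_real: "L t = ereal (real_of_ereal (L t))" if "t \<in> {0..T}" for t
    using that by (metis abs_ereal_ge0 ereal_infty_less_eq(1) ereal_real not_infty_ereal order_antisym)
  define B where "B t = real_of_ereal (L t)" for t
  have LB: "L t = ereal (B t)" if "t \<in> {0..T}" for t using L_real[OF that] by (simp add: B_def)
  have "q * (h t - h s) - (t - s) * cumulant q \<le> B t - B s" if st: "0 \<le> s" "s \<le> t" "t \<le> T" for q s t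
  proof -
    have in_T: "s \<in> {0..T}" "t \<in> {0..T}" using st by auto
    define c where "c j = q * (g j t - g j s) - (t - s) * cumulant q" for j
    define c' where "c' = q * (h t - h s) - (t - s) * cumulant q"
    have "c \<longlonglongrightarrow> c'"
      unfolding c_def c'_def by (intro tendsto_intros lim in_T)
    then have "(\<lambda>j. ereal (c j)) \<longlonglongrightarrow> ereal c'" by simp
    then have "limsup (\<lambda>j. ereal (c j) + ereal (A j s)) = ereal c' + limsup (\<lambda>j. ereal (A j s))"
      by (rule ereal_limsup_lim_add) simp
    moreover have "limsup (\<lambda>j. ereal (c j) + ereal (A j s)) \<le> limsup (\<lambda>j. ereal (A j t))"
    proof (rule Limsup_mono, rule always_eventually, rule allI)
      fix j
      show "ereal (c j) + ereal (A j s) \<le> ereal (A j t)"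
        using action_majorantD[OF maj[of j] st, of q] by (simp add: c_def)
    qed
    ultimately have "ereal c' + L s \<le> L t" unfolding L_def by simp
    then show ?thesis using LB[OF in_T(1)] LB[OF in_T(2)] by (simp add: c'_def)
  qed
  then have "action_majorant T h B" unfolding action_majorant_def by blast
  moreover have "B 0 = 0" by (simp add: B_def L_def A0 Limsup_const flip: zero_ereal_def)
  moreover have "B T \<le> m"
  proof -
    have "L T \<le> ereal m" unfolding L_def using AT by (intro Limsup_bounded) auto
    then show ?thesis using LB[of T] \<open>0 \<le> T\<close> by simp
  qed
  ultimately show ?thesis by blast
qed

text \<open>
  A majorant of increment at most \<open>m\<close> gives \<open>q * \<bar>g t - g s\<bar> \<le> m + \<bar>t - s\<bar> * cumulant q\<close> for all
  \<open>q \<ge> 0\<close>, which is equicontinuity since \<open>q\<close> is arbitrary. The Arzela-Ascoli theorem yields a limit, and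
  \<open>action_majorant_limit\<close> its majorant.
\<close>

lemma action_majorant_compact:
  assumes maj: "\<And>j. action_majorant T (g j) (A j)" and "0 < T"
    and A0: "\<And>j. A j 0 = 0" and AT: "\<And>j. A j T \<le> m" and g0: "\<And>j. g j 0 = r"
  obtains h k B where "strict_mono (k :: nat \<Rightarrow> nat)" "action_majorant T h B" "B 0 = 0" "B T \<le> m" "h 0 = r"
    "\<forall>e>0. \<exists>N. \<forall>j\<ge>N. \<forall>t\<in>{0..T}. \<bar>g (k j) t - h t\<bar> < e"
proof -
  have incr: "q * \<bar>g j t - g j s\<bar> \<le> m + \<bar>t - s\<bar> * cumulant q" if "s \<in> {0..T}" "t \<in> {0..T}" "0 \<le> q" for j s t q
  proof -
    have *: "q * \<bar>g j t - g j s\<bar> \<le> m + (t - s) * cumulant q" if "0 \<le> s" "s \<le> t" "t \<le> T" for s t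
    proof -
      have "A j t \<le> m" "0 \<le> A j s"
        using action_majorant_mono[OF maj[of j], of t T] action_majorant_mono[OF maj[of j], of 0 s] AT[of j] A0[of j] that
        by auto
      then show ?thesis using action_majorant_abs[OF maj[of j] that \<open>0 \<le> q\<close>] by simp
    qed
    show ?thesis
    proof (cases "s \<le> t")
      case True
      then show ?thesis using *[of s t] that by simp
    next
      case False
      then show ?thesis using *[of t s] that by (simp add: abs_minus_commute)
    qed
  qed
  have "m \<ge> 0" using action_majorant_mono[OF maj[of 0], of 0 T] A0[of 0] AT[of 0] \<open>0 < T\<close> by simp
  obtain h k where hk: "continuous_on {0..T} h" "strict_mono (k :: nat \<Rightarrow> nat)"
    "\<And>e. 0 < e \<Longrightarrow> \<exists>N. \<forall>n x. n \<ge> N \<and> x \<in> {0..T} \<longrightarrow> norm (g (k n) x - h x) < e"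
  proof (rule Arzela_Ascoli[of "{0..T}" g "\<bar>r\<bar> + m + T * cumulant 1"])
    fix j t assume "t \<in> {0..T}"
    then have "\<bar>g j t - r\<bar> \<le> m + t * cumulant 1" using incr[of 0 t 1 j] g0[of j] \<open>0 < T\<close> by simp
    moreover have "t * cumulant 1 \<le> T * cumulant 1"
      using \<open>t \<in> {0..T}\<close> cumulant_nonneg by (intro mult_right_mono) auto
    ultimately show "norm (g j t) \<le> \<bar>r\<bar> + m + T * cumulant 1" by (simp add: real_norm_def)
  next
    fix x e :: real assume x: "x \<in> {0..T}" and "0 < e"
    define q where "q = 2 * (m + 1) / e"
    have "q > 0" using \<open>0 < e\<close> \<open>m \<ge> 0\<close> by (simp add: q_def)
    define d where "d = 1 / (cumulant q + 1)"
    have "d > 0" using cumulant_nonneg[of q] by (simp add: d_def)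
    have "\<bar>g j x - g j y\<bar> < e" if y: "y \<in> {0..T}" "\<bar>x - y\<bar> < d" for j y
    proof -
      have "q * \<bar>g j x - g j y\<bar> \<le> m + \<bar>x - y\<bar> * cumulant q" using incr[of y x q j] x y \<open>q > 0\<close> by simp
      also have "\<bar>x - y\<bar> * cumulant q \<le> d * cumulant q"
        using y cumulant_nonneg by (intro mult_right_mono) auto
      also have "d * cumulant q \<le> 1" using cumulant_nonneg[of q] by (simp add: d_def)
      finally have "\<bar>g j x - g j y\<bar> \<le> (m + 1) / q" using \<open>q > 0\<close> by (simp add: field_simps)
      also have "(m + 1) / q = e / 2" using \<open>m \<ge> 0\<close> \<open>e > 0\<close> by (simp add: q_def field_simps)
      also have "\<dots> < e" using \<open>e > 0\<close> by simp
      finally show ?thesis .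
    qed
    with \<open>d > 0\<close> show "\<exists>d. 0 < d \<and> (\<forall>n y. y \<in> {0..T} \<and> norm (x - y) < d \<longrightarrow> norm (g n x - g n y) < e)"
      by (intro exI[of _ d]) (simp add: real_norm_def)
  qed (use that in auto)
  have unif: "\<exists>N. \<forall>j\<ge>N. \<forall>t\<in>{0..T}. \<bar>g (k j) t - h t\<bar> < e" if e: "0 < e" for e
  proof -
    obtain N where "\<forall>n x. n \<ge> N \<and> x \<in> {0..T} \<longrightarrow> norm (g (k n) x - h x) < e"
      using hk(3)[OF e] by blast
    then show ?thesis by (intro exI[of _ N]) (simp add: real_norm_def)
  qed
  have lim: "(\<lambda>j. g (k j) t) \<longlonglongrightarrow> h t" if "t \<in> {0..T}" for t
  proof (rule LIMSEQ_I)
    fix e :: real assume "0 < e"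
    then obtain N where "\<forall>j\<ge>N. \<forall>t\<in>{0..T}. \<bar>g (k j) t - h t\<bar> < e" using unif by blast
    then show "\<exists>no. \<forall>n\<ge>no. norm (g (k n) t - h t) < e"
      using that by (intro exI[of _ N]) (simp add: real_norm_def)
  qed
  obtain B where B: "action_majorant T h B" "B 0 = 0" "B T \<le> m"
    using action_majorant_limit[of T "\<lambda>j. g (k j)" "\<lambda>j. A (k j)" m h] maj A0 AT lim \<open>0 < T\<close> by auto
  have "h 0 = r" using lim[of 0] g0 \<open>0 < T\<close> by (simp add: LIMSEQ_const_iff)
  moreover have "\<forall>e>0. \<exists>N. \<forall>j\<ge>N. \<forall>t\<in>{0..T}. \<bar>g (k j) t - h t\<bar> < e" using unif by blast
  ultimately show ?thesis by (rule that[OF hk(2) B])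
qed

text \<open>
  Otherwise there are paths \<open>\<gamma> j\<close> in \<open>C\<close> whose uniform distance to lifts \<open>g j\<close> of action at most \<open>m\<close>
  tends to 0. A uniform limit of the lifts along a subsequence has action at most \<open>m\<close>, but it is also a limit of paths of \<open>C\<close> and
  so lies in \<open>C\<close>.
\<close>

lemma closed_set_separated:
  assumes T: "0 < T" and closed: "closedin (skorohod_topology T) C"
    and rate: "\<And>\<gamma>. \<gamma> \<in> C \<Longrightarrow> ereal m < rate_function T y \<gamma>"
  shows "\<exists>\<delta>>0. \<forall>\<gamma>\<in>C. \<forall>g A. action_majorant T g A \<and> A 0 = 0 \<and> A T \<le> m \<and> g 0 = Rep_circle y \<longrightarrow>
    (\<exists>t\<in>{0..T}. \<delta> < dist (\<gamma> t) (circle_of_real (g t)))"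
proof (rule ccontr)
  assume no: "\<not> ?thesis"
  define \<delta> where "\<delta> j = 1 / real (Suc j)" for j
  have \<delta>: "\<delta> j > 0" for j by (simp add: \<delta>_def)
  have "\<exists>\<gamma> g A. \<gamma> \<in> C \<and> action_majorant T g A \<and> A 0 = 0 \<and> A T \<le> m \<and> g 0 = Rep_circle y \<and>
      (\<forall>t\<in>{0..T}. dist (\<gamma> t) (circle_of_real (g t)) \<le> \<delta> j)" for j
  proof -
    have "\<not> (\<forall>\<gamma>\<in>C. \<forall>g A. action_majorant T g A \<and> A 0 = 0 \<and> A T \<le> m \<and> g 0 = Rep_circle y \<longrightarrow>
        (\<exists>t\<in>{0..T}. \<delta> j < dist (\<gamma> t) (circle_of_real (g t))))"
      using no \<delta>[of j] by blast
    then show ?thesis by (simp only: not_less[symmetric]) blast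
  qed
  then obtain \<gamma> g A where *: "\<And>j. \<gamma> j \<in> C" "\<And>j. action_majorant T (g j) (A j)" "\<And>j. A j 0 = 0"
    "\<And>j. A j T \<le> m" "\<And>j. g j 0 = Rep_circle y"
    "\<And>j t. t \<in> {0..T} \<Longrightarrow> dist (\<gamma> j t) (circle_of_real (g j t)) \<le> \<delta> j"
    by metis
  obtain f k B where lim: "strict_mono (k :: nat \<Rightarrow> nat)" "action_majorant T f B" "B 0 = 0" "B T \<le> m"
    "f 0 = Rep_circle y" "\<forall>e>0. \<exists>N. \<forall>j\<ge>N. \<forall>t\<in>{0..T}. \<bar>g (k j) t - f t\<bar> < e"
    by (rule action_majorant_compact[OF *(2) T *(3,4,5)]) (rule that)
  interpret Metric_space "cadlag_paths T :: (real \<Rightarrow> circle) set" "skorohod_dist T"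
    using Metric_space_skorohod T by simp
  have cad: "wrap T f \<in> cadlag_paths T"
    using action_majorant_abs_cont[OF lim(2)] T by (intro wrap_cadlag abs_cont_continuous) simp
  have C_sub: "C \<subseteq> cadlag_paths T" using closed closedin_metric unfolding skorohod_topology_def by blast
  have "limitin mtopology (\<lambda>j. \<gamma> (k j)) (wrap T f) sequentially"
    unfolding limitin_metric
  proof (intro conjI allI impI cad)
    fix e :: real assume e: "0 < e"
    obtain N where N: "\<forall>j\<ge>N. \<forall>t\<in>{0..T}. \<bar>g (k j) t - f t\<bar> < e / 4" using lim(6)[rule_format, of "e / 4"] e by auto
    obtain N' where N': "4 / e < real N'" using reals_Archimedean2 by blast
    show "\<forall>\<^sub>F j in sequentially. \<gamma> (k j) \<in> cadlag_paths T \<and> skorohod_dist T (\<gamma> (k j)) (wrap T f) < e"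
      using eventually_ge_at_top[of "max N N'"]
    proof eventually_elim
      case (elim j)
      have "N' \<le> k j" using elim seq_suble[OF lim(1), of j] by simp
      then have "4 / e < real (Suc (k j))" using N' by linarith
      then have \<delta>e: "\<delta> (k j) < e / 4" using e by (simp add: \<delta>_def field_simps)
      have "dist (\<gamma> (k j) t) (wrap T f t) \<le> e / 2" if t: "t \<in> {0..T}" for t
      proof -
        have "dist (\<gamma> (k j) t) (wrap T f t) \<le> dist (\<gamma> (k j) t) (circle_of_real (g (k j) t))
            + dist (circle_of_real (g (k j) t)) (circle_of_real (f t))"
          unfolding wrap_apply[OF t] by (rule dist_triangle)
        also have "\<dots> \<le> \<delta> (k j) + \<bar>g (k j) t - f t\<bar>"
          by (intro add_mono *(6)[OF t] dist_circle_of_real_le)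
        also have "\<dots> \<le> e / 4 + e / 4"
          using \<delta>e N elim t by (intro add_mono) (auto intro: less_imp_le)
        finally show ?thesis by simp
      qed
      then have "skorohod_dist T (\<gamma> (k j)) (wrap T f) < e"
        using e T by (subst skorohod_dist_less_iff) (auto intro!: bexI[OF _ time_changes_id] exI[of _ "e / 2"])
      then show ?case using *(1) C_sub by blast
    qed
  qed
  moreover have "range (\<lambda>j. \<gamma> (k j)) \<subseteq> C" using *(1) by blast
  ultimately have "wrap T f \<in> C"
    using closed unfolding skorohod_topology_def metric_closedin_iff_sequentially_closed by blast
  then have "ereal m < rate_function T y (wrap T f)" by (rule rate)
  also have "\<dots> = action T (wrap T f)"
    using T lim(5) by (simp add: rate_function_def wrap_apply circle_of_real_Rep)
  also have "\<dots> \<le> ereal (B T - B 0)" by (rule action_wrap_le[OF lim(2) T])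
  also have "\<dots> \<le> ereal m" using lim(3,4) by simp
  finally show False by simp
qed

section \<open>Polygonal lifts\<close>

text \<open>
  A primitive of the step function with value \<open>c i\<close> on the \<open>i\<close>-th of \<open>n\<close> equal pieces of \<open>[0,T]\<close>. The value is
  linear in the slopes, so inequalities between slopes become inequalities between increments
  (\<open>polygon_mono\<close>, \<open>polygon_linear\<close>).
\<close>

definition polygon :: "real \<Rightarrow> nat \<Rightarrow> (nat \<Rightarrow> real) \<Rightarrow> real \<Rightarrow> real" where
  "polygon T n c t = (\<Sum>i<n. c i * (clip (real i * T / real n) (real (Suc i) * T / real n) t - real i * T / real n))"

lemma polygon_mono:
  "(\<And>i. i < n \<Longrightarrow> 0 \<le> c i) \<Longrightarrow> s \<le> t \<Longrightarrow> polygon T n c s \<le> polygon T n c t"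
  unfolding polygon_def by (intro sum_mono mult_left_mono diff_right_mono clip_mono) auto

lemma polygon_linear:
  "polygon T n (\<lambda>i. a i - q * b i + r) t = polygon T n a t - q * polygon T n b t + r * polygon T n (\<lambda>_. 1) t"
proof -
  define e where "e i = clip (real i * T / real n) (real (Suc i) * T / real n) t - real i * T / real n" for i
  show ?thesis unfolding polygon_def e_def[symmetric]
    by (simp add: algebra_simps sum.distrib sum_subtractf sum_distrib_left)
qed

lemma polygon_one:
  assumes "0 < n" "0 \<le> t" "t \<le> T"
  shows "polygon T n (\<lambda>_. 1) t = t"
proof -
  have "real i * T / real n \<le> real (Suc i) * T / real n" for i
    using assms by (intro divide_right_mono mult_right_mono) auto
  then show ?thesis
    using sum_clip[of n "\<lambda>i. real i * T / real n" t "\<lambda>x. x"] assms by (simp add: polygon_def)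
qed

lemma polygon_node:
  assumes "j \<le> n" "0 < n" "0 \<le> T"
  shows "polygon T n c (real j * T / real n) = (\<Sum>i<j. c i * (T / real n))"
proof -
  define u where "u i = real i * T / real n" for i
  have mono: "u i \<le> u i'" if "i \<le> i'" for i i'
    unfolding u_def using that assms by (intro divide_right_mono mult_right_mono) auto
  have step: "u (Suc i) - u i = T / real n" for i
    by (simp add: u_def add_divide_distrib distrib_right)
  have "polygon T n c (u j) = (\<Sum>i<n. if i < j then c i * (T / real n) else 0)"
    unfolding polygon_def u_def[symmetric]
  proof (rule sum.cong)
    fix i assume "i \<in> {..<n}"
    show "c i * (clip (u i) (u (Suc i)) (u j) - u i) = (if i < j then c i * (T / real n) else 0)"
    proof (cases "i < j")
      case True
      then have "clip (u i) (u (Suc i)) (u j) = u (Suc i)"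
        using mono[of "Suc i" j] mono[of i "Suc i"] by (simp add: clip_def min_absorb1 max_absorb2)
      then show ?thesis using True step by simp
    next
      case False
      then have "clip (u i) (u (Suc i)) (u j) = u i"
        using mono[of j i] mono[of j "Suc i"] by (simp add: clip_def min_absorb2 max_absorb1)
      then show ?thesis using False by simp
    qed
  qed simp
  also have "\<dots> = (\<Sum>i\<in>{..<n} \<inter> {..<j}. c i * (T / real n))"
    by (subst sum.inter_restrict) simp_all
  also have "{..<n} \<inter> {..<j} = {..<j}" using assms by auto
  finally show ?thesis by (simp add: u_def)
qed

text \<open>
  On each piece the slopes satisfy \<open>q * v i - cumulant q \<le> rate_density (v i)\<close>. The difference of the two
  sides, as slopes of a polygon, gives a nondecreasing function.
\<close>

lemma action_majorant_polygon:
  assumes "0 < n" "0 < T"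
  shows "action_majorant T (\<lambda>t. r + polygon T n v t) (polygon T n (\<lambda>i. rate_density (v i)))"
  unfolding action_majorant_def
proof (intro allI impI, elim conjE)
  fix q s t :: real assume st: "0 \<le> s" "s \<le> t" "t \<le> T"
  have "polygon T n (\<lambda>i. rate_density (v i) - q * v i + cumulant q) s
      \<le> polygon T n (\<lambda>i. rate_density (v i) - q * v i + cumulant q) t"
  proof (rule polygon_mono[OF _ st(2)])
    fix i show "0 \<le> rate_density (v i) - q * v i + cumulant q"
      using rate_density_ge[of q "v i"] by simp
  qed
  then show "q * (r + polygon T n v t - (r + polygon T n v s)) - (t - s) * cumulant q
      \<le> polygon T n (\<lambda>i. rate_density (v i)) t - polygon T n (\<lambda>i. rate_density (v i)) s"
    unfolding polygon_linear using polygon_one[of n s T] polygon_one[of n t T] assms st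
    by (simp add: algebra_simps)
qed

lemma polygon_abs_diff:
  assumes "s \<le> t"
  shows "\<bar>polygon T n v t - polygon T n v s\<bar> \<le> polygon T n (\<lambda>i. \<bar>v i\<bar>) t - polygon T n (\<lambda>i. \<bar>v i\<bar>) s"
proof -
  have "polygon T n (\<lambda>i. \<bar>v i\<bar> - q * v i + 0) s \<le> polygon T n (\<lambda>i. \<bar>v i\<bar> - q * v i + 0) t" if "\<bar>q\<bar> \<le> 1" for q
  proof (rule polygon_mono[OF _ assms])
    fix i
    have "q * v i \<le> \<bar>q * v i\<bar>" by simp
    also have "\<dots> \<le> \<bar>v i\<bar>" unfolding abs_mult using that by (intro mult_left_le_one_le) auto
    finally show "0 \<le> \<bar>v i\<bar> - q * v i + 0" by simp
  qed
  from this[of 1] this[of "- 1"] show ?thesis unfolding polygon_linear by simp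
qed

text \<open>
  Join consecutive positions by shortest arcs at constant speed. The lift starts over \<open>y\<close>
  rather than over \<open>a 0\<close>; this translates the whole polygon by \<open>dist (a 0) y\<close>, since the circle is a group.
\<close>

lemma interpolating_lift:
  assumes n: "0 < n" and T: "0 < T"
  shows "\<exists>g A. action_majorant T g A \<and> A 0 = 0 \<and> g 0 = Rep_circle y
    \<and> A T = (\<Sum>i<n. T / real n * rate_density (dist (a i) (a (Suc i)) / (T / real n)))
    \<and> (\<forall>i\<le>n. dist (a i) (circle_of_real (g (real i * T / real n))) \<le> dist (a 0) y)
    \<and> (\<forall>i<n. \<forall>t\<in>{real i * T / real n..real (Suc i) * T / real n}.
        \<bar>g t - g (real i * T / real n)\<bar> \<le> dist (a i) (a (Suc i)))"
proof -
  define h where "h = T / real n"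
  have h: "0 < h" using n T by (simp add: h_def)
  have "\<exists>d. \<bar>d\<bar> = dist (a i) (a (Suc i)) \<and> circle_shift d (a i) = a (Suc i)" for i
    using circle_displacement[of "a i" "a (Suc i)"] by metis
  then obtain d where d: "\<And>i. \<bar>d i\<bar> = dist (a i) (a (Suc i))" "\<And>i. circle_shift (d i) (a i) = a (Suc i)"
    by metis
  define v where "v i = d i / h" for i
  define g where "g t = Rep_circle y + polygon T n v t" for t
  define A where "A = polygon T n (\<lambda>i. rate_density (v i))"
  have node: "polygon T n c (real j * T / real n) = (\<Sum>i<j. c i * h)" if "j \<le> n" for c j
    unfolding h_def using that n T by (intro polygon_node) auto
  have vh: "v i * h = d i" for i using h by (simp add: v_def)
  have g_node: "g (real j * T / real n) = Rep_circle y + (\<Sum>i<j. d i)" if "j \<le> n" for j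
    unfolding g_def node[OF that] vh ..
  have maj: "action_majorant T g A"
    unfolding g_def[abs_def] A_def by (rule action_majorant_polygon[OF n T])
  have zero: "polygon T n c 0 = 0" for c using node[of 0 c] by simp
  have A0: "A 0 = 0" and g0: "g 0 = Rep_circle y" by (simp_all add: A_def g_def zero)
  have AT: "A T = (\<Sum>i<n. h * rate_density (dist (a i) (a (Suc i)) / h))"
  proof -
    have rd: "rate_density (v i) = rate_density (dist (a i) (a (Suc i)) / h)" for i
    proof -
      have "\<bar>v i\<bar> = dist (a i) (a (Suc i)) / h" using h d(1)[of i] by (simp add: v_def)
      then show ?thesis using rate_density_abs[of "v i"] by simp
    qed
    have "A T = (\<Sum>i<n. rate_density (v i) * h)"
      using node[of n "\<lambda>i. rate_density (v i)"] n by (simp add: A_def)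
    then show ?thesis unfolding rd by (simp add: mult.commute)
  qed
  have a_eq: "a j = circle_of_real (Rep_circle (a 0) + (\<Sum>i<j. d i))" for j
  proof (induction j)
    case 0
    then show ?case by (simp add: circle_of_real_Rep)
  next
    case (Suc j)
    have "a (Suc j) = circle_shift (d j) (circle_of_real (Rep_circle (a 0) + (\<Sum>i<j. d i)))"
      using d(2)[of j] Suc.IH by simp
    then show ?case by (simp add: circle_shift_of_real add.assoc)
  qed
  have near: "dist (a i) (circle_of_real (g (real i * T / real n))) \<le> dist (a 0) y" if "i \<le> n" for i
  proof -
    obtain e where e: "\<bar>e\<bar> = dist (a 0) y" "circle_shift e (a 0) = y" by (rule circle_displacement)
    have "circle_of_real (Rep_circle y) = circle_of_real (Rep_circle (a 0) + e)"
      using e(2) by (simp add: circle_shift_def circle_of_real_Rep)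
    then have "Rep_circle y - (Rep_circle (a 0) + e) \<in> \<int>" by (simp add: circle_of_real_eq_iff)
    then have "circle_of_real (g (real i * T / real n)) = circle_of_real (Rep_circle (a 0) + (\<Sum>i<i. d i) + e)"
      unfolding g_node[OF that] circle_of_real_eq_iff by (simp add: algebra_simps)
    moreover have "dist (a i) (circle_of_real (Rep_circle (a 0) + (\<Sum>i<i. d i) + e)) \<le> \<bar>e\<bar>"
      unfolding a_eq[of i] using dist_circle_of_real_le[of "Rep_circle (a 0) + (\<Sum>i<i. d i)" "Rep_circle (a 0) + (\<Sum>i<i. d i) + e"]
      by simp
    ultimately show ?thesis using e(1) by simp
  qed
  have inside: "\<bar>g t - g (real i * T / real n)\<bar> \<le> dist (a i) (a (Suc i))"
    if "i < n" "t \<in> {real i * T / real n..real (Suc i) * T / real n}" for i t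
  proof -
    have "\<bar>g t - g (real i * T / real n)\<bar> \<le> polygon T n (\<lambda>i. \<bar>v i\<bar>) t - polygon T n (\<lambda>i. \<bar>v i\<bar>) (real i * T / real n)"
      using polygon_abs_diff[of "real i * T / real n" t T n v] that(2) by (simp add: g_def)
    also have "\<dots> \<le> polygon T n (\<lambda>i. \<bar>v i\<bar>) (real (Suc i) * T / real n) - polygon T n (\<lambda>i. \<bar>v i\<bar>) (real i * T / real n)"
      using that(2) by (intro diff_right_mono polygon_mono) auto
    also have "\<dots> = \<bar>v i\<bar> * h" using node[of i "\<lambda>i. \<bar>v i\<bar>"] node[of "Suc i" "\<lambda>i. \<bar>v i\<bar>"] that(1) by simp
    also have "\<dots> = dist (a i) (a (Suc i))" using h d(1)[of i] by (simp add: v_def)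
    finally show ?thesis .
  qed
  show ?thesis
    using maj A0 g0 AT near inside unfolding h_def by (intro exI[of _ g] exI[of _ A]) simp
qed

section \<open>Finite Markov semigroups\<close>

lemma markov_semigroupD:
  assumes "markov_semigroup S p"
  shows markov_semigroup_nonneg: "\<And>t x y. 0 \<le> t \<Longrightarrow> x \<in> S \<Longrightarrow> y \<in> S \<Longrightarrow> 0 \<le> p t x y"
    and markov_semigroup_sum: "\<And>t x. 0 \<le> t \<Longrightarrow> x \<in> S \<Longrightarrow> (\<Sum>y\<in>S. p t x y) = 1"
    and markov_semigroup_zero: "\<And>x y. x \<in> S \<Longrightarrow> y \<in> S \<Longrightarrow> p 0 x y = (if x = y then 1 else 0)"
    and markov_semigroup_add: "\<And>s t x y. 0 \<le> s \<Longrightarrow> 0 \<le> t \<Longrightarrow> x \<in> S \<Longrightarrow> y \<in> S \<Longrightarrow>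
      p (s + t) x y = (\<Sum>z\<in>S. p s x z * p t z y)"
  using assms unfolding markov_semigroup_def by blast+

lemma markov_semigroup_le_1:
  assumes "markov_semigroup S p" "finite S" "0 \<le> t" "x \<in> S" "y \<in> S"
  shows "p t x y \<le> 1"
proof -
  have "p t x y \<le> (\<Sum>y\<in>S. p t x y)"
    using assms markov_semigroup_nonneg[OF assms(1)] by (intro member_le_sum) auto
  then show ?thesis using markov_semigroup_sum[OF assms(1,3,4)] by simp
qed

text \<open>
  For \<open>c + e\<close> in place of \<open>c\<close> the inequality on the generator is strict, so it holds up to a factor
  \<open>exp ((c + e) * h)\<close> for one small step \<open>h\<close>, uniformly on the finite state space. Composing \<open>n\<close> steps
  of length \<open>t / n\<close> and letting \<open>e\<close> tend to 0 gives the claim.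
\<close>

lemma semigroup_supersolution:
  fixes f :: "'s \<Rightarrow> real"
  assumes S: "finite S" and ms: "markov_semigroup S p" and gen: "has_generator S p G"
    and pos: "\<And>x. x \<in> S \<Longrightarrow> 0 < f x" and le: "\<And>x. x \<in> S \<Longrightarrow> G f x \<le> c * f x"
    and "0 \<le> t" "x \<in> S"
  shows "(\<Sum>y\<in>S. p t x y * f y) \<le> exp (c * t) * f x"
proof -
  have approx: "(\<Sum>y\<in>S. p t x y * f y) \<le> exp ((c + e) * t) * f x" if "0 < e" "0 < t" for e
  proof -
    define m where "m = c + e"
    have "\<forall>\<^sub>F h in at_right 0. ((\<Sum>y\<in>S. p h x y * f y) - f x) / h < m * f x" if "x \<in> S" for x
    proof (rule order_tendstoD(2))
      show "((\<lambda>h. ((\<Sum>y\<in>S. p h x y * f y) - f x) / h) \<longlongrightarrow> G f x) (at_right 0)"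
        using gen that unfolding has_generator_def by blast
      have "G f x \<le> c * f x" using le that by blast
      also have "\<dots> < m * f x" using pos[OF that] \<open>0 < e\<close> by (simp add: m_def)
      finally show "G f x < m * f x" .
    qed
    then have "\<forall>\<^sub>F h in at_right 0. \<forall>x\<in>S. ((\<Sum>y\<in>S. p h x y * f y) - f x) / h < m * f x"
      using S by (intro eventually_ball_finite) auto
    then obtain h0 where "h0 > 0" and
      h0: "\<And>h x. 0 < h \<Longrightarrow> h < h0 \<Longrightarrow> x \<in> S \<Longrightarrow> ((\<Sum>y\<in>S. p h x y * f y) - f x) / h < m * f x"
      unfolding eventually_at_right_field by blast
    obtain n where n: "t / h0 < real n" using reals_Archimedean2 by blast
    have "0 < real n" using n \<open>0 < t\<close> \<open>h0 > 0\<close> by (meson divide_pos_pos less_trans)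
    define h where "h = t / real n"
    have h: "0 < h" "h < h0" "real n * h = t"
      using n \<open>0 < real n\<close> \<open>0 < t\<close> \<open>h0 > 0\<close> by (auto simp: h_def field_simps)
    have one: "(\<Sum>y\<in>S. p h x y * f y) \<le> exp (m * h) * f x" if "x \<in> S" for x
    proof -
      have "(\<Sum>y\<in>S. p h x y * f y) \<le> (1 + m * h) * f x"
        using h0[OF h(1,2) that] h(1) by (simp add: field_simps)
      also have "\<dots> \<le> exp (m * h) * f x"
        using pos[OF that] by (intro mult_right_mono) auto
      finally show ?thesis .
    qed
    have "(\<Sum>y\<in>S. p (real i * h) x y * f y) \<le> exp (m * (real i * h)) * f x" if "x \<in> S" for i x
      using that
    proof (induction i arbitrary: x)
      case 0
      have "(\<Sum>y\<in>S. p 0 x y * f y) = (\<Sum>y\<in>S. if x = y then f y else 0)"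
        using markov_semigroup_zero[OF ms \<open>x \<in> S\<close>] by (intro sum.cong) auto
      then show ?case using S \<open>x \<in> S\<close> by simp
    next
      case (Suc i)
      have "(\<Sum>y\<in>S. p (real (Suc i) * h) x y * f y) = (\<Sum>y\<in>S. p (h + real i * h) x y * f y)"
        by (simp add: algebra_simps)
      also have "\<dots> = (\<Sum>y\<in>S. \<Sum>z\<in>S. p h x z * (p (real i * h) z y * f y))"
        using markov_semigroup_add[OF ms, of h "real i * h" x] h(1) Suc.prems
        by (intro sum.cong) (simp_all add: sum_distrib_right mult.assoc)
      also have "\<dots> = (\<Sum>z\<in>S. p h x z * (\<Sum>y\<in>S. p (real i * h) z y * f y))"
        by (subst sum.swap) (simp add: sum_distrib_left)
      also have "\<dots> \<le> (\<Sum>z\<in>S. p h x z * (exp (m * (real i * h)) * f z))"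
        using Suc h(1) by (intro sum_mono mult_left_mono markov_semigroup_nonneg[OF ms]) auto
      also have "\<dots> = exp (m * (real i * h)) * (\<Sum>z\<in>S. p h x z * f z)"
        by (simp add: sum_distrib_left mult_ac)
      also have "\<dots> \<le> exp (m * (real i * h)) * (exp (m * h) * f x)"
        using one[OF Suc.prems] by (intro mult_left_mono) auto
      also have "\<dots> = exp (m * (real (Suc i) * h)) * f x"
        by (simp add: algebra_simps flip: exp_add)
      finally show ?case .
    qed
    from this[of x n] show ?thesis using h(3) \<open>x \<in> S\<close> by (simp add: m_def)
  qed
  show ?thesis
  proof (cases "t = 0")
    case True
    have "(\<Sum>y\<in>S. p 0 x y * f y) = (\<Sum>y\<in>S. if x = y then f y else 0)"
      using markov_semigroup_zero[OF ms \<open>x \<in> S\<close>] by (intro sum.cong) auto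
    then show ?thesis using True S \<open>x \<in> S\<close> by simp
  next
    case False
    have "((\<lambda>e. exp ((c + e) * t) * f x) \<longlongrightarrow> exp ((c + 0) * t) * f x) (at_right 0)"
      by (intro tendsto_intros)
    moreover have "\<forall>\<^sub>F e in at_right 0. (\<Sum>y\<in>S. p t x y * f y) \<le> exp ((c + e) * t) * f x"
      using approx False \<open>0 \<le> t\<close> by (intro eventually_at_right_less[THEN eventually_mono]) auto
    ultimately have "(\<Sum>y\<in>S. p t x y * f y) \<le> exp ((c + 0) * t) * f x"
      by (intro tendsto_lowerbound) auto
    then show ?thesis by simp
  qed
qed

text \<open>
  Kolmogorov's backward equation. The right derivative is immediate from the semigroup property
  \<open>p (h + t) = p h * p t\<close>. For the left derivative the same identity is used with \<open>t - h\<close> in place of \<open>t\<close>,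
  and this requires continuity of \<open>p\<close> from the left.
\<close>

lemma semigroup_derivative:
  assumes S: "finite S" and ms: "markov_semigroup S p" and gen: "has_generator S p G"
    and x: "x \<in> S" and y: "y \<in> S"
  shows semigroup_has_derivative:
      "0 < t \<Longrightarrow> ((\<lambda>t. p t x y) has_real_derivative G (\<lambda>z. p t z y) x) (at t)" (is "_ \<Longrightarrow> ?deriv")
    and semigroup_continuous: "continuous_on {0..} (\<lambda>t. p t x y)"
proof -
  \<comment> \<open>The matrix of the generator and its difference quotients.\<close>
  define D where "D h x z = (p h x z - (if x = z then 1 else 0)) / h" for h x z
  define q where "q x z = G (\<lambda>y. if y = z then 1 else 0) x" for x z
  have D: "((\<lambda>h. D h x z) \<longlongrightarrow> q x z) (at_right 0)" if "x \<in> S" "z \<in> S" for x z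
  proof -
    have "((\<lambda>h. ((\<Sum>y\<in>S. p h x y * (if y = z then 1 else 0)) - (if x = z then 1 else 0)) / h) \<longlongrightarrow> q x z) (at_right 0)"
      using gen[unfolded has_generator_def, rule_format, OF \<open>x \<in> S\<close>, of "\<lambda>y. if y = z then 1 else 0"]
      unfolding q_def .
    then show ?thesis using S \<open>z \<in> S\<close> by (simp add: D_def if_distrib cong: if_cong)
  qed
  have diff_eq: "(\<Sum>z\<in>S. p h x z * f z) - f x = (\<Sum>z\<in>S. (p h x z - (if x = z then 1 else 0)) * f z)"
    if "x \<in> S" for h x and f :: "_ \<Rightarrow> real"
  proof -
    have "(\<Sum>z\<in>S. (if x = z then 1 else 0) * f z) = (\<Sum>z\<in>S. if x = z then f z else 0)"
      by (intro sum.cong) auto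
    then show ?thesis using S that by (simp add: left_diff_distrib sum_subtractf)
  qed
  have G: "G f x = (\<Sum>z\<in>S. q x z * f z)" if "x \<in> S" for f x
  proof (rule tendsto_unique[of "at_right (0::real)"])
    show "((\<lambda>h. ((\<Sum>y\<in>S. p h x y * f y) - f x) / h) \<longlongrightarrow> G f x) (at_right 0)"
      using gen that unfolding has_generator_def by blast
    have "((\<lambda>h. \<Sum>z\<in>S. D h x z * f z) \<longlongrightarrow> (\<Sum>z\<in>S. q x z * f z)) (at_right 0)"
      using that by (intro tendsto_sum tendsto_mult D tendsto_const)
    then show "((\<lambda>h. ((\<Sum>y\<in>S. p h x y * f y) - f x) / h) \<longlongrightarrow> (\<Sum>z\<in>S. q x z * f z)) (at_right 0)"
      unfolding diff_eq[OF that] by (simp add: D_def sum_divide_distrib)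
  qed simp
  have small: "((\<lambda>h. p h x z - (if x = z then 1 else 0)) \<longlongrightarrow> 0) (at_right 0)" if "x \<in> S" "z \<in> S" for x z
  proof -
    have "((\<lambda>h. h * D h x z) \<longlongrightarrow> 0 * q x z) (at_right 0)"
      using D[OF that] by (intro tendsto_mult tendsto_ident_at)
    moreover have "\<forall>\<^sub>F h in at_right (0::real). h * D h x z = p h x z - (if x = z then 1 else 0)"
      using eventually_at_right_less[of 0] by eventually_elim (simp add: D_def)
    ultimately show ?thesis by (simp add: tendsto_cong)
  qed
  have step: "p (h + s) x y - p s x y = (\<Sum>z\<in>S. (p h x z - (if x = z then 1 else 0)) * p s z y)"
    if "0 \<le> h" "0 \<le> s" "x \<in> S" for h s x
    using markov_semigroup_add[OF ms that y] diff_eq[OF that(3), of h "\<lambda>z. p s z y"] by simp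
  have left_cont: "((\<lambda>h. p (t - h) x y) \<longlongrightarrow> p t x y) (at_right 0)" if "0 < t" "x \<in> S" for t x
  proof -
    have "((\<lambda>h. \<Sum>z\<in>S. \<bar>p h x z - (if x = z then 1 else 0)\<bar>) \<longlongrightarrow> (\<Sum>z\<in>S. \<bar>0\<bar>)) (at_right 0)"
      using small that by (intro tendsto_sum tendsto_rabs) auto
    then have lim: "((\<lambda>h. \<Sum>z\<in>S. \<bar>p h x z - (if x = z then 1 else 0)\<bar>) \<longlongrightarrow> 0) (at_right 0)" by simp
    have "((\<lambda>h. p (t - h) x y - p t x y) \<longlongrightarrow> 0) (at_right 0)"
    proof (rule Lim_null_comparison[OF _ lim])
      have "\<forall>\<^sub>F h in at_right 0. h < t" using \<open>0 < t\<close> by (auto simp: eventually_at_right[of 0 t])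
      with eventually_at_right_less[of "0::real"]
      show "\<forall>\<^sub>F h in at_right 0. norm (p (t - h) x y - p t x y)
          \<le> (\<Sum>z\<in>S. \<bar>p h x z - (if x = z then 1 else 0)\<bar>)"
      proof eventually_elim
        case (elim h)
        have "p t x y - p (t - h) x y = (\<Sum>z\<in>S. (p h x z - (if x = z then 1 else 0)) * p (t - h) z y)"
          using step[of h "t - h" x] elim \<open>x \<in> S\<close> by simp
        then have "norm (p (t - h) x y - p t x y)
            = \<bar>\<Sum>z\<in>S. (p h x z - (if x = z then 1 else 0)) * p (t - h) z y\<bar>"
          by (simp add: real_norm_def abs_minus_commute)
        also have "\<dots> \<le> (\<Sum>z\<in>S. \<bar>(p h x z - (if x = z then 1 else 0)) * p (t - h) z y\<bar>)"
          by (rule sum_abs)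
        also have "\<dots> \<le> (\<Sum>z\<in>S. \<bar>p h x z - (if x = z then 1 else 0)\<bar>)"
        proof (rule sum_mono)
          fix z assume "z \<in> S"
          then have "0 \<le> p (t - h) z y" "p (t - h) z y \<le> 1"
            using markov_semigroup_nonneg[OF ms] markov_semigroup_le_1[OF ms S] y elim by auto
          then show "\<bar>(p h x z - (if x = z then 1 else 0)) * p (t - h) z y\<bar> \<le> \<bar>p h x z - (if x = z then 1 else 0)\<bar>"
            unfolding abs_mult by (intro mult_left_le) auto
        qed
        finally show ?case .
      qed
    qed
    then show ?thesis by (simp add: LIM_zero_iff)
  qed
  have right_deriv: "((\<lambda>h. (p (t + h) x y - p t x y) / h) \<longlongrightarrow> G (\<lambda>z. p t z y) x) (at_right 0)" if "0 \<le> t" for t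
  proof -
    have "((\<lambda>h. \<Sum>z\<in>S. D h x z * p t z y) \<longlongrightarrow> G (\<lambda>z. p t z y) x) (at_right 0)"
      unfolding G[OF x] using x by (intro tendsto_sum tendsto_mult D tendsto_const)
    moreover have "\<forall>\<^sub>F h in at_right (0::real). (\<Sum>z\<in>S. D h x z * p t z y) = (p (t + h) x y - p t x y) / h"
      using eventually_at_right_less[of 0]
    proof eventually_elim
      case (elim h)
      show ?case using step[of h t x] elim x \<open>0 \<le> t\<close> by (simp add: D_def sum_divide_distrib add.commute)
    qed
    ultimately show ?thesis by (simp add: tendsto_cong)
  qed
  have deriv: "((\<lambda>t. p t x y) has_real_derivative G (\<lambda>z. p t z y) x) (at t)" if "0 < t" for t
  proof -
    have "((\<lambda>h. \<Sum>z\<in>S. D h x z * p (t - h) z y) \<longlongrightarrow> G (\<lambda>z. p t z y) x) (at_right 0)"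
      unfolding G[OF x] using x that by (intro tendsto_sum tendsto_mult D left_cont) auto
    moreover have "\<forall>\<^sub>F h in at_right (0::real).
        (\<Sum>z\<in>S. D h x z * p (t - h) z y) = (p (t + - h) x y - p t x y) / - h"
    proof -
      have "\<forall>\<^sub>F h in at_right 0. h < t" using \<open>0 < t\<close> by (auto simp: eventually_at_right[of 0 t])
      with eventually_at_right_less[of "0::real"] show ?thesis
      proof eventually_elim
        case (elim h)
        have "(\<Sum>z\<in>S. D h x z * p (t - h) z y) = (p t x y - p (t - h) x y) / h"
          using step[of h "t - h" x] elim x by (simp add: D_def sum_divide_distrib)
        then show ?case using elim by (simp add: field_simps)
      qed
    qed
    ultimately have "((\<lambda>h. (p (t + - h) x y - p t x y) / - h) \<longlongrightarrow> G (\<lambda>z. p t z y) x) (at_right 0)"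
      by (simp add: tendsto_cong)
    then have "((\<lambda>h. (p (t + h) x y - p t x y) / h) \<longlongrightarrow> G (\<lambda>z. p t z y) x) (at_left 0)"
      by (subst filterlim_at_left_to_right) simp
    with right_deriv[of t] that show ?thesis
      unfolding DERIV_def by (intro filterlim_split_at) auto
  qed
  show "0 < t \<Longrightarrow> ?deriv" by (rule deriv)
  show "continuous_on {0..} (\<lambda>t. p t x y)"
    unfolding continuous_on_eq_continuous_within
  proof
    fix t :: real assume "t \<in> {0..}"
    show "continuous (at t within {0..}) (\<lambda>t. p t x y)"
    proof (cases "t = 0")
      case True
      have "((\<lambda>h. p h x y) \<longlongrightarrow> (if x = y then 1 else 0)) (at_right 0)"
        using small[OF x y] by (rule LIM_zero_cancel)
      moreover have "at (0::real) within {0..} = at_right 0"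
        by (auto simp: at_within_def greaterThan_def atLeast_def intro!: arg_cong[where f="\<lambda>A. inf _ (principal A)"])
      ultimately show ?thesis using markov_semigroup_zero[OF ms x y] True
        by (simp add: continuous_within)
    next
      case False
      with \<open>t \<in> {0..}\<close> have "0 < t" by simp
      then have "isCont (\<lambda>t. p t x y) t" by (rule DERIV_isCont[OF deriv])
      then show ?thesis by (rule continuous_at_imp_continuous_at_within)
    qed
  qed
qed

section \<open>Transition probabilities of the walk on the grid\<close>

text \<open>
  The grid points with indices in all of \<open>\<int>\<close>, so that neighbours and displacements need no reduction modulo \<open>k\<close>.
\<close>

definition node :: "nat \<Rightarrow> int \<Rightarrow> circle" where
  "node k j = circle_of_real (of_int j / real k)"

lemma circle_shift_node:
  "circle_shift (1 / real k) (node k j) = node k (j + 1)"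
  "circle_shift (- 1 / real k) (node k j) = node k (j - 1)"
  by (simp_all add: node_def circle_shift_of_real add_divide_distrib diff_divide_distrib)

lemma node_eq_iff:
  assumes "k \<ge> 1"
  shows "node k i = node k j \<longleftrightarrow> int k dvd i - j"
proof -
  have k: "real k \<noteq> 0" using assms by simp
  have "node k i = node k j \<longleftrightarrow> of_int (i - j) / real k \<in> \<int>"
    unfolding node_def circle_of_real_eq_iff by (simp add: diff_divide_distrib)
  also have "\<dots> \<longleftrightarrow> int k dvd i - j"
  proof
    assume "of_int (i - j) / real k \<in> \<int>"
    then obtain n where "of_int (i - j) / real k = of_int n" by (rule Ints_cases)
    then have "real_of_int (i - j) = of_int (int k * n)" using k by (simp add: field_simps)
    then have "i - j = int k * n" by (simp only: of_int_eq_iff)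
    then show "int k dvd i - j" by simp
  next
    assume "int k dvd i - j"
    then obtain n where "i - j = int k * n" by (rule dvdE)
    then show "of_int (i - j) / real k \<in> \<int>" using k by simp
  qed
  finally show ?thesis .
qed

lemma grid_eq_range_node:
  assumes "k \<ge> 1"
  shows "grid k = range (node k)"
proof
  show "grid k \<subseteq> range (node k)"
  proof
    fix x assume "x \<in> grid k"
    then obtain j where "x = circle_of_real (real j / real k)" unfolding grid_def by blast
    then have "x = node k (int j)" by (simp add: node_def)
    then show "x \<in> range (node k)" by blast
  qed
  show "range (node k) \<subseteq> grid k"
  proof
    fix x assume "x \<in> range (node k)"
    then obtain j where j: "x = node k j" by blast
    define r where "r = nat (j mod int k)"
    have "int r = j mod int k" using assms by (simp add: r_def)
    then have "node k j = node k (int r)"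
      unfolding node_eq_iff[OF assms] by (simp add: mod_eq_dvd_iff[symmetric])
    moreover have "r < k" using assms unfolding r_def by (simp add: nat_less_iff)
    ultimately show "x \<in> grid k"
      unfolding j grid_def node_def by (intro image_eqI[of _ _ r]) simp_all
  qed
qed

lemma finite_grid [simp]: "finite (grid k)"
  by (simp add: grid_def)

lemma card_grid_le: "card (grid k) \<le> k"
  unfolding grid_def using card_image_le[of "{..<k}"] by fastforce

lemma node_in_grid: "k \<ge> 1 \<Longrightarrow> node k j \<in> grid k"
  by (simp add: grid_eq_range_node)

lemma grid_laplacian_node:
  "grid_laplacian k f (node k j) = (f (node k (j + 1)) - f (node k j)) + (f (node k (j - 1)) - f (node k j))"
  unfolding grid_laplacian_def circle_shift_node ..

lemma cosh_real_mono_abs: "\<bar>x\<bar> \<le> \<bar>y\<bar> \<Longrightarrow> cosh x \<le> cosh (y :: real)"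
  using cosh_real_nonneg_le_iff[of "\<bar>x\<bar>" "\<bar>y\<bar>"] by simp

text \<open>
  Write the displacement from \<open>x\<close> to \<open>y\<close> as \<open>m / k\<close>. Then the distance from \<open>x\<close> to \<open>y\<close> is exactly
  \<open>\<bar>m\<bar> / k\<close>, and the distances to the neighbours of \<open>y\<close> are at most \<open>\<bar>m + 1\<bar> / k\<close> and \<open>\<bar>m - 1\<bar> / k\<close>. So
  the addition theorem \<open>cosh (p * (m + 1)) + cosh (p * (m - 1)) = 2 * cosh p * cosh (p * m)\<close> bounds the
  generator; it would be an equality on the real line.
\<close>

lemma grid_laplacian_cosh_dist:
  assumes k: "k \<ge> 1" and "x \<in> grid k" "y \<in> grid k"
  shows "real k * grid_laplacian k (\<lambda>z. cosh (real k * p * dist x z)) y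
     \<le> real k * cumulant p * cosh (real k * p * dist x y)"
proof -
  have kpos: "0 < real k" using k by simp
  obtain i j where ij: "x = node k i" "y = node k j" using assms grid_eq_range_node[OF k] by blast
  obtain d where d: "\<bar>d\<bar> = dist x y" "circle_shift d x = y" by (rule circle_displacement)
  have "of_int i / real k + d - of_int j / real k \<in> \<int>"
    using d(2) unfolding ij node_def circle_shift_of_real circle_of_real_eq_iff .
  then obtain n where n: "of_int i / real k + d - of_int j / real k = of_int n" by (rule Ints_cases)
  define m where "m = j - i + n * int k"
  have "d = of_int j / real k - of_int i / real k + of_int n" using n by linarith
  then have dm: "d = of_int m / real k" using kpos by (simp add: m_def field_simps)
  have y: "node k (j + l) = node k (i + (m + l))" for l
    unfolding node_eq_iff[OF k] by (simp add: m_def)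
  have near: "cosh (real k * p * dist x (node k (j + l))) \<le> cosh (p * of_int (m + l))" for l
  proof (rule cosh_real_mono_abs)
    have "dist x (node k (j + l)) \<le> \<bar>of_int i / real k - of_int (i + (m + l)) / real k\<bar>"
      unfolding y unfolding ij node_def by (rule dist_circle_of_real_le)
    also have "\<dots> = \<bar>of_int (m + l)\<bar> / real k"
      using kpos by (simp add: abs_divide abs_minus_commute flip: diff_divide_distrib)
    finally have "real k * dist x (node k (j + l)) \<le> \<bar>of_int (m + l)\<bar>"
      using kpos by (simp add: field_simps)
    then have "\<bar>p\<bar> * (real k * dist x (node k (j + l))) \<le> \<bar>p\<bar> * \<bar>of_int (m + l)\<bar>"
      by (rule mult_left_mono) simp
    then show "\<bar>real k * p * dist x (node k (j + l))\<bar> \<le> \<bar>p * of_int (m + l)\<bar>"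
      by (simp add: abs_mult mult_ac)
  qed
  have at: "cosh (real k * p * dist x y) = cosh (p * of_int m)"
  proof -
    have "real k * p * dist x y = p * \<bar>of_int m\<bar>"
      using kpos unfolding d(1)[symmetric] dm by (simp add: abs_divide)
    also have "cosh \<dots> = cosh (p * of_int m)" by (cases "m \<ge> 0") simp_all
    finally show ?thesis .
  qed
  have "cosh (real k * p * dist x (node k (j + 1))) + cosh (real k * p * dist x (node k (j - 1)))
      \<le> cosh (p * of_int (m + 1)) + cosh (p * of_int (m - 1))"
    using near[of 1] near[of "- 1"] by simp
  also have "\<dots> = 2 * cosh p * cosh (p * of_int m)"
    by (simp add: distrib_left right_diff_distrib cosh_add cosh_diff)
  also have "\<dots> = 2 * cosh p * cosh (real k * p * dist x y)" unfolding at ..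
  finally have "grid_laplacian k (\<lambda>z. cosh (real k * p * dist x z)) y
      \<le> 2 * cosh p * cosh (real k * p * dist x y) - 2 * cosh (real k * p * dist x y)"
    unfolding ij(2) grid_laplacian_node by linarith
  also have "\<dots> = cumulant p * cosh (real k * p * dist x y)"
    by (simp add: cumulant_def left_diff_distrib)
  finally have "grid_laplacian k (\<lambda>z. cosh (real k * p * dist x z)) y
      \<le> cumulant p * cosh (real k * p * dist x y)" .
  then show ?thesis using kpos by (simp add: mult.assoc)
qed

locale grid_semigroup =
  fixes k :: nat and p :: "real \<Rightarrow> circle \<Rightarrow> circle \<Rightarrow> real"
  assumes k: "1 \<le> k"
    and ms: "markov_semigroup (grid k) p"
    and gen: "has_generator (grid k) p (\<lambda>f y. real k * grid_laplacian k f y)"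
begin

lemma exponential_moment_le:
  assumes "x \<in> grid k" "z \<in> grid k" "0 \<le> t"
  shows "(\<Sum>y\<in>grid k. p t z y * cosh (real k * q * dist x y))
      \<le> exp (real k * cumulant q * t) * cosh (real k * q * dist x z)"
  by (rule semigroup_supersolution[OF finite_grid ms gen])
    (use assms grid_laplacian_cosh_dist[OF k] in auto)

text \<open>
  Chebyshev's inequality for the moment \<open>cosh (k * q * dist x y)\<close> at the optimal tilt \<open>q\<close> for the speed
  \<open>dist x y / t\<close>. The factor 2 comes from \<open>exp u \<le> 2 * cosh u\<close>.
\<close>

lemma transition_le:
  assumes "x \<in> grid k" "y \<in> grid k" "0 < t"
  shows "p t x y \<le> 2 * exp (- (real k * (t * rate_density (dist x y / t))))"
proof -
  define q where "q = optimal_tilt (dist x y / t)"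
  define u where "u = real k * q * dist x y"
  have "p t x y * cosh u \<le> (\<Sum>y\<in>grid k. p t x y * cosh (real k * q * dist x y))"
    unfolding u_def using assms markov_semigroup_nonneg[OF ms] cosh_real_nonneg
    by (intro member_le_sum[of y "grid k" "\<lambda>y. p t x y * cosh (real k * q * dist x y)"]) auto
  also have "\<dots> \<le> exp (real k * cumulant q * t)"
    using exponential_moment_le[OF assms(1,1), of t q] assms by simp
  finally have "p t x y * cosh u \<le> exp (real k * cumulant q * t)" .
  moreover have "exp u / 2 \<le> cosh u" by (simp add: cosh_field_def)
  then have "p t x y * (exp u / 2) \<le> p t x y * cosh u"
    using assms markov_semigroup_nonneg[OF ms] by (intro mult_left_mono) auto
  ultimately have "p t x y * exp u \<le> 2 * exp (real k * cumulant q * t)" by simp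
  then have "p t x y \<le> 2 * exp (real k * cumulant q * t) / exp u"
    by (simp add: field_simps)
  also have "\<dots> = 2 * exp (real k * cumulant q * t - u)" by (simp add: exp_diff)
  also have "real k * cumulant q * t - u = - (real k * (t * rate_density (dist x y / t)))"
    using \<open>0 < t\<close> by (simp add: rate_density_eq q_def u_def algebra_simps)
  finally show ?thesis .
qed

text \<open>
  The left hand side times \<open>exp (- 2 * k * t)\<close> is the probability that two independent Poisson clocks of rate \<open>k\<close>
  ring \<open>a\<close> and \<open>b\<close> times. The proof goes by induction on \<open>a + b\<close>: multiplying by \<open>exp (2 * k * t)\<close> cancels the diagonal term
  of the backward equation, so the derivative of the right hand side is \<open>k\<close> times the sum of the two neighbouring terms,
  to which the induction hypothesis applies; the derivative of the left hand side has the same recursion.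
\<close>

lemma transition_ge:
  assumes "0 \<le> t"
  shows "(real k * t) ^ (a + b) / (fact a * fact b) \<le> exp (2 * real k * t) * p t (node k j) (node k (j + int a - int b))"
proof -
  have "\<forall>a b j t. a + b = n \<longrightarrow> 0 \<le> t \<longrightarrow>
    (real k * t) ^ (a + b) / (fact a * fact b) \<le> exp (2 * real k * t) * p t (node k j) (node k (j + int a - int b))" for n
  proof (induction n)
    case 0
    have "1 \<le> exp (2 * real k * t) * p t (node k j) (node k j)" if "0 \<le> t" for j t
    proof -
      define y where "y = node k j"
      define u where "u t = exp (2 * real k * t) * p t y y" for t
      have yS: "y \<in> grid k" by (simp add: y_def node_in_grid[OF k])
      have "u 0 \<le> u t"
      proof (rule DERIV_nonneg_imp_increasing_open[OF that])
        fix s :: real assume s: "0 < s" "s < t"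
        have "(u has_real_derivative 2 * real k * exp (2 * real k * s) * p s y y
            + exp (2 * real k * s) * (real k * grid_laplacian k (\<lambda>z. p s z y) y)) (at s)"
          unfolding u_def
          by (auto intro!: derivative_eq_intros semigroup_has_derivative[OF finite_grid ms gen yS yS s(1)])
        moreover have "2 * real k * exp (2 * real k * s) * p s y y
            + exp (2 * real k * s) * (real k * grid_laplacian k (\<lambda>z. p s z y) y)
          = exp (2 * real k * s) * real k * (p s (node k (j + 1)) y + p s (node k (j - 1)) y)"
          unfolding y_def grid_laplacian_node by (simp add: algebra_simps)
        moreover have "0 \<le> p s (node k (j + 1)) y + p s (node k (j - 1)) y"
          using markov_semigroup_nonneg[OF ms] s yS node_in_grid[OF k] by simp
        ultimately show "\<exists>d. (u has_real_derivative d) (at s) \<and> 0 \<le> d"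
          by (metis mult_nonneg_nonneg exp_ge_zero of_nat_0_le_iff)
      next
        show "continuous_on {0..t} u" unfolding u_def
          by (intro continuous_intros continuous_on_subset[OF semigroup_continuous[OF finite_grid ms gen yS yS]]) auto
      qed
      then show ?thesis using markov_semigroup_zero[OF ms yS yS] by (simp add: u_def y_def)
    qed
    then show ?case by simp
  next
    case (Suc n)
    show ?case
    proof (intro allI impI)
      fix a b :: nat and j :: int and t :: real assume ab: "a + b = Suc n" and t: "0 \<le> t"
      define y where "y = node k (j + int a - int b)"
      define x where "x = node k j"
      have S: "x \<in> grid k" "y \<in> grid k" by (simp_all add: x_def y_def node_in_grid[OF k])
      define c where "c = 1 / (fact a * fact b :: real)"
      define u where "u t = exp (2 * real k * t) * p t x y - c * (real k * t) ^ Suc n" for t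
      have up: "c * real a * (real k * s) ^ n \<le> exp (2 * real k * s) * p s (node k (j + 1)) y" if "0 \<le> s" for s
      proof (cases a)
        case 0
        then show ?thesis using markov_semigroup_nonneg[OF ms that node_in_grid[OF k] S(2)] by simp
      next
        case (Suc a')
        have "(real k * s) ^ (a' + b) / (fact a' * fact b)
            \<le> exp (2 * real k * s) * p s (node k (j + 1)) (node k ((j + 1) + int a' - int b))"
          using Suc.IH[rule_format, of a' b s "j + 1"] ab Suc that by simp
        moreover have "node k ((j + 1) + int a' - int b) = y" by (simp add: y_def Suc algebra_simps)
        moreover have "c * real a = 1 / (fact a' * fact b)"
          by (simp add: Suc c_def fact_Suc del: of_nat_Suc)
        then have "(real k * s) ^ (a' + b) / (fact a' * fact b) = c * real a * (real k * s) ^ n"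
          using ab Suc by simp
        ultimately show ?thesis by simp
      qed
      have down: "c * real b * (real k * s) ^ n \<le> exp (2 * real k * s) * p s (node k (j - 1)) y" if "0 \<le> s" for s
      proof (cases b)
        case 0
        then show ?thesis using markov_semigroup_nonneg[OF ms that node_in_grid[OF k] S(2)] by simp
      next
        case (Suc b')
        have "(real k * s) ^ (a + b') / (fact a * fact b')
            \<le> exp (2 * real k * s) * p s (node k (j - 1)) (node k ((j - 1) + int a - int b'))"
          using Suc.IH[rule_format, of a b' s "j - 1"] ab Suc that by simp
        moreover have "node k ((j - 1) + int a - int b') = y" by (simp add: y_def Suc algebra_simps)
        moreover have "c * real b = 1 / (fact a * fact b')"
          by (simp add: Suc c_def fact_Suc del: of_nat_Suc)
        then have "(real k * s) ^ (a + b') / (fact a * fact b') = c * real b * (real k * s) ^ n"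
          using ab Suc by simp
        ultimately show ?thesis by simp
      qed
      have "u 0 \<le> u t"
      proof (rule DERIV_nonneg_imp_increasing_open[OF t])
        fix s :: real assume s: "0 < s" "s < t"
        have "((\<lambda>t. real k * t) has_real_derivative real k) (at s)"
          by (auto intro!: derivative_eq_intros)
        then have "((\<lambda>t. (real k * t) ^ Suc n) has_real_derivative real (Suc n) * (real k * (real k * s) ^ (Suc n - Suc 0))) (at s)"
          by (rule DERIV_power)
        then have "((\<lambda>t. c * (real k * t) ^ Suc n) has_real_derivative c * (real (Suc n) * (real k * (real k * s) ^ (Suc n - Suc 0)))) (at s)"
          by (rule DERIV_cmult)
        moreover have "((\<lambda>t. exp (2 * real k * t) * p t x y) has_real_derivative 2 * real k * exp (2 * real k * s) * p s x y
            + exp (2 * real k * s) * (real k * grid_laplacian k (\<lambda>z. p s z y) x)) (at s)"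
          by (auto intro!: derivative_eq_intros semigroup_has_derivative[OF finite_grid ms gen S s(1)])
        ultimately have "(u has_real_derivative (2 * real k * exp (2 * real k * s) * p s x y
            + exp (2 * real k * s) * (real k * grid_laplacian k (\<lambda>z. p s z y) x))
            - c * (real (Suc n) * (real k * (real k * s) ^ (Suc n - Suc 0)))) (at s)"
          unfolding u_def by (rule DERIV_diff[rotated])
        moreover have "c * (real (Suc n) * (real k * (real k * s) ^ (Suc n - Suc 0))) = c * (real (Suc n) * real k * (real k * s) ^ n)"
          by simp
        ultimately have d: "(u has_real_derivative 2 * real k * exp (2 * real k * s) * p s x y
            + exp (2 * real k * s) * (real k * grid_laplacian k (\<lambda>z. p s z y) x)
            - c * (real (Suc n) * real k * (real k * s) ^ n)) (at s)"
          by (simp only:)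
        have "2 * real k * exp (2 * real k * s) * p s x y
            + exp (2 * real k * s) * (real k * grid_laplacian k (\<lambda>z. p s z y) x)
          = real k * (exp (2 * real k * s) * p s (node k (j + 1)) y + exp (2 * real k * s) * p s (node k (j - 1)) y)"
          unfolding x_def grid_laplacian_node by (simp add: algebra_simps)
        also have "\<dots> \<ge> real k * (c * real a * (real k * s) ^ n + c * real b * (real k * s) ^ n)"
          using up[of s] down[of s] s by (intro mult_left_mono add_mono) auto
        also have "real k * (c * real a * (real k * s) ^ n + c * real b * (real k * s) ^ n)
            = c * (real (a + b) * real k * (real k * s) ^ n)"
          by (simp add: algebra_simps)
        finally have "0 \<le> 2 * real k * exp (2 * real k * s) * p s x y
            + exp (2 * real k * s) * (real k * grid_laplacian k (\<lambda>z. p s z y) x)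
            - c * (real (Suc n) * real k * (real k * s) ^ n)"
          unfolding ab by linarith
        with d show "\<exists>d. (u has_real_derivative d) (at s) \<and> 0 \<le> d" by blast
      next
        show "continuous_on {0..t} u" unfolding u_def
          by (intro continuous_intros continuous_on_subset[OF semigroup_continuous[OF finite_grid ms gen S]]) auto
      qed
      moreover have "0 \<le> u 0" using markov_semigroup_nonneg[OF ms _ S, of 0] by (simp add: u_def)
      ultimately have "c * (real k * t) ^ Suc n \<le> exp (2 * real k * t) * p t x y" by (simp add: u_def)
      then show "(real k * t) ^ (a + b) / (fact a * fact b)
          \<le> exp (2 * real k * t) * p t (node k j) (node k (j + int a - int b))"
        unfolding ab by (simp add: c_def x_def y_def)
    qed
  qed
  then show ?thesis using assms by blast
qed

lemma transition_pos:
  assumes "x \<in> grid k" "y \<in> grid k" "0 < t"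
  shows "0 < p t x y"
proof -
  obtain i j where ij: "x = node k i" "y = node k j" using assms grid_eq_range_node[OF k] by blast
  define a b where "a = nat (j - i)" and "b = nat (i - j)"
  have "j = i + int a - int b" by (simp add: a_def b_def)
  then have "(real k * t) ^ (a + b) / (fact a * fact b) \<le> exp (2 * real k * t) * p t x y"
    using transition_ge[of t a b i] assms ij by simp
  moreover have "0 < (real k * t) ^ (a + b) / (fact a * fact b)" using k assms by simp
  ultimately have "0 < exp (2 * real k * t) * p t x y" by linarith
  then show ?thesis by (simp add: zero_less_mult_iff)
qed

end

section \<open>Asymptotics of transition probabilities\<close>

text \<open>
  A form of Stirling's bound, with an error that is logarithmic in \<open>n\<close>.
\<close>

lemma ln_fact_le: "ln (fact n) \<le> (real n + 1) * ln (real n + 1) - real n"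
proof (induction n)
  case (Suc n)
  have "1 / (real n + 2) \<le> ln ((real n + 2) / (real n + 1))"
  proof -
    have "ln ((real n + 1) / (real n + 2)) \<le> (real n + 1) / (real n + 2) - 1"
      by (intro ln_le_minus_one) simp
    moreover have "(real n + 1) / (real n + 2) - 1 = - (1 / (real n + 2))" by (simp add: field_simps)
    moreover have "ln ((real n + 1) / (real n + 2)) = - ln ((real n + 2) / (real n + 1))"
      by (simp add: ln_div)
    ultimately show ?thesis by simp
  qed
  then have "1 \<le> (real n + 2) * (ln (real n + 2) - ln (real n + 1))"
    by (simp add: ln_div field_simps)
  moreover have "ln (fact (Suc n)) = ln (real n + 1) + ln (fact n)"
    by (simp add: ln_mult add.commute)
  ultimately show ?case using Suc.IH by (simp add: algebra_simps)
qed simp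

lemma floor_scaled_tendsto: "(\<lambda>k. of_int \<lfloor>real k * y\<rfloor> / real k) \<longlonglongrightarrow> y"
proof (rule tendsto_sandwich)
  show "\<forall>\<^sub>F k in sequentially. y - 1 / real k \<le> of_int \<lfloor>real k * y\<rfloor> / real k"
    using eventually_ge_at_top[of 1]
  proof eventually_elim
    case (elim k)
    have "real k * y - 1 \<le> of_int \<lfloor>real k * y\<rfloor>" by linarith
    then have "(real k * y - 1) / real k \<le> of_int \<lfloor>real k * y\<rfloor> / real k" by (rule divide_right_mono) simp
    then show ?case using elim by (simp add: diff_divide_distrib)
  qed
  show "\<forall>\<^sub>F k in sequentially. of_int \<lfloor>real k * y\<rfloor> / real k \<le> y"
    using eventually_ge_at_top[of 1]
  proof eventually_elim
    case (elim k)
    have "of_int \<lfloor>real k * y\<rfloor> \<le> real k * y" by linarith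
    then show ?case using elim by (simp add: field_simps)
  qed
  have "(\<lambda>k. y - 1 / real k) \<longlonglongrightarrow> y - 0" by (intro tendsto_diff tendsto_const lim_1_over_n)
  then show "(\<lambda>k. y - 1 / real k) \<longlonglongrightarrow> y" by simp
qed simp

lemma poisson_weight_asymptotic:
  fixes a :: "nat \<Rightarrow> nat"
  assumes a: "(\<lambda>k. real (a k) / real k) \<longlonglongrightarrow> \<alpha>" and "0 < \<alpha>" "0 < h"
  shows "\<exists>e. e \<longlonglongrightarrow> \<alpha> - \<alpha> * ln (\<alpha> / h) \<and>
    (\<forall>k\<ge>1. exp (real k * e k) \<le> (real k * h) ^ a k / fact (a k))"
proof -
  define b where "b k = (real (a k) + 1) / real k" for k
  define e where "e k = real (a k) / real k - b k * ln (b k / h) - (ln (real k) / real k + ln h / real k)" for k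
  have inv: "(\<lambda>k. 1 / real k) \<longlonglongrightarrow> 0" by (rule lim_1_over_n)
  have "(\<lambda>k. real (a k) / real k + 1 / real k) \<longlonglongrightarrow> \<alpha> + 0" by (intro tendsto_add a inv)
  then have b: "b \<longlonglongrightarrow> \<alpha>" by (simp add: b_def[abs_def] add_divide_distrib)
  have lnk: "(\<lambda>k. ln (real k) / real k) \<longlonglongrightarrow> 0"
    by (rule filterlim_compose[OF ln_x_over_x_tendsto_0 filterlim_real_sequentially])
  have "(\<lambda>k. ln h * (1 / real k)) \<longlonglongrightarrow> ln h * 0" by (intro tendsto_mult tendsto_const inv)
  then have lnh: "(\<lambda>k. ln h / real k) \<longlonglongrightarrow> 0" by simp
  have "e \<longlonglongrightarrow> \<alpha> - \<alpha> * ln (\<alpha> / h) - (0 + 0)"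
    unfolding e_def[abs_def] using \<open>0 < \<alpha>\<close> \<open>0 < h\<close>
    by (intro tendsto_diff tendsto_add tendsto_mult a b lnk lnh tendsto_ln tendsto_divide tendsto_const) auto
  moreover have "exp (real k * e k) \<le> (real k * h) ^ a k / fact (a k)" if "1 \<le> k" for k
  proof -
    have k: "0 < real k" using that by simp
    have kb: "real k * b k = real (a k) + 1" using k by (simp add: b_def)
    have lnb: "ln (b k / h) = ln (real (a k) + 1) - (ln (real k) + ln h)"
      using k \<open>0 < h\<close> by (simp add: b_def ln_div ln_mult add_pos_nonneg)
    have "real k * e k = real (a k) - (real k * b k) * ln (b k / h) - (ln (real k) + ln h)"
      using k by (simp add: e_def right_diff_distrib distrib_left)
    also have "\<dots> = real (a k) * (ln (real k) + ln h) - ((real (a k) + 1) * ln (real (a k) + 1) - real (a k))"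
      unfolding kb lnb by (simp add: algebra_simps)
    also have "\<dots> \<le> real (a k) * (ln (real k) + ln h) - ln (fact (a k))"
      using ln_fact_le[of "a k"] by simp
    finally have "exp (real k * e k) \<le> exp (real (a k) * (ln (real k) + ln h) - ln (fact (a k)))" by simp
    also have "\<dots> = (real k * h) ^ a k / fact (a k)"
      using k \<open>0 < h\<close> by (simp add: exp_diff exp_of_nat_mult exp_add)
    finally show ?thesis .
  qed
  ultimately show ?thesis by auto
qed

text \<open>
  Apply \<open>transition_ge\<close> with about \<open>k * \<alpha>\<close> steps to the right and \<open>k * \<beta>\<close> steps to the left, where
  \<open>\<alpha> = h * exp \<tau>\<close> and \<open>\<beta> = h * exp (- \<tau>)\<close> are the mean numbers of steps, divided by \<open>k\<close>, of the walk whose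
  rates are tilted so that it has speed \<open>D / h\<close>. The error sequence \<open>e\<close> depends neither on the semigroup nor on the starting point.
\<close>

lemma transition_lower_asymptotic:
  fixes J :: "nat \<Rightarrow> int"
  assumes J: "(\<lambda>k. of_int (J k) / real k) \<longlonglongrightarrow> D" and "0 < h"
  shows "\<exists>e. e \<longlonglongrightarrow> - (h * rate_density (D / h)) \<and>
    (\<forall>\<^sub>F k in sequentially. \<forall>p j. grid_semigroup k p \<longrightarrow> exp (real k * e k) \<le> p h (node k j) (node k (j + J k)))"
proof -
  define v where "v = D / h"
  define \<tau> where "\<tau> = optimal_tilt v"
  define \<alpha> where "\<alpha> = h * exp \<tau>"
  define \<beta> where "\<beta> = h * exp (- \<tau>)"
  have pos: "0 < \<alpha>" "0 < \<beta>" using \<open>0 < h\<close> by (simp_all add: \<alpha>_def \<beta>_def)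
  have diff: "\<alpha> - \<beta> = D"
    using exp_optimal_tilt[of v] \<open>0 < h\<close>
    by (simp add: \<alpha>_def \<beta>_def \<tau>_def v_def flip: right_diff_distrib)
  define b where "b k = nat \<lfloor>real k * \<beta>\<rfloor>" for k
  define a where "a k = nat (J k + int (b k))" for k
  have "real (b k) = of_int \<lfloor>real k * \<beta>\<rfloor>" for k using pos by (simp add: b_def)
  then have b_lim: "(\<lambda>k. real (b k) / real k) \<longlonglongrightarrow> \<beta>" using floor_scaled_tendsto[of \<beta>] by simp
  have sum_lim: "(\<lambda>k. of_int (J k) / real k + real (b k) / real k) \<longlonglongrightarrow> \<alpha>"
    using tendsto_add[OF J b_lim] diff by (simp add: algebra_simps)
  then have "\<forall>\<^sub>F k in sequentially. 0 < of_int (J k) / real k + real (b k) / real k"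
    using pos(1) by (rule order_tendstoD)
  then have Jb: "\<forall>\<^sub>F k in sequentially. int (a k) = J k + int (b k)"
    using eventually_ge_at_top[of 1]
  proof eventually_elim
    case (elim k)
    then have "0 < (of_int (J k) + real (b k)) / real k" by (simp add: add_divide_distrib)
    then have "0 < of_int (J k) + real (b k)" by (simp add: zero_less_divide_iff)
    then have "0 \<le> J k + int (b k)" by linarith
    then show ?case by (simp add: a_def)
  qed
  have "(\<lambda>k. real (a k) / real k) \<longlonglongrightarrow> \<alpha>"
  proof (rule Lim_transform_eventually[OF sum_lim])
    show "\<forall>\<^sub>F k in sequentially. of_int (J k) / real k + real (b k) / real k = real (a k) / real k"
      using Jb
    proof eventually_elim
      case (elim k)
      then have "real_of_int (int (a k)) = of_int (J k + int (b k))" by simp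
      then have "real (a k) = of_int (J k) + real (b k)" by simp
      then show ?case by (simp add: add_divide_distrib)
    qed
  qed
  then obtain e1 where e1: "e1 \<longlonglongrightarrow> \<alpha> - \<alpha> * ln (\<alpha> / h)"
    "\<forall>k\<ge>1. exp (real k * e1 k) \<le> (real k * h) ^ a k / fact (a k)"
    using poisson_weight_asymptotic[OF _ pos(1) \<open>0 < h\<close>] by blast
  obtain e2 where e2: "e2 \<longlonglongrightarrow> \<beta> - \<beta> * ln (\<beta> / h)"
    "\<forall>k\<ge>1. exp (real k * e2 k) \<le> (real k * h) ^ b k / fact (b k)"
    using poisson_weight_asymptotic[OF b_lim pos(2) \<open>0 < h\<close>] by blast
  define e where "e k = e1 k + e2 k - 2 * h" for k
  have "e \<longlonglongrightarrow> (\<alpha> - \<alpha> * ln (\<alpha> / h)) + (\<beta> - \<beta> * ln (\<beta> / h)) - 2 * h"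
    unfolding e_def[abs_def] by (intro tendsto_diff tendsto_add e1 e2 tendsto_const)
  also have "(\<alpha> - \<alpha> * ln (\<alpha> / h)) + (\<beta> - \<beta> * ln (\<beta> / h)) - 2 * h = - (h * rate_density (D / h))"
  proof -
    have ln: "ln (\<alpha> / h) = \<tau>" "ln (\<beta> / h) = - \<tau>" using \<open>0 < h\<close> by (simp_all add: \<alpha>_def \<beta>_def)
    have "\<alpha> + \<beta> = h * (2 * cosh \<tau>)" by (simp add: \<alpha>_def \<beta>_def cosh_field_def algebra_simps)
    moreover have "D = h * v" using \<open>0 < h\<close> by (simp add: v_def)
    ultimately show ?thesis
      unfolding ln rate_density_eq v_def[symmetric] \<tau>_def[symmetric] cumulant_def
      using diff by (simp add: algebra_simps)
  qed
  finally have "e \<longlonglongrightarrow> - (h * rate_density (D / h))" .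
  moreover have "\<forall>\<^sub>F k in sequentially. \<forall>p j. grid_semigroup k p \<longrightarrow>
      exp (real k * e k) \<le> p h (node k j) (node k (j + J k))"
    using Jb eventually_ge_at_top[of 1]
  proof eventually_elim
    case (elim k)
    show ?case
    proof (intro allI impI)
      fix p j assume "grid_semigroup k p"
      then interpret grid_semigroup k p .
      have "exp (real k * e k) = exp (real k * e1 k) * exp (real k * e2 k) * exp (- (2 * real k * h))"
        by (simp add: e_def algebra_simps flip: exp_add)
      also have "\<dots> \<le> ((real k * h) ^ a k / fact (a k)) * ((real k * h) ^ b k / fact (b k)) * exp (- (2 * real k * h))"
        using e1(2) e2(2) elim(2) \<open>0 < h\<close> by (intro mult_right_mono mult_mono) auto
      also have "\<dots> = ((real k * h) ^ (a k + b k) / (fact (a k) * fact (b k))) * exp (- (2 * real k * h))"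
        by (simp add: power_add)
      also have "\<dots> \<le> (exp (2 * real k * h) * p h (node k j) (node k (j + int (a k) - int (b k)))) * exp (- (2 * real k * h))"
        using \<open>0 < h\<close> by (intro mult_right_mono transition_ge) auto
      also have "\<dots> = p h (node k j) (node k (j + J k))"
        using elim(1) by (simp add: exp_minus)
      finally show "exp (real k * e k) \<le> p h (node k j) (node k (j + J k))" .
    qed
  qed
  ultimately show ?thesis by blast
qed

section \<open>The walk as a process\<close>

definition time_chain :: "real \<Rightarrow> nat \<Rightarrow> (nat \<Rightarrow> real) \<Rightarrow> bool" where
  "time_chain T n t \<longleftrightarrow> t 0 = 0 \<and> (\<forall>i<n. t i \<le> t (Suc i)) \<and> t n \<le> T"

lemma time_chain_mono: "time_chain T n t \<Longrightarrow> i \<le> j \<Longrightarrow> j \<le> n \<Longrightarrow> t i \<le> t j"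
  unfolding time_chain_def using chain_mono[of n t i j] by blast

lemma time_chain_range: "time_chain T n t \<Longrightarrow> i \<le> n \<Longrightarrow> t i \<in> {0..T}"
  using time_chain_mono[of T n t 0 i] time_chain_mono[of T n t i n] by (auto simp: time_chain_def)

locale grid_walk = grid_semigroup k p + prob_space M
  for k :: nat and p :: "real \<Rightarrow> circle \<Rightarrow> circle \<Rightarrow> real" and M :: "'a measure" +
  fixes T :: real and x :: circle and X :: "'a \<Rightarrow> real \<Rightarrow> circle"
  assumes T: "0 < T" and x: "x \<in> grid k"
    and X_measurable: "X \<in> measurable M (skorohod_borel T)"
    and X_grid: "\<And>\<omega> t. \<omega> \<in> space M \<Longrightarrow> t \<in> {0..T} \<Longrightarrow> X \<omega> t \<in> grid k"
    and markov: "markov_process_from T (grid k) p x M X"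
begin

text \<open>
  This event has probability 1. Events are intersected with it because the Markov property only determines
  the probability of events that include the position at time 0.
\<close>

definition start :: "'a set" where
  "start = {\<omega> \<in> space M. X \<omega> 0 = x}"

definition cylinder :: "nat \<Rightarrow> (nat \<Rightarrow> real) \<Rightarrow> (nat \<Rightarrow> circle) \<Rightarrow> 'a set" where
  "cylinder n t a = {\<omega> \<in> space M. \<forall>i\<le>n. X \<omega> (t i) = a i}"

lemma prob_cylinder:
  assumes "time_chain T n t" "\<And>i. i \<le> n \<Longrightarrow> a i \<in> grid k" "a 0 = x"
  shows "prob (cylinder n t a) = (\<Prod>i<n. p (t (Suc i) - t i) (a i) (a (Suc i)))"
  using markov[unfolded markov_process_from_def, rule_format, of t n a] assms
  by (simp add: cylinder_def time_chain_def)

lemma start_event: "start \<in> events" and prob_start: "prob start = 1"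
proof -
  have "start = cylinder 0 (\<lambda>_. 0) (\<lambda>_. x)" by (simp add: start_def cylinder_def)
  then show *: "prob start = 1"
    using prob_cylinder[of 0 "\<lambda>_. 0" "\<lambda>_. x"] x T by (simp add: time_chain_def)
  show "start \<in> events" using * measure_notin_sets by fastforce
qed

text \<open>
  For \<open>t > 0\<close> the set is a cylinder, whose measure is a transition probability and hence positive. A set that is not an event
  has measure 0, so this one is an event.
\<close>

lemma state_event:
  assumes t: "t \<in> {0..T}" and y: "y \<in> grid k"
  shows "{\<omega> \<in> start. X \<omega> t = y} \<in> events"
proof (cases "t = 0")
  case True
  then have "{\<omega> \<in> start. X \<omega> t = y} = (if y = x then start else {})"
    by (auto simp: start_def)
  then show ?thesis using start_event by simp
next
  case False
  then have "0 < t" using t by simp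
  define s where "s i = (if i = 0 then 0 else t)" for i :: nat
  define a where "a i = (if i = 0 then x else y)" for i :: nat
  have eq: "{\<omega> \<in> start. X \<omega> t = y} = cylinder 1 s a"
    by (auto simp: start_def cylinder_def s_def a_def le_Suc_eq)
  have "time_chain T 1 s" using t by (simp add: time_chain_def s_def)
  then have "prob (cylinder 1 s a) = p t x y"
    using prob_cylinder[of 1 s a] x y by (simp add: a_def s_def)
  also have "\<dots> > 0" using transition_pos x y \<open>0 < t\<close> by blast
  finally show ?thesis unfolding eq using measure_notin_sets by fastforce
qed

lemma X_start_grid: "\<omega> \<in> start \<Longrightarrow> t \<in> {0..T} \<Longrightarrow> X \<omega> t \<in> grid k"
  using X_grid by (simp add: start_def)

lemma state_set_event:
  assumes t: "t \<in> {0..T}"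
  shows "{\<omega> \<in> start. X \<omega> t \<in> B} \<in> events"
proof -
  have "{\<omega> \<in> start. X \<omega> t \<in> B} = (\<Union>y\<in>grid k \<inter> B. {\<omega> \<in> start. X \<omega> t = y})"
    using X_start_grid t by auto
  then show ?thesis using state_event[OF t] by auto
qed

lemma cylinder_subset_start:
  assumes "t 0 = 0" "a 0 = x"
  shows "cylinder n t a \<subseteq> start"
proof
  fix \<omega> assume "\<omega> \<in> cylinder n t a"
  then have "\<omega> \<in> space M" "X \<omega> (t 0) = a 0" unfolding cylinder_def by blast+
  then show "\<omega> \<in> start" using assms by (simp add: start_def)
qed

lemma cylinder_event:
  assumes "time_chain T n t" "\<And>i. i \<le> n \<Longrightarrow> a i \<in> grid k" "a 0 = x"
  shows "cylinder n t a \<in> events"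
proof -
  have "cylinder n t a = (\<Inter>i\<in>{..n}. {\<omega> \<in> start. X \<omega> (t i) = a i})"
  proof (intro equalityI subsetI)
    fix \<omega> assume \<omega>: "\<omega> \<in> cylinder n t a"
    then have "\<omega> \<in> start"
      using cylinder_subset_start[of t a n] assms(1,3) by (auto simp: time_chain_def)
    with \<omega> show "\<omega> \<in> (\<Inter>i\<in>{..n}. {\<omega> \<in> start. X \<omega> (t i) = a i})"
      by (simp add: cylinder_def)
  next
    fix \<omega> assume "\<omega> \<in> (\<Inter>i\<in>{..n}. {\<omega> \<in> start. X \<omega> (t i) = a i})"
    then show "\<omega> \<in> cylinder n t a" by (auto simp: cylinder_def start_def)
  qed
  also have "\<dots> \<in> events"
    using state_event time_chain_range[OF assms(1)] assms(2) by (intro sets.finite_INT) auto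
  finally show ?thesis .
qed

lemma pair_event:
  assumes "s \<in> {0..T}" "t \<in> {0..T}"
  shows "{\<omega> \<in> start. R (X \<omega> s) (X \<omega> t)} \<in> events"
proof -
  have "{\<omega> \<in> start. R (X \<omega> s) (X \<omega> t)}
      = (\<Union>y\<in>grid k. {\<omega> \<in> start. X \<omega> s = y} \<inter> {\<omega> \<in> start. R y (X \<omega> t)})"
    using X_start_grid assms by auto
  also have "\<dots> \<in> events"
  proof (intro sets.finite_UN finite_grid sets.Int state_event[OF assms(1)])
    show "{\<omega> \<in> start. R y (X \<omega> t)} \<in> events" for y
      using state_set_event[OF assms(2), of "{z. R y z}"] by simp
  qed
  finally show ?thesis .
qed

section \<open>Fluctuations of the walk\<close>

text \<open>
  A maximal inequality: \<open>exp (- c * s) * f (X s)\<close> is a supermartingale, and \<open>f \<ge> F\<close> on \<open>B\<close>. It is proved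
  by backward induction on the number \<open>l\<close> of positions already fixed: either the last of them is in \<open>B\<close>, or the
  cylinder is split according to the next position.
\<close>

lemma hitting_prob_le:
  assumes chain: "time_chain T n t" and "l \<le> n"
    and a: "\<And>i. i \<le> l \<Longrightarrow> a i \<in> grid k" "a 0 = x"
    and f: "\<And>y. 0 \<le> f y" and c: "0 \<le> c" and F: "0 < F" "\<And>y. y \<in> B \<Longrightarrow> F \<le> f y"
    and super: "\<And>s y. 0 \<le> s \<Longrightarrow> y \<in> grid k \<Longrightarrow> (\<Sum>z\<in>grid k. p s y z * f z) \<le> exp (c * s) * f y"
  shows "prob {\<omega> \<in> cylinder l t a. \<exists>j\<in>{l..n}. X \<omega> (t j) \<in> B}
      \<le> prob (cylinder l t a) * (exp (c * (t n - t l)) * f (a l) / F)"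
  using \<open>l \<le> n\<close> a
proof (induction l arbitrary: a rule: inc_induct)
  case base
  show ?case
  proof (cases "a n \<in> B")
    case True
    have ev: "cylinder n t a \<in> events" by (rule cylinder_event[OF chain]) (use base in auto)
    have "prob {\<omega> \<in> cylinder n t a. \<exists>j\<in>{n..n}. X \<omega> (t j) \<in> B} \<le> prob (cylinder n t a) * 1"
      using ev by (simp add: finite_measure_mono)
    also have "\<dots> \<le> prob (cylinder n t a) * (exp (c * (t n - t n)) * f (a n) / F)"
      using F(1) F(2)[OF True] by (intro mult_left_mono) auto
    finally show ?thesis .
  next
    case False
    then have empty: "{\<omega> \<in> cylinder n t a. \<exists>j\<in>{n..n}. X \<omega> (t j) \<in> B} = {}"
      by (auto simp: cylinder_def)
    show ?thesis unfolding empty using F(1) f[of "a n"] by simp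
  qed
next
  case (step l)
  note al = step.prems(1)
  have chl: "time_chain T l t" "time_chain T (Suc l) t"
    using chain \<open>l < n\<close> time_chain_mono[OF chain, of l n] time_chain_mono[OF chain, of "Suc l" n]
    by (auto simp: time_chain_def)
  have ev: "cylinder l t a \<in> events" by (rule cylinder_event[OF chl(1)]) (use step.prems in auto)
  have mono: "t l \<le> t (Suc l)" "t (Suc l) \<le> t n" using time_chain_mono[OF chain] \<open>l < n\<close> by auto
  show ?case
  proof (cases "a l \<in> B")
    case True
    have "prob {\<omega> \<in> cylinder l t a. \<exists>j\<in>{l..n}. X \<omega> (t j) \<in> B} \<le> prob (cylinder l t a) * 1"
      using ev by (simp add: finite_measure_mono)
    also have "\<dots> \<le> prob (cylinder l t a) * (exp (c * (t n - t l)) * f (a l) / F)"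
    proof (intro mult_left_mono)
      have "1 * F \<le> exp (c * (t n - t l)) * f (a l)"
        using F(1) F(2)[OF True] c mono by (intro mult_mono) auto
      then show "1 \<le> exp (c * (t n - t l)) * f (a l) / F" using F(1) by (simp add: field_simps)
    qed simp
    finally show ?thesis .
  next
    case False
    define ext where "ext y = a(Suc l := y)" for y
    have ext: "\<And>i. i \<le> Suc l \<Longrightarrow> ext y i \<in> grid k" "ext y 0 = x" if "y \<in> grid k" for y
      using al step.prems(2) that by (auto simp: ext_def le_Suc_eq)
    have "{\<omega> \<in> cylinder l t a. \<exists>j\<in>{l..n}. X \<omega> (t j) \<in> B}
        = (\<Union>y\<in>grid k. {\<omega> \<in> cylinder (Suc l) t (ext y). \<exists>j\<in>{Suc l..n}. X \<omega> (t j) \<in> B})"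
    proof (intro equalityI subsetI)
      fix \<omega> assume "\<omega> \<in> {\<omega> \<in> cylinder l t a. \<exists>j\<in>{l..n}. X \<omega> (t j) \<in> B}"
      then obtain j where \<omega>: "\<omega> \<in> space M" "\<forall>i\<le>l. X \<omega> (t i) = a i" "j \<in> {l..n}" "X \<omega> (t j) \<in> B"
        by (auto simp: cylinder_def)
      have "j \<noteq> l" using \<omega> False by auto
      then have j: "j \<in> {Suc l..n}" using \<omega>(3) by auto
      have y: "X \<omega> (t (Suc l)) \<in> grid k"
        using X_grid[OF \<omega>(1)] time_chain_range[OF chain] \<open>l < n\<close> by auto
      have "\<omega> \<in> cylinder (Suc l) t (ext (X \<omega> (t (Suc l))))"
        using \<omega>(1,2) by (auto simp: cylinder_def ext_def le_Suc_eq)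
      then show "\<omega> \<in> (\<Union>y\<in>grid k. {\<omega> \<in> cylinder (Suc l) t (ext y). \<exists>j\<in>{Suc l..n}. X \<omega> (t j) \<in> B})"
        using y j \<omega>(4) by blast
    next
      fix \<omega> assume "\<omega> \<in> (\<Union>y\<in>grid k. {\<omega> \<in> cylinder (Suc l) t (ext y). \<exists>j\<in>{Suc l..n}. X \<omega> (t j) \<in> B})"
      then obtain y j where \<omega>: "\<omega> \<in> space M" "\<forall>i\<le>Suc l. X \<omega> (t i) = ext y i" "j \<in> {Suc l..n}" "X \<omega> (t j) \<in> B"
        unfolding cylinder_def by blast
      have "X \<omega> (t i) = a i" if "i \<le> l" for i
        using \<omega>(2)[rule_format, of i] that by (simp add: ext_def)
      then have "\<omega> \<in> cylinder l t a" using \<omega>(1) by (simp add: cylinder_def)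
      moreover have "j \<in> {l..n}" using \<omega>(3) by auto
      ultimately show "\<omega> \<in> {\<omega> \<in> cylinder l t a. \<exists>j\<in>{l..n}. X \<omega> (t j) \<in> B}" using \<omega>(4) by blast
    qed
    also have "prob \<dots> \<le> (\<Sum>y\<in>grid k. prob {\<omega> \<in> cylinder (Suc l) t (ext y). \<exists>j\<in>{Suc l..n}. X \<omega> (t j) \<in> B})"
    proof (rule finite_measure_subadditive_finite[OF finite_grid], rule image_subsetI)
      fix y assume y: "y \<in> grid k"
      have "{\<omega> \<in> cylinder (Suc l) t (ext y). \<exists>j\<in>{Suc l..n}. X \<omega> (t j) \<in> B}
          = (\<Union>j\<in>{Suc l..n}. cylinder (Suc l) t (ext y) \<inter> {\<omega> \<in> start. X \<omega> (t j) \<in> B})"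
        using cylinder_subset_start[of t "ext y" "Suc l"] ext(2)[OF y] chain
        unfolding time_chain_def by blast
      also have "\<dots> \<in> events"
      proof (intro sets.finite_UN sets.Int)
        show "cylinder (Suc l) t (ext y) \<in> events"
          by (rule cylinder_event[OF chl(2)]) (use ext[OF y] in auto)
        show "{\<omega> \<in> start. X \<omega> (t j) \<in> B} \<in> events" if "j \<in> {Suc l..n}" for j
          using that by (intro state_set_event time_chain_range[OF chain]) simp
      qed simp
      finally show "{\<omega> \<in> cylinder (Suc l) t (ext y). \<exists>j\<in>{Suc l..n}. X \<omega> (t j) \<in> B} \<in> events" .
    qed
    also have "\<dots> \<le> (\<Sum>y\<in>grid k. prob (cylinder (Suc l) t (ext y)) * (exp (c * (t n - t (Suc l))) * f (ext y (Suc l)) / F))"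
      using ext by (intro sum_mono step.IH)
    also have "\<dots> = (\<Sum>y\<in>grid k. prob (cylinder l t a) * (exp (c * (t n - t (Suc l))) / F) * (p (t (Suc l) - t l) (a l) y * f y))"
    proof (rule sum.cong[OF refl])
      fix y assume y: "y \<in> grid k"
      have "prob (cylinder (Suc l) t (ext y)) = (\<Prod>i<Suc l. p (t (Suc i) - t i) (ext y i) (ext y (Suc i)))"
        by (rule prob_cylinder[OF chl(2)]) (use ext[OF y] in auto)
      also have "\<dots> = (\<Prod>i<l. p (t (Suc i) - t i) (a i) (a (Suc i))) * p (t (Suc l) - t l) (a l) y"
        by (simp add: ext_def)
      also have "(\<Prod>i<l. p (t (Suc i) - t i) (a i) (a (Suc i))) = prob (cylinder l t a)"
        by (rule prob_cylinder[symmetric, OF chl(1)]) (use step.prems in auto)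
      finally have pr: "prob (cylinder (Suc l) t (ext y)) = prob (cylinder l t a) * p (t (Suc l) - t l) (a l) y" .
      show "prob (cylinder (Suc l) t (ext y)) * (exp (c * (t n - t (Suc l))) * f (ext y (Suc l)) / F)
         = prob (cylinder l t a) * (exp (c * (t n - t (Suc l))) / F) * (p (t (Suc l) - t l) (a l) y * f y)"
        unfolding pr by (simp add: ext_def mult_ac)
    qed
    also have "\<dots> = prob (cylinder l t a) * (exp (c * (t n - t (Suc l))) / F) * (\<Sum>y\<in>grid k. p (t (Suc l) - t l) (a l) y * f y)"
      by (simp add: sum_distrib_left)
    also have "\<dots> \<le> prob (cylinder l t a) * (exp (c * (t n - t (Suc l))) / F) * (exp (c * (t (Suc l) - t l)) * f (a l))"
      using F(1) mono al by (intro mult_left_mono super) auto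
    also have "\<dots> = prob (cylinder l t a) * ((exp (c * (t n - t (Suc l))) * exp (c * (t (Suc l) - t l))) * f (a l) / F)"
      by simp
    also have "exp (c * (t n - t (Suc l))) * exp (c * (t (Suc l) - t l)) = exp (c * (t n - t l))"
      by (simp add: algebra_simps flip: exp_add)
    finally show ?thesis .
  qed
qed

text \<open>
  The maximal inequality after conditioning on the position \<open>y\<close> at time \<open>r\<close>, with
  \<open>f = cosh (k * q * dist y z)\<close>, which is 1 at \<open>y\<close> and at least \<open>cosh (k * q * \<delta>)\<close> at distance \<open>\<delta>\<close>.
\<close>

lemma grid_fluctuation_prob_le:
  assumes "0 \<le> r" "0 < h" "r + h \<le> T" "0 < m" "0 \<le> \<delta>"
  shows "prob {\<omega> \<in> start. \<exists>j\<le>m. \<delta> \<le> dist (X \<omega> r) (X \<omega> (r + real j * h / real m))}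
      \<le> exp (real k * cumulant q * h) / cosh (real k * q * \<delta>)"
proof -
  \<comment> \<open>The time 0 is prefixed, and the time \<open>r\<close> has index 1.\<close>
  define t where "t i = (case i of 0 \<Rightarrow> 0 | Suc j \<Rightarrow> r + real j * h / real m)" for i :: nat
  have t_simps: "t 0 = 0" "t (Suc j) = r + real j * h / real m" for j by (simp_all add: t_def)
  have tn: "t (Suc m) = r + h" using assms by (simp add: t_simps)
  have t_step: "t i \<le> t (Suc i)" for i
    using assms by (cases i) (auto simp: t_simps intro!: divide_right_mono mult_right_mono)
  have chain: "time_chain T (Suc m) t"
    unfolding time_chain_def using t_step tn assms by (simp add: t_simps)
  have chain1: "time_chain T 1 t"
    unfolding time_chain_def using t_step assms by (simp add: t_simps)
  define a where "a y i = (if i = 0 then x else y)" for y and i :: nat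
  define F where "F = cosh (real k * q * \<delta>)"
  define E where "E y = {\<omega> \<in> cylinder 1 t (a y). \<exists>j\<in>{1..Suc m}. X \<omega> (t j) \<in> {z. \<delta> \<le> dist y z}}" for y
  have c: "0 \<le> real k * cumulant q" using cumulant_nonneg by simp
  have "F > 0" unfolding F_def using cosh_real_pos by blast
  have E_le: "prob (E y) \<le> p r x y * (exp (real k * cumulant q * h) / F)" if y: "y \<in> grid k" for y
  proof -
    have "prob (E y) \<le> prob (cylinder 1 t (a y)) * (exp (real k * cumulant q * (t (Suc m) - t 1)) * cosh (real k * q * dist y (a y 1)) / F)"
      unfolding E_def
    proof (rule hitting_prob_le[OF chain])
      show "(\<Sum>z\<in>grid k. p s z' z * cosh (real k * q * dist y z)) \<le> exp (real k * cumulant q * s) * cosh (real k * q * dist y z')"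
        if "0 \<le> s" "z' \<in> grid k" for s z' using exponential_moment_le[OF y that(2,1)] .
      show "F \<le> cosh (real k * q * dist y z)" if "z \<in> {z. \<delta> \<le> dist y z}" for z
        unfolding F_def using that assms(5)
        by (intro cosh_real_mono_abs) (auto simp: abs_mult intro!: mult_left_mono)
    qed (use x y c \<open>F > 0\<close> cosh_real_nonneg in \<open>auto simp: a_def\<close>)
    also have "prob (cylinder 1 t (a y)) = p r x y"
      using prob_cylinder[OF chain1, of "a y"] x y by (simp add: a_def t_simps)
    finally show ?thesis using tn by (simp add: a_def t_simps)
  qed
  have "{\<omega> \<in> start. \<exists>j\<le>m. \<delta> \<le> dist (X \<omega> r) (X \<omega> (r + real j * h / real m))} \<subseteq> (\<Union>y\<in>grid k. E y)"
  proof
    fix \<omega> assume "\<omega> \<in> {\<omega> \<in> start. \<exists>j\<le>m. \<delta> \<le> dist (X \<omega> r) (X \<omega> (r + real j * h / real m))}"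
    then obtain j where \<omega>: "\<omega> \<in> start" "j \<le> m" "\<delta> \<le> dist (X \<omega> r) (X \<omega> (t (Suc j)))" by (auto simp: t_simps)
    have "X \<omega> r \<in> grid k" using X_start_grid[OF \<omega>(1)] assms by simp
    moreover have "\<omega> \<in> E (X \<omega> r)"
    proof -
      have "\<omega> \<in> cylinder 1 t (a (X \<omega> r))"
        using \<omega>(1) by (auto simp: cylinder_def start_def a_def le_Suc_eq t_simps)
      moreover have "Suc j \<in> {1..Suc m}" using \<omega>(2) by simp
      ultimately show ?thesis using \<omega>(3) unfolding E_def by blast
    qed
    ultimately show "\<omega> \<in> (\<Union>y\<in>grid k. E y)" by blast
  qed
  moreover have E_event: "E y \<in> events" if y: "y \<in> grid k" for y
  proof -
    have "E y = (\<Union>j\<in>{1..Suc m}. cylinder 1 t (a y) \<inter> {\<omega> \<in> start. X \<omega> (t j) \<in> {z. \<delta> \<le> dist y z}})"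
      using cylinder_subset_start[of t "a y" 1] unfolding E_def by (simp add: a_def t_simps) blast
    also have "\<dots> \<in> events"
    proof (intro sets.finite_UN sets.Int)
      show "cylinder 1 t (a y) \<in> events"
        by (rule cylinder_event[OF chain1]) (use x y in \<open>auto simp: a_def\<close>)
      show "{\<omega> \<in> start. X \<omega> (t j) \<in> {z. \<delta> \<le> dist y z}} \<in> events" if "j \<in> {1..Suc m}" for j
        using that by (intro state_set_event time_chain_range[OF chain]) simp
    qed simp
    finally show ?thesis .
  qed
  ultimately have "prob {\<omega> \<in> start. \<exists>j\<le>m. \<delta> \<le> dist (X \<omega> r) (X \<omega> (r + real j * h / real m))} \<le> prob (\<Union>y\<in>grid k. E y)"
    by (intro finite_measure_mono) auto
  also have "\<dots> \<le> (\<Sum>y\<in>grid k. prob (E y))"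
    using E_event by (intro finite_measure_subadditive_finite) auto
  also have "\<dots> \<le> (\<Sum>y\<in>grid k. p r x y * (exp (real k * cumulant q * h) / F))"
    using E_le by (rule sum_mono)
  also have "\<dots> = (\<Sum>y\<in>grid k. p r x y) * (exp (real k * cumulant q * h) / F)"
    by (simp only: sum_distrib_right)
  also have "\<dots> = exp (real k * cumulant q * h) / F"
    using markov_semigroup_sum[OF ms assms(1) x] by simp
  finally show ?thesis by (simp add: F_def)
qed

lemma X_cadlag: "\<omega> \<in> space M \<Longrightarrow> X \<omega> \<in> cadlag_paths T"
  using measurable_space[OF X_measurable] by (simp add: skorohod_borel_def space_measure_of_conv)

text \<open>
  Only dyadic subdivision points of \<open>[r,r+h]\<close> are inspected, so that this is a countable union of events, increasing in \<open>N\<close>.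
  By right continuity the remaining times follow (\<open>not_fluctuation_dist_le\<close>).
\<close>

definition fluctuation :: "real \<Rightarrow> real \<Rightarrow> real \<Rightarrow> 'a set" where
  "fluctuation \<delta> r h = (\<Union>N. {\<omega> \<in> start. \<exists>j\<le>2 ^ N. \<delta> \<le> dist (X \<omega> r) (X \<omega> (r + real j * h / real (2 ^ N)))})"

lemma fluctuation_event_prob:
  assumes "0 \<le> r" "0 < h" "r + h \<le> T" "0 \<le> \<delta>"
  shows "fluctuation \<delta> r h \<in> events"
    and "prob (fluctuation \<delta> r h) \<le> exp (real k * cumulant q * h) / cosh (real k * q * \<delta>)"
proof -
  define E where "E N = {\<omega> \<in> start. \<exists>j\<le>2 ^ N. \<delta> \<le> dist (X \<omega> r) (X \<omega> (r + real j * h / real (2 ^ N)))}" for N :: nat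
  have in_T: "r + real j * h / real (2 ^ N) \<in> {0..T}" if "j \<le> 2 ^ N" for j N
  proof -
    have "real j \<le> real (2 ^ N)" using that by (rule of_nat_mono)
    then have "real j * h / real (2 ^ N) \<le> real (2 ^ N) * h / real (2 ^ N)"
      using assms by (intro divide_right_mono mult_right_mono) auto
    then show ?thesis using assms by simp
  qed
  have ev: "E N \<in> events" for N
  proof -
    have "E N = (\<Union>j\<in>{..2 ^ N}. {\<omega> \<in> start. \<delta> \<le> dist (X \<omega> r) (X \<omega> (r + real j * h / real (2 ^ N)))})"
      by (auto simp: E_def)
    also have "\<dots> \<in> events"
      using assms in_T by (intro sets.finite_UN pair_event) auto
    finally show ?thesis .
  qed
  have "E N \<subseteq> E (Suc N)" for N
  proof
    fix \<omega> assume "\<omega> \<in> E N"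
    then obtain j where j: "\<omega> \<in> start" "j \<le> 2 ^ N" "\<delta> \<le> dist (X \<omega> r) (X \<omega> (r + real j * h / real (2 ^ N)))"
      by (auto simp: E_def)
    have "real (2 * j) * h / real (2 ^ Suc N) = real j * h / real (2 ^ N)" by simp
    then show "\<omega> \<in> E (Suc N)" using j unfolding E_def by (intro CollectI conjI exI[of _ "2 * j"]) simp_all
  qed
  then have "incseq E" by (rule incseq_SucI)
  then have "(\<lambda>N. prob (E N)) \<longlonglongrightarrow> prob (\<Union>N. E N)"
    using ev by (intro finite_Lim_measure_incseq) auto
  moreover have "prob (E N) \<le> exp (real k * cumulant q * h) / cosh (real k * q * \<delta>)" for N
    unfolding E_def by (rule grid_fluctuation_prob_le) (use assms in auto)
  ultimately have "prob (\<Union>N. E N) \<le> exp (real k * cumulant q * h) / cosh (real k * q * \<delta>)"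
    by (intro LIMSEQ_le_const2) auto
  then show "prob (fluctuation \<delta> r h) \<le> exp (real k * cumulant q * h) / cosh (real k * q * \<delta>)"
    by (simp add: fluctuation_def E_def)
  show "fluctuation \<delta> r h \<in> events" unfolding fluctuation_def E_def[symmetric] using ev by auto
qed

lemma not_fluctuation_dist_le:
  assumes "\<omega> \<in> start" "\<omega> \<notin> fluctuation \<delta> r h" "0 \<le> r" "0 < h" "r + h \<le> T" and s: "s \<in> {r..r + h}"
  shows "dist (X \<omega> r) (X \<omega> s) \<le> \<delta>"
proof (rule ccontr)
  assume "\<not> dist (X \<omega> r) (X \<omega> s) \<le> \<delta>"
  then have far: "\<delta> < dist (X \<omega> r) (X \<omega> s)" by simp
  have grid: "dist (X \<omega> r) (X \<omega> (r + real j * h / real (2 ^ N))) < \<delta>" if "j \<le> 2 ^ N" for j N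
  proof -
    have "\<not> \<delta> \<le> dist (X \<omega> r) (X \<omega> (r + real j * h / real (2 ^ N)))"
      using assms(1,2) that unfolding fluctuation_def by blast
    then show ?thesis by simp
  qed
  show False
  proof (cases "s = r + h")
    case True
    then show False using grid[of 1 0] far by simp
  next
    case False
    then have s': "r \<le> s" "s < r + h" using s by auto
    have "\<omega> \<in> space M" using assms(1) by (simp add: start_def)
    then have "(X \<omega> \<longlongrightarrow> X \<omega> s) (at_right s)"
      using X_cadlag s' assms by (auto simp: cadlag_paths_def)
    then have "((\<lambda>u. dist (X \<omega> r) (X \<omega> u)) \<longlongrightarrow> dist (X \<omega> r) (X \<omega> s)) (at_right s)"
      by (intro tendsto_intros)
    then have "\<forall>\<^sub>F u in at_right s. \<delta> < dist (X \<omega> r) (X \<omega> u)"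
      using far by (rule order_tendstoD)
    then obtain b where "b > s" and b: "\<And>u. s < u \<Longrightarrow> u < b \<Longrightarrow> \<delta> < dist (X \<omega> r) (X \<omega> u)"
      unfolding eventually_at_right_field by blast
    define c where "c = min b (r + h)"
    have c: "s < c" using \<open>b > s\<close> s' by (simp add: c_def)
    obtain N where N: "h / (c - s) < 2 ^ N" using real_arch_pow[of 2 "h / (c - s)"] by auto
    have step: "h / 2 ^ N < c - s" using N c by (simp add: field_simps)
    \<comment> \<open>The first dyadic point of level \<open>N\<close> after \<open>s\<close>.\<close>
    define j where "j = nat (\<lfloor>(s - r) * 2 ^ N / h\<rfloor> + 1)"
    have pos: "0 \<le> (s - r) * 2 ^ N / h" using s' assms by simp
    have j: "real j = of_int \<lfloor>(s - r) * 2 ^ N / h\<rfloor> + 1" using pos by (simp add: j_def)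
    have "(s - r) * 2 ^ N / h < real j" "real j \<le> (s - r) * 2 ^ N / h + 1" unfolding j by linarith+
    then have "s - r < real j * h / 2 ^ N" "real j * h / 2 ^ N \<le> (s - r) + h / 2 ^ N"
      using assms(4) by (simp_all add: field_simps)
    then have u: "s < r + real j * h / 2 ^ N" "r + real j * h / 2 ^ N < c" using step by linarith+
    then have "real j * h / 2 ^ N < h" by (simp add: c_def)
    then have "real j < 2 ^ N" using assms(4) by (simp add: field_simps)
    then have "real j < real (2 ^ N)" by simp
    then have "j \<le> 2 ^ N" by (simp only: of_nat_less_iff)
    then have "dist (X \<omega> r) (X \<omega> (r + real j * h / 2 ^ N)) < \<delta>" using grid[of j N] by simp
    moreover have "\<delta> < dist (X \<omega> r) (X \<omega> (r + real j * h / 2 ^ N))"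
      using u by (intro b) (auto simp: c_def)
    ultimately show False by simp
  qed
qed

end

section \<open>The walk observed on a mesh\<close>

definition mesh_point :: "real \<Rightarrow> nat \<Rightarrow> nat \<Rightarrow> real" where
  "mesh_point T n i = real i * T / real n"

context grid_walk
begin

abbreviation mesh :: "nat \<Rightarrow> nat \<Rightarrow> real" where
  "mesh \<equiv> mesh_point T"

definition path_cost :: "nat \<Rightarrow> (nat \<Rightarrow> circle) \<Rightarrow> real" where
  "path_cost n a = (\<Sum>i<n. T / real n * rate_density (dist (a i) (a (Suc i)) / (T / real n)))"

lemma mesh_step: "mesh n (Suc i) - mesh n i = T / real n"
  by (simp add: mesh_point_def add_divide_distrib distrib_right)

lemma mesh_0: "mesh n 0 = 0" and mesh_n: "0 < n \<Longrightarrow> mesh n n = T"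
  by (simp_all add: mesh_point_def)

lemma mesh_chain: "0 < n \<Longrightarrow> time_chain T n (mesh n)"
  unfolding time_chain_def mesh_0 mesh_n using T
  by (auto simp: mesh_point_def intro!: divide_right_mono)

lemma mesh_range: "0 < n \<Longrightarrow> i \<le> n \<Longrightarrow> mesh n i \<in> {0..T}"
  using time_chain_range[OF mesh_chain] by blast

lemma mesh_cover:
  assumes "0 < n" "t \<in> {0..T}"
  shows "\<exists>i<n. t \<in> {mesh n i..mesh n (Suc i)}"
proof (rule ccontr)
  assume no: "\<not> ?thesis"
  have "mesh n i \<le> t" if "i \<le> n" for i
    using that
  proof (induction i)
    case 0
    then show ?case using assms by (simp add: mesh_0)
  next
    case (Suc i)
    then have "mesh n i \<le> t" "i < n" by simp_all
    then have "\<not> t \<le> mesh n (Suc i)" using no by auto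
    then show ?case by simp
  qed
  from this[of "n - 1"] have "mesh n (n - 1) \<le> t" by simp
  moreover have "t \<le> mesh n (Suc (n - 1))" using assms by (simp add: mesh_n)
  moreover have "n - 1 < n" using assms by simp
  ultimately show False using no by auto
qed

lemma prob_mesh_cylinder_le:
  assumes n: "0 < n" and a: "\<And>i. i \<le> n \<Longrightarrow> a i \<in> grid k" "a 0 = x"
  shows "prob (cylinder n (mesh n) a) \<le> 2 ^ n * exp (- (real k * path_cost n a))"
proof -
  define h where "h = T / real n"
  have h: "0 < h" using n T by (simp add: h_def)
  have "prob (cylinder n (mesh n) a) = (\<Prod>i<n. p h (a i) (a (Suc i)))"
    using prob_cylinder[OF mesh_chain[OF n], of a] a by (simp add: mesh_step h_def)
  also have "\<dots> \<le> (\<Prod>i<n. 2 * exp (- (real k * (h * rate_density (dist (a i) (a (Suc i)) / h)))))"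
    using a h by (intro prod_mono conjI markov_semigroup_nonneg[OF ms] transition_le) auto
  also have "\<dots> = 2 ^ n * exp (\<Sum>i<n. - (real k * (h * rate_density (dist (a i) (a (Suc i)) / h))))"
    by (simp add: prod.distrib exp_sum)
  also have "(\<Sum>i<n. - (real k * (h * rate_density (dist (a i) (a (Suc i)) / h)))) = - (real k * path_cost n a)"
    by (simp add: path_cost_def h_def sum_negf sum_distrib_left)
  finally show ?thesis .
qed

text \<open>
  A union bound over the possible positions at the mesh times, of which there are at most \<open>k ^ (n + 1)\<close>.
\<close>

lemma costly_paths:
  fixes m :: real
  assumes n: "0 < n"
  defines "E \<equiv> {\<omega> \<in> start. m < path_cost n (\<lambda>i. X \<omega> (mesh n i))}"
  shows costly_paths_event: "E \<in> events"
    and prob_costly_paths_le: "prob E \<le> real k ^ Suc n * 2 ^ n * exp (- (real k * m))"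
proof -
  define S where "S = {a \<in> PiE {..n} (\<lambda>_. grid k). a 0 = x \<and> m < path_cost n a}"
  have fin: "finite (PiE {..n} (\<lambda>_. grid k))" by (intro finite_PiE) auto
  then have finS: "finite S" by (simp add: S_def)
  have S: "\<And>i. i \<le> n \<Longrightarrow> a i \<in> grid k" "a 0 = x" "m < path_cost n a" if "a \<in> S" for a
    using that by (auto simp: S_def)
  have cost_cong: "path_cost n a = path_cost n b" if "\<And>i. i \<le> n \<Longrightarrow> a i = b i" for a b
    unfolding path_cost_def using that by (intro sum.cong) auto
  have E: "E = (\<Union>a\<in>S. cylinder n (mesh n) a)"
  proof (intro equalityI subsetI)
    fix \<omega> assume "\<omega> \<in> E"
    then have \<omega>: "\<omega> \<in> start" "m < path_cost n (\<lambda>i. X \<omega> (mesh n i))" by (auto simp: E_def)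
    define a where "a = restrict (\<lambda>i. X \<omega> (mesh n i)) {..n}"
    have "path_cost n a = path_cost n (\<lambda>i. X \<omega> (mesh n i))"
      by (rule cost_cong) (simp add: a_def)
    moreover have "a 0 = x" using \<omega>(1) by (simp add: a_def mesh_0 start_def)
    moreover have "a \<in> PiE {..n} (\<lambda>_. grid k)"
      using X_start_grid[OF \<omega>(1) mesh_range[OF n]] by (auto simp: a_def)
    ultimately have "a \<in> S" using \<omega>(2) by (simp add: S_def)
    moreover have "\<omega> \<in> cylinder n (mesh n) a"
      using \<omega>(1) by (simp add: cylinder_def start_def a_def)
    ultimately show "\<omega> \<in> (\<Union>a\<in>S. cylinder n (mesh n) a)" by blast
  next
    fix \<omega> assume "\<omega> \<in> (\<Union>a\<in>S. cylinder n (mesh n) a)"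
    then obtain a where a: "a \<in> S" "\<omega> \<in> cylinder n (mesh n) a" by blast
    have "\<omega> \<in> start" using cylinder_subset_start[of "mesh n" a n] S(2)[OF a(1)] a(2) mesh_0 by auto
    moreover have "path_cost n (\<lambda>i. X \<omega> (mesh n i)) = path_cost n a"
      using a(2) by (intro cost_cong) (simp add: cylinder_def)
    ultimately show "\<omega> \<in> E" using S(3)[OF a(1)] by (simp add: E_def)
  qed
  have cyl: "cylinder n (mesh n) a \<in> events" if "a \<in> S" for a
    by (rule cylinder_event[OF mesh_chain[OF n]]) (use S[OF that] in auto)
  show "E \<in> events" unfolding E using finS cyl by (intro sets.finite_UN) auto
  have "prob E \<le> (\<Sum>a\<in>S. prob (cylinder n (mesh n) a))"
    unfolding E using finS cyl by (intro finite_measure_subadditive_finite) auto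
  also have "\<dots> \<le> (\<Sum>a\<in>S. 2 ^ n * exp (- (real k * m)))"
  proof (rule sum_mono)
    fix a assume a: "a \<in> S"
    have "prob (cylinder n (mesh n) a) \<le> 2 ^ n * exp (- (real k * path_cost n a))"
      by (rule prob_mesh_cylinder_le[OF n]) (use S[OF a] in auto)
    also have "\<dots> \<le> 2 ^ n * exp (- (real k * m))"
      using S(3)[OF a] by (intro mult_left_mono) (auto intro!: mult_left_mono)
    finally show "prob (cylinder n (mesh n) a) \<le> 2 ^ n * exp (- (real k * m))" .
  qed
  also have "\<dots> = real (card S) * (2 ^ n * exp (- (real k * m)))" by simp
  also have "\<dots> \<le> real k ^ Suc n * (2 ^ n * exp (- (real k * m)))"
  proof (rule mult_right_mono)
    have "card S \<le> card (PiE {..n} (\<lambda>_. grid k))" using fin by (intro card_mono) (auto simp: S_def)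
    also have "\<dots> = card (grid k) ^ Suc n" by (simp add: card_PiE)
    also have "\<dots> \<le> k ^ Suc n" by (intro power_mono card_grid_le) simp
    finally have "real (card S) \<le> real (k ^ Suc n)" by (rule of_nat_mono)
    then show "real (card S) \<le> real k ^ Suc n" by simp
  qed simp
  finally show "prob E \<le> real k ^ Suc n * 2 ^ n * exp (- (real k * m))" by (simp add: mult.assoc)
qed

definition rough :: "nat \<Rightarrow> real \<Rightarrow> 'a set" where
  "rough n \<delta> = (\<Union>i<n. fluctuation \<delta> (mesh n i) (T / real n))"

text \<open>
  The tilt \<open>q\<close> is free: for any \<open>m\<close> and \<open>\<delta> > 0\<close>, a large \<open>q\<close> followed by a fine mesh satisfies the last hypothesis, so
  fluctuations between the mesh times are negligible on the exponential scale.
\<close>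

lemma rough_event_prob:
  assumes n: "0 < n" and "0 \<le> \<delta>" "0 \<le> q" and large: "m + cumulant q * (T / real n) \<le> q * \<delta>"
  shows "rough n \<delta> \<in> events" and "prob (rough n \<delta>) \<le> 2 * real n * exp (- (real k * m))"
proof -
  define h where "h = T / real n"
  have h: "0 < h" using n T by (simp add: h_def)
  have piece: "0 \<le> mesh n i" "mesh n i + h \<le> T" if "i < n" for i
    using mesh_range[OF n, of i] mesh_range[OF n, of "Suc i"] mesh_step[of n i] that by (auto simp: h_def)
  have ev: "fluctuation \<delta> (mesh n i) h \<in> events" if "i < n" for i
    using fluctuation_event_prob(1)[OF piece(1)[OF that] h piece(2)[OF that] \<open>0 \<le> \<delta>\<close>] .
  show "rough n \<delta> \<in> events" unfolding rough_def h_def[symmetric] using ev by (intro sets.finite_UN) auto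
  have "prob (rough n \<delta>) \<le> (\<Sum>i<n. prob (fluctuation \<delta> (mesh n i) h))"
    unfolding rough_def h_def[symmetric] using ev by (intro finite_measure_subadditive_finite) auto
  also have "\<dots> \<le> (\<Sum>i<n. 2 * exp (- (real k * m)))"
  proof (rule sum_mono)
    fix i assume "i \<in> {..<n}"
    then have "prob (fluctuation \<delta> (mesh n i) h) \<le> exp (real k * cumulant q * h) / cosh (real k * q * \<delta>)"
      using fluctuation_event_prob(2)[OF piece(1) h piece(2) \<open>0 \<le> \<delta>\<close>] by simp
    also have "\<dots> \<le> exp (real k * cumulant q * h) / (exp (real k * q * \<delta>) / 2)"
      by (intro divide_left_mono mult_pos_pos) (simp_all add: cosh_field_def add_pos_pos)
    also have "\<dots> = 2 * exp (real k * (cumulant q * h - q * \<delta>))"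
      by (simp add: exp_diff right_diff_distrib mult.assoc)
    also have "\<dots> \<le> 2 * exp (real k * (- m))"
    proof -
      have "cumulant q * h - q * \<delta> \<le> - m" using large by (simp add: h_def)
      then have "real k * (cumulant q * h - q * \<delta>) \<le> real k * (- m)" by (rule mult_left_mono) simp
      then show ?thesis by simp
    qed
    finally show "prob (fluctuation \<delta> (mesh n i) h) \<le> 2 * exp (- (real k * m))" by simp
  qed
  also have "\<dots> = 2 * real n * exp (- (real k * m))" by simp
  finally show "prob (rough n \<delta>) \<le> 2 * real n * exp (- (real k * m))" .
qed

lemma not_rough_dist_le:
  assumes "\<omega> \<in> start" "\<omega> \<notin> rough n \<delta>" "i < n" "t \<in> {mesh n i..mesh n (Suc i)}"
  shows "dist (X \<omega> (mesh n i)) (X \<omega> t) \<le> \<delta>"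
proof (rule not_fluctuation_dist_le[of \<omega> \<delta> "mesh n i" "T / real n"])
  have n: "0 < n" using assms by simp
  show "0 < T / real n" using n T by simp
  show "0 \<le> mesh n i" "mesh n i + T / real n \<le> T"
    using mesh_range[OF n, of i] mesh_range[OF n, of "Suc i"] mesh_step[of n i] assms(3) by auto
  show "t \<in> {mesh n i..mesh n i + T / real n}" using assms(4) mesh_step[of n i] by auto
  show "\<omega> \<notin> fluctuation \<delta> (mesh n i) (T / real n)" using assms(2,3) unfolding rough_def by blast
qed fact

text \<open>
  The interpolation of the observed positions stays close to the path, since both move by at most \<open>\<delta>\<close>
  between mesh times.
\<close>

lemma smooth_path_near_lift:
  assumes \<omega>: "\<omega> \<in> start" "\<omega> \<notin> rough n \<delta>" and n: "0 < n"
  shows "\<exists>g A. action_majorant T g A \<and> A 0 = 0 \<and> g 0 = Rep_circle y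
    \<and> A T = path_cost n (\<lambda>i. X \<omega> (mesh n i))
    \<and> (\<forall>t\<in>{0..T}. dist (X \<omega> t) (circle_of_real (g t)) \<le> 2 * \<delta> + dist x y)"
proof -
  define a where "a i = X \<omega> (mesh n i)" for i
  obtain g A where gA: "action_majorant T g A" "A 0 = 0" "g 0 = Rep_circle y"
    "A T = (\<Sum>i<n. T / real n * rate_density (dist (a i) (a (Suc i)) / (T / real n)))"
    "\<forall>i\<le>n. dist (a i) (circle_of_real (g (real i * T / real n))) \<le> dist (a 0) y"
    "\<forall>i<n. \<forall>t\<in>{real i * T / real n..real (Suc i) * T / real n}.
        \<bar>g t - g (real i * T / real n)\<bar> \<le> dist (a i) (a (Suc i))"
    using interpolating_lift[OF n T, of y a] by (elim exE conjE) (rule that)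
  have a0: "a 0 = x" using \<omega>(1) by (simp add: a_def mesh_0 start_def)
  have "dist (X \<omega> t) (circle_of_real (g t)) \<le> 2 * \<delta> + dist x y" if t: "t \<in> {0..T}" for t
  proof -
    obtain i where i: "i < n" "t \<in> {mesh n i..mesh n (Suc i)}" using mesh_cover[OF n t] by blast
    have "mesh n i \<le> mesh n (Suc i)" using i(2) by simp
    then have fin: "dist (a i) (a (Suc i)) \<le> \<delta>"
      unfolding a_def by (intro not_rough_dist_le[OF \<omega> i(1)]) simp
    have "dist (X \<omega> t) (a i) \<le> \<delta>"
      using not_rough_dist_le[OF \<omega> i] by (simp add: a_def dist_commute)
    moreover have "dist (a i) (circle_of_real (g (mesh n i))) \<le> dist x y"
      using gA(5) i(1) a0 by (simp add: mesh_point_def)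
    moreover have "dist (circle_of_real (g (mesh n i))) (circle_of_real (g t)) \<le> \<delta>"
    proof -
      have "\<bar>g t - g (mesh n i)\<bar> \<le> dist (a i) (a (Suc i))"
        using gA(6) i unfolding mesh_point_def by blast
      then show ?thesis
        using dist_circle_of_real_le[of "g t" "g (mesh n i)"] fin by (simp add: dist_commute)
    qed
    moreover have "dist (X \<omega> t) (circle_of_real (g t)) \<le> dist (X \<omega> t) (a i)
        + (dist (a i) (circle_of_real (g (mesh n i))) + dist (circle_of_real (g (mesh n i))) (circle_of_real (g t)))"
      using dist_triangle[of "X \<omega> t" "circle_of_real (g t)" "a i"]
        dist_triangle[of "a i" "circle_of_real (g t)" "circle_of_real (g (mesh n i))"] by linarith
    ultimately show ?thesis by linarith
  qed
  then show ?thesis using gA(1-4) unfolding path_cost_def a_def by blast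
qed

text \<open>
  Outside the two events estimated above the path is within \<open>3 * \<delta>\<close> of a lift of action at most \<open>m\<close>:
  \<open>2 * \<delta>\<close> for the fluctuations of the path and of the lift, and \<open>\<delta>\<close> for the starting point.
\<close>

lemma prob_separated_le:
  assumes C: "C \<in> sets (skorohod_borel T)" and n: "0 < n" and "0 \<le> \<delta>" "0 \<le> q"
    and large: "m + cumulant q * (T / real n) \<le> q * \<delta>" and near: "dist x y \<le> \<delta>"
    and sep: "\<And>\<gamma> g A. \<gamma> \<in> C \<Longrightarrow> action_majorant T g A \<Longrightarrow> A 0 = 0 \<Longrightarrow> A T \<le> m \<Longrightarrow> g 0 = Rep_circle y \<Longrightarrow>
      \<exists>t\<in>{0..T}. 3 * \<delta> < dist (\<gamma> t) (circle_of_real (g t))"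
  shows "measure (distr M (skorohod_borel T) X) C \<le> (real k ^ Suc n * 2 ^ n + 2 * real n) * exp (- (real k * m))"
proof -
  define E where "E = {\<omega> \<in> start. m < path_cost n (\<lambda>i. X \<omega> (mesh n i))}"
  have E: "E \<in> events" "prob E \<le> real k ^ Suc n * 2 ^ n * exp (- (real k * m))"
    unfolding E_def by (rule costly_paths[OF n])+
  note R = rough_event_prob[OF n \<open>0 \<le> \<delta>\<close> \<open>0 \<le> q\<close> large]
  define Q where "Q = X -` C \<inter> space M"
  have Q: "Q \<in> events" unfolding Q_def using X_measurable C by (rule measurable_sets)
  have "prob Q = prob (Q \<inter> start)"
  proof (rule finite_measure_eq_AE)
    have "AE \<omega> in M. \<omega> \<in> start" using prob_start start_event by (simp add: prob_eq_1)
    then show "AE \<omega> in M. \<omega> \<in> Q \<longleftrightarrow> \<omega> \<in> Q \<inter> start" by eventually_elim simp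
  qed (use Q start_event in auto)
  also have "\<dots> \<le> prob (E \<union> rough n \<delta>)"
  proof (rule finite_measure_mono)
    show "Q \<inter> start \<subseteq> E \<union> rough n \<delta>"
    proof
      fix \<omega> assume \<omega>: "\<omega> \<in> Q \<inter> start"
      show "\<omega> \<in> E \<union> rough n \<delta>"
      proof (rule ccontr)
        assume no: "\<omega> \<notin> E \<union> rough n \<delta>"
        obtain g A where gA: "action_majorant T g A" "A 0 = 0" "g 0 = Rep_circle y"
          "A T = path_cost n (\<lambda>i. X \<omega> (mesh n i))"
          "\<forall>t\<in>{0..T}. dist (X \<omega> t) (circle_of_real (g t)) \<le> 2 * \<delta> + dist x y"
          using smooth_path_near_lift[of \<omega> n \<delta> y] \<omega> no n by blast
        have "A T \<le> m" using no \<omega> gA(4) by (auto simp: E_def)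
        moreover have "X \<omega> \<in> C" using \<omega> by (simp add: Q_def)
        ultimately obtain t where "t \<in> {0..T}" "3 * \<delta> < dist (X \<omega> t) (circle_of_real (g t))"
          using sep[OF _ gA(1,2) _ gA(3)] by blast
        moreover from this(1) have "dist (X \<omega> t) (circle_of_real (g t)) \<le> 2 * \<delta> + dist x y"
          using gA(5) by blast
        ultimately show False using near by linarith
      qed
    qed
  qed (use E R in auto)
  also have "\<dots> \<le> prob E + prob (rough n \<delta>)" using E(1) R(1) by (rule measure_Un_le)
  also have "\<dots> \<le> real k ^ Suc n * 2 ^ n * exp (- (real k * m)) + 2 * real n * exp (- (real k * m))"
    using E(2) R(2) by (rule add_mono)
  also have "prob Q = measure (distr M (skorohod_borel T) X) C"
    unfolding Q_def using X_measurable C by (simp add: measure_distr)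
  finally show ?thesis by (simp add: distrib_right)
qed

text \<open>
  If the walk visits the positions \<open>a i\<close> at the mesh times and does not fluctuate in between, it stays within
  \<open>3 * \<delta>\<close> of \<open>\<gamma>\<close>: one \<open>\<delta>\<close> each for the walk, for the positions and for \<open>\<gamma>\<close> itself.
\<close>

lemma prob_neighbourhood_ge:
  assumes U: "U \<in> sets (skorohod_borel T)" and n: "0 < n" and "0 \<le> \<delta>" "0 \<le> q"
    and large: "m + cumulant q * (T / real n) \<le> q * \<delta>"
    and a: "\<And>i. i \<le> n \<Longrightarrow> a i \<in> grid k" "a 0 = x"
    and near: "\<And>i. i \<le> n \<Longrightarrow> dist (a i) (\<gamma> (mesh n i)) \<le> \<delta>"
    and osc: "\<And>i t. i < n \<Longrightarrow> t \<in> {mesh n i..mesh n (Suc i)} \<Longrightarrow> dist (\<gamma> (mesh n i)) (\<gamma> t) \<le> \<delta>"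
    and ball: "\<And>\<eta>. \<eta> \<in> cadlag_paths T \<Longrightarrow> (\<And>t. t \<in> {0..T} \<Longrightarrow> dist (\<gamma> t) (\<eta> t) \<le> 3 * \<delta>) \<Longrightarrow> \<eta> \<in> U"
  shows "(\<Prod>i<n. p (T / real n) (a i) (a (Suc i))) - 2 * real n * exp (- (real k * m))
      \<le> measure (distr M (skorohod_borel T) X) U"
proof -
  note R = rough_event_prob[OF n \<open>0 \<le> \<delta>\<close> \<open>0 \<le> q\<close> large]
  define Q where "Q = X -` U \<inter> space M"
  have Q: "Q \<in> events" unfolding Q_def using X_measurable U by (rule measurable_sets)
  have cyl: "cylinder n (mesh n) a \<in> events"
    by (rule cylinder_event[OF mesh_chain[OF n]]) (use a in auto)
  have "prob (cylinder n (mesh n) a) = (\<Prod>i<n. p (T / real n) (a i) (a (Suc i)))"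
    using prob_cylinder[OF mesh_chain[OF n], of a] a by (simp add: mesh_step)
  moreover have "prob (cylinder n (mesh n) a) \<le> prob (Q \<union> rough n \<delta>)"
  proof (rule finite_measure_mono)
    show "cylinder n (mesh n) a \<subseteq> Q \<union> rough n \<delta>"
    proof
      fix \<omega> assume \<omega>: "\<omega> \<in> cylinder n (mesh n) a"
      then have sp: "\<omega> \<in> space M" "\<And>i. i \<le> n \<Longrightarrow> X \<omega> (mesh n i) = a i" by (simp_all add: cylinder_def)
      have st: "\<omega> \<in> start" using cylinder_subset_start[of "mesh n" a n] a(2) \<omega> mesh_0 by auto
      show "\<omega> \<in> Q \<union> rough n \<delta>"
      proof (cases "\<omega> \<in> rough n \<delta>")
        case False
        have "X \<omega> \<in> U"
        proof (rule ball[OF X_cadlag[OF sp(1)]])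
          fix t assume t: "t \<in> {0..T}"
          obtain i where i: "i < n" "t \<in> {mesh n i..mesh n (Suc i)}" using mesh_cover[OF n t] by blast
          have "dist (a i) (X \<omega> t) \<le> \<delta>"
            using not_rough_dist_le[OF st False i] sp(2)[of i] i(1) by simp
          moreover have "dist (a i) (\<gamma> (mesh n i)) \<le> \<delta>" using near i(1) by simp
          moreover have "dist (\<gamma> (mesh n i)) (\<gamma> t) \<le> \<delta>" by (rule osc[OF i])
          moreover have "dist (\<gamma> t) (X \<omega> t) \<le> dist (\<gamma> (mesh n i)) (\<gamma> t) + (dist (a i) (\<gamma> (mesh n i)) + dist (a i) (X \<omega> t))"
            using dist_triangle[of "\<gamma> t" "X \<omega> t" "\<gamma> (mesh n i)"] dist_triangle[of "\<gamma> (mesh n i)" "X \<omega> t" "a i"]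
              dist_commute[of "\<gamma> t" "\<gamma> (mesh n i)"] dist_commute[of "a i" "\<gamma> (mesh n i)"] by linarith
          ultimately show "dist (\<gamma> t) (X \<omega> t) \<le> 3 * \<delta>" by linarith
        qed
        then show ?thesis using sp(1) by (simp add: Q_def)
      qed simp
    qed
  qed (use Q R in auto)
  moreover have "prob (Q \<union> rough n \<delta>) \<le> prob Q + prob (rough n \<delta>)"
    using Q R(1) by (rule measure_Un_le)
  moreover have "prob Q = measure (distr M (skorohod_borel T) X) U"
    unfolding Q_def using X_measurable U by (simp add: measure_distr)
  ultimately show ?thesis using R(2) by linarith
qed

end

section \<open>Logarithmic asymptotics\<close>

text \<open>
  Factors polynomial in \<open>k\<close> disappear on the exponential scale.
\<close>

lemma limsup_log_prob_le:
  assumes "0 < c" and le: "\<forall>\<^sub>F k in sequentially. P k \<le> c * real k ^ n * exp (- (real k * m))"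
  shows "limsup (\<lambda>k. ereal (1 / real k) * log_prob (P k)) \<le> - ereal m"
proof -
  define b where "b k = ln c / real k + real n * (ln (real k) / real k) - m" for k
  have "(\<lambda>k. ln c * (1 / real k)) \<longlonglongrightarrow> ln c * 0" by (intro tendsto_mult tendsto_const lim_1_over_n)
  moreover have "(\<lambda>k. ln (real k) / real k) \<longlonglongrightarrow> 0"
    by (rule filterlim_compose[OF ln_x_over_x_tendsto_0 filterlim_real_sequentially])
  ultimately have "b \<longlonglongrightarrow> 0 + real n * 0 - m"
    unfolding b_def[abs_def] by (intro tendsto_diff tendsto_add tendsto_mult tendsto_const) simp_all
  then have b: "(\<lambda>k. ereal (b k)) \<longlonglongrightarrow> ereal (- m)" by simp
  have "limsup (\<lambda>k. ereal (1 / real k) * log_prob (P k)) \<le> limsup (\<lambda>k. ereal (b k))"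
  proof (rule Limsup_mono)
    show "\<forall>\<^sub>F k in sequentially. ereal (1 / real k) * log_prob (P k) \<le> ereal (b k)"
      using le eventually_ge_at_top[of 1]
    proof eventually_elim
      case (elim k)
      then have k: "0 < real k" by simp
      show ?case
      proof (cases "0 < P k")
        case True
        then have "ln (P k) \<le> ln (c * real k ^ n * exp (- (real k * m)))"
          using elim(1) by (intro ln_mono) auto
        also have "\<dots> = ln c + real n * ln (real k) - real k * m"
          using \<open>0 < c\<close> k by (simp add: ln_mult ln_realpow)
        also have "\<dots> = real k * b k" using k by (simp add: b_def field_simps)
        finally have "1 / real k * ln (P k) \<le> b k" using k by (simp add: field_simps)
        then show ?thesis using True by (simp add: log_prob_def)
      next
        case False
        then show ?thesis using k by (simp add: log_prob_def)
      qed
    qed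
  qed
  also have "\<dots> = ereal (- m)" using b by (simp add: lim_imp_Limsup)
  finally show ?thesis by simp
qed

lemma liminf_log_prob_ge:
  assumes ge: "\<forall>\<^sub>F k in sequentially. exp (- (real k * m)) \<le> P k"
  shows "- ereal m \<le> liminf (\<lambda>k. ereal (1 / real k) * log_prob (P k))"
proof (rule Liminf_bounded)
  show "\<forall>\<^sub>F k in sequentially. - ereal m \<le> ereal (1 / real k) * log_prob (P k)"
    using ge eventually_ge_at_top[of 1]
  proof eventually_elim
    case (elim k)
    then have k: "0 < real k" by simp
    have pos: "0 < P k" using elim(1) exp_gt_zero less_le_trans by blast
    have "ln (exp (- (real k * m))) \<le> ln (P k)" using elim(1) pos by (intro ln_mono) auto
    then have "- m \<le> 1 / real k * ln (P k)" using k by (simp add: field_simps)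
    then show ?case using pos by (simp add: log_prob_def)
  qed
qed

section \<open>The two large deviation bounds\<close>

lemma skorohod_sets:
  assumes "0 \<le> T"
  shows openin_skorohod_sets: "openin (skorohod_topology T) U \<Longrightarrow> U \<in> sets (skorohod_borel T)"
    and closedin_skorohod_sets: "closedin (skorohod_topology T) C \<Longrightarrow> C \<in> sets (skorohod_borel T)"
proof -
  interpret Metric_space "cadlag_paths T :: (real \<Rightarrow> circle) set" "skorohod_dist T"
    by (rule Metric_space_skorohod[OF assms])
  have top: "topspace (skorohod_topology T) = cadlag_paths T" by (simp add: skorohod_topology_def)
  have "{U. openin (skorohod_topology T) U} \<subseteq> Pow (cadlag_paths T)"
    using openin_subset top by blast
  then have sets: "sets (skorohod_borel T) = sigma_sets (cadlag_paths T) {U. openin (skorohod_topology T) U}"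
    unfolding skorohod_borel_def by (rule sets_measure_of)
  show op: "U \<in> sets (skorohod_borel T)" if "openin (skorohod_topology T) U" for U
    unfolding sets using that by (intro sigma_sets.Basic) simp
  assume C: "closedin (skorohod_topology T) C"
  then have "cadlag_paths T - C \<in> sets (skorohod_borel T)"
    using top by (intro op) (simp add: closedin_def)
  then have "cadlag_paths T - (cadlag_paths T - C) \<in> sets (skorohod_borel T)"
    unfolding sets by (rule sigma_sets.Compl)
  moreover have "cadlag_paths T - (cadlag_paths T - C) = C"
    using C top by (auto simp: closedin_def)
  ultimately show "C \<in> sets (skorohod_borel T)" by simp
qed

lemma dist_node_floor_le:
  assumes "1 \<le> k"
  shows "dist (node k \<lfloor>real k * y\<rfloor>) (circle_of_real y) \<le> 1 / real k"
proof -
  have k: "0 < real k" using assms by simp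
  have "dist (node k \<lfloor>real k * y\<rfloor>) (circle_of_real y) \<le> \<bar>of_int \<lfloor>real k * y\<rfloor> / real k - y\<bar>"
    unfolding node_def by (rule dist_circle_of_real_le)
  also have "of_int \<lfloor>real k * y\<rfloor> / real k - y = (of_int \<lfloor>real k * y\<rfloor> - real k * y) / real k"
    using k by (simp add: diff_divide_distrib)
  also have "\<bar>\<dots>\<bar> = \<bar>of_int \<lfloor>real k * y\<rfloor> - real k * y\<bar> / real k"
    by (simp add: abs_divide)
  also have "\<dots> \<le> 1 / real k"
    using k by (intro divide_right_mono) linarith+
  finally show ?thesis .
qed

lemma large_mesh:
  assumes "0 < T" "0 < \<eta>"
  shows "\<exists>n>0. T / real n < \<eta> \<and> c * (T / real n) \<le> 1"
proof -
  define b where "b = min \<eta> (1 / (\<bar>c\<bar> + 1))"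
  have b: "0 < b" using assms by (simp add: b_def)
  obtain n where n: "T / b < real n" using reals_Archimedean2 by blast
  have "0 < T / b" using assms b by simp
  then have n0: "0 < real n" using n by linarith
  have Tn: "T / real n < b" using n n0 b by (simp add: field_simps)
  have "c * (T / real n) \<le> \<bar>c\<bar> * (T / real n)" using assms by (intro mult_right_mono) auto
  also have "\<dots> \<le> (\<bar>c\<bar> + 1) * (1 / (\<bar>c\<bar> + 1))"
    using Tn assms by (intro mult_mono) (auto simp: b_def)
  also have "\<dots> = 1" by (simp add: field_simps)
  finally show ?thesis using Tn n0 by (intro exI[of _ n]) (auto simp: b_def)
qed

lemma upper_bound:
  fixes M :: "nat \<Rightarrow> 'a measure" and X :: "nat \<Rightarrow> 'a \<Rightarrow> real \<Rightarrow> circle"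
  assumes T: "0 < T"
    and walk: "\<And>k. 1 \<le> k \<Longrightarrow> \<exists>p. grid_walk k p (M k) T (node k \<lfloor>real k * Rep_circle x\<^sub>0\<rfloor>) (X k)"
    and P: "\<And>k. 1 \<le> k \<Longrightarrow> P k = distr (M k) (skorohod_borel T) (X k)"
    and C: "closedin (skorohod_topology T) C"
  shows "limsup (\<lambda>k. ereal (1 / real k) * log_prob (measure (P k) C)) \<le> - (INF \<gamma>\<in>C. rate_function T x\<^sub>0 \<gamma>)"
    (is "?L \<le> - ?I")
proof (rule ccontr)
  assume "\<not> ?L \<le> - ?I"
  then have "- ?I < ?L" by simp
  then obtain z where z: "- ?I < ereal z" "ereal z < ?L" using ereal_dense2 by blast
  define m where "m = - z"
  have mI: "ereal m < ?I" using z(1) by (simp add: m_def ereal_uminus_less_reorder flip: uminus_ereal.simps)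
  have mL: "- ereal m < ?L" using z(2) by (simp add: m_def)
  have Cs: "C \<in> sets (skorohod_borel T)" using closedin_skorohod_sets C T by simp
  show False
  proof (cases "m < 0")
    case True
    have "?L \<le> - ereal 0"
    proof (rule limsup_log_prob_le[of 1 _ 0])
      show "\<forall>\<^sub>F k in sequentially. measure (P k) C \<le> 1 * real k ^ 0 * exp (- (real k * 0))"
        using eventually_ge_at_top[of 1]
      proof eventually_elim
        case (elim k)
        then obtain p where "grid_walk k p (M k) T (node k \<lfloor>real k * Rep_circle x\<^sub>0\<rfloor>) (X k)" using walk by blast
        then interpret grid_walk k p "M k" T "node k \<lfloor>real k * Rep_circle x\<^sub>0\<rfloor>" "X k" .
        show ?case using X_measurable Cs elim by (simp add: P measure_distr)
      qed
    qed simp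
    also have "\<dots> < - ereal m" using True by simp
    finally show False using mL by simp
  next
    case False
    then have "0 \<le> m" by simp
    have "ereal m < rate_function T x\<^sub>0 \<gamma>" if "\<gamma> \<in> C" for \<gamma>
      using mI INF_lower[OF that, of "rate_function T x\<^sub>0"] by (rule less_le_trans)
    then obtain \<delta>0 where "0 < \<delta>0" and sep: "\<forall>\<gamma>\<in>C. \<forall>g A. action_majorant T g A \<and> A 0 = 0 \<and> A T \<le> m \<and> g 0 = Rep_circle x\<^sub>0 \<longrightarrow>
      (\<exists>t\<in>{0..T}. \<delta>0 < dist (\<gamma> t) (circle_of_real (g t)))"
      using closed_set_separated[OF T C, of m x\<^sub>0] by blast
    \<comment> \<open>One third each for the fluctuations of the path, those of its interpolation, and the starting point.\<close>
    define \<delta> where "\<delta> = \<delta>0 / 3"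
    have \<delta>: "0 < \<delta>" "3 * \<delta> = \<delta>0" using \<open>0 < \<delta>0\<close> by (simp_all add: \<delta>_def)
    \<comment> \<open>The mesh below makes \<open>cumulant q * (T / n) \<le> 1\<close>, hence \<open>m + cumulant q * (T / n) \<le> q * \<delta>\<close>.\<close>
    define q where "q = (m + 1) / \<delta>"
    have q: "0 \<le> q" "q * \<delta> = m + 1" using \<delta>(1) \<open>0 \<le> m\<close> by (simp_all add: q_def)
    obtain n where n: "0 < n" "cumulant q * (T / real n) \<le> 1"
      using large_mesh[OF T zero_less_one, of "cumulant q"] by blast
    obtain K where K: "1 / \<delta> < real K" using reals_Archimedean2 by blast
    have "?L \<le> - ereal m"
    proof (rule limsup_log_prob_le[of "2 ^ n + 2 * real n" _ "Suc n"])
      show "0 < 2 ^ n + 2 * real n" by (simp add: add_pos_nonneg)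
      show "\<forall>\<^sub>F k in sequentially. measure (P k) C \<le> (2 ^ n + 2 * real n) * real k ^ Suc n * exp (- (real k * m))"
        using eventually_ge_at_top[of "max 1 K"]
      proof eventually_elim
        case (elim k)
        then have kK: "1 \<le> k" "K \<le> k" by simp_all
        obtain p where "grid_walk k p (M k) T (node k \<lfloor>real k * Rep_circle x\<^sub>0\<rfloor>) (X k)" using walk kK(1) by blast
        then interpret grid_walk k p "M k" T "node k \<lfloor>real k * Rep_circle x\<^sub>0\<rfloor>" "X k" .
        have "dist (node k \<lfloor>real k * Rep_circle x\<^sub>0\<rfloor>) x\<^sub>0 \<le> 1 / real k"
          using dist_node_floor_le[OF kK(1), of "Rep_circle x\<^sub>0"] by (simp add: circle_of_real_Rep)
        also have "1 / real k \<le> \<delta>"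
        proof -
          have "real K \<le> real k" using kK(2) by simp
          then have "1 / \<delta> < real k" using K by linarith
          then show ?thesis using \<delta>(1) kK(1) by (simp add: field_simps)
        qed
        finally have near: "dist (node k \<lfloor>real k * Rep_circle x\<^sub>0\<rfloor>) x\<^sub>0 \<le> \<delta>" .
        have "measure (distr (M k) (skorohod_borel T) (X k)) C
            \<le> (real k ^ Suc n * 2 ^ n + 2 * real n) * exp (- (real k * m))"
          by (rule prob_separated_le[OF Cs n(1) _ q(1) _ near]) (use \<delta> q(2) n(2) sep in auto)
        also have "\<dots> \<le> ((2 ^ n + 2 * real n) * real k ^ Suc n) * exp (- (real k * m))"
        proof (rule mult_right_mono)
          have "1 \<le> real k ^ Suc n" using kK(1) by (intro one_le_power) simp
          then have "2 * real n * 1 \<le> 2 * real n * real k ^ Suc n" by (intro mult_left_mono) auto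
          then show "real k ^ Suc n * 2 ^ n + 2 * real n \<le> (2 ^ n + 2 * real n) * real k ^ Suc n"
            by (simp add: algebra_simps)
        qed simp
        finally show ?case using P[OF kK(1)] by simp
      qed
    qed
    then show False using mL by simp
  qed
qed

text \<open>
  The form in which the fluctuation event, of exponential rate \<open>z + 1\<close>, is absorbed by the gap between \<open>z - \<epsilon>\<close> and \<open>z\<close>
  in the lower bound.
\<close>

lemma exp_dominates:
  assumes "0 < \<epsilon>"
  shows "\<forall>\<^sub>F k in sequentially. exp (- (real k * z)) \<le> exp (- (real k * (z - \<epsilon>))) - c * exp (- (real k * (z + 1)))"
proof -
  obtain K where K: "1 / \<epsilon> + \<bar>c\<bar> < real K" using reals_Archimedean2 by blast
  show ?thesis using eventually_ge_at_top[of K]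
  proof eventually_elim
    case (elim k)
    then have "real K \<le> real k" by simp
    moreover have "0 < 1 / \<epsilon>" using assms by simp
    ultimately have k: "1 / \<epsilon> < real k" "\<bar>c\<bar> < real k" using K by linarith+
    have "2 \<le> 1 + real k * \<epsilon>" using k(1) assms by (simp add: field_simps)
    also have "\<dots> \<le> exp (real k * \<epsilon>)" by (rule exp_ge_add_one_self)
    finally have 1: "2 \<le> exp (real k * \<epsilon>)" .
    have "c \<le> exp (real k)" using k(2) exp_ge_add_one_self[of "real k"] by linarith
    then have 2: "c * exp (- real k) \<le> 1" by (simp add: exp_minus field_simps)
    have "exp (- (real k * z)) * 1 \<le> exp (- (real k * z)) * (exp (real k * \<epsilon>) - c * exp (- real k))"
      using 1 2 by (intro mult_left_mono) auto
    also have "\<dots> = exp (- (real k * (z - \<epsilon>))) - c * exp (- (real k * (z + 1)))"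
      by (simp add: right_diff_distrib distrib_left exp_add exp_diff exp_minus field_simps)
    finally show ?case by simp
  qed
qed

text \<open>
  The positions at the mesh times are the grid points next to the path. Their transition probabilities multiply to
  an exponent that is at most the action \<open>a\<close> by \<open>action_majorant_rate_density\<close>, up to an error below \<open>z - a\<close>.
\<close>

lemma lower_bound_at:
  fixes M :: "nat \<Rightarrow> 'a measure" and X :: "nat \<Rightarrow> 'a \<Rightarrow> real \<Rightarrow> circle"
  assumes T: "0 < T"
    and walk: "\<And>k. 1 \<le> k \<Longrightarrow> \<exists>p. grid_walk k p (M k) T (node k \<lfloor>real k * Rep_circle x\<^sub>0\<rfloor>) (X k)"
    and P: "\<And>k. 1 \<le> k \<Longrightarrow> P k = distr (M k) (skorohod_borel T) (X k)"
    and U: "openin (skorohod_topology T) U" and \<gamma>: "\<gamma> \<in> U"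
    and rate: "rate_function T x\<^sub>0 \<gamma> = ereal a" and z: "a < z"
  shows "- ereal z \<le> liminf (\<lambda>k. ereal (1 / real k) * log_prob (measure (P k) U))"
proof (rule liminf_log_prob_ge)
  have start: "\<gamma> 0 = x\<^sub>0" and act: "action T \<gamma> = ereal a"
    using rate by (auto simp: rate_function_def split: if_splits)
  then have "\<gamma> \<in> abs_cont_paths T" by (auto simp: action_def split: if_splits)
  then obtain g where ac: "abs_cont T g" and lift: "\<And>t. t \<in> {0..T} \<Longrightarrow> \<gamma> t = circle_of_real (g t)"
    and "g 0 = Rep_circle (\<gamma> 0)"
    by (rule abs_cont_lift[OF _ T]) (rule that)
  then have g0: "g 0 = Rep_circle x\<^sub>0" using start by simp
  obtain A where A: "action_majorant T g A" "A 0 = 0" "A T = a"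
    using action_self_majorant[OF ac T lift act] by blast
  have "0 \<le> a" using action_majorant_mono[OF A(1), of 0 T] A T by simp
  have Us: "U \<in> sets (skorohod_borel T)" using openin_skorohod_sets U T by simp
  interpret S: Metric_space "cadlag_paths T :: (real \<Rightarrow> circle) set" "skorohod_dist T"
    using Metric_space_skorohod T by simp
  obtain \<rho> where \<rho>: "0 < \<rho>" "S.mball \<gamma> \<rho> \<subseteq> U"
    using U \<gamma> unfolding skorohod_topology_def S.openin_mtopology
    by (elim conjE allE[of _ \<gamma>] impE exE) (assumption, rule that)
  have \<gamma>c: "\<gamma> \<in> cadlag_paths T"
    using U \<gamma> unfolding skorohod_topology_def S.openin_mtopology by blast
  \<comment> \<open>Paths within \<open>3 * \<delta> < \<rho>\<close> of \<open>\<gamma>\<close> uniformly are in \<open>U\<close>.\<close>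
  define \<delta> where "\<delta> = \<rho> / 4"
  have \<delta>: "0 < \<delta>" using \<rho>(1) by (simp add: \<delta>_def)
  have ball: "\<eta> \<in> U" if "\<eta> \<in> cadlag_paths T" "\<And>t. t \<in> {0..T} \<Longrightarrow> dist (\<gamma> t) (\<eta> t) \<le> 3 * \<delta>" for \<eta>
  proof -
    have "skorohod_dist T \<gamma> \<eta> < \<rho>"
      unfolding skorohod_dist_less_iff[OF less_imp_le[OF T]]
    proof (intro bexI[OF _ time_changes_id] exI[of _ "3 * \<delta>"] conjI ballI)
      show "3 * \<delta> < \<rho>" using \<rho>(1) by (simp add: \<delta>_def)
    qed (use that(2) \<delta> in auto)
    then have "\<eta> \<in> S.mball \<gamma> \<rho>" using that(1) \<gamma>c by simp
    then show ?thesis using \<rho>(2) by blast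
  qed
  have "uniformly_continuous_on {0..T} g"
    by (intro compact_uniformly_continuous abs_cont_continuous[OF ac]) simp
  then obtain \<eta> where \<eta>: "0 < \<eta>" "\<forall>s\<in>{0..T}. \<forall>t\<in>{0..T}. dist t s < \<eta> \<longrightarrow> dist (g t) (g s) < \<delta>"
    unfolding uniformly_continuous_on_def using \<delta> by (elim allE[of _ \<delta>] impE exE conjE) (assumption, rule that)
  \<comment> \<open>Fluctuations then have exponential rate \<open>z + 1\<close>.\<close>
  define q where "q = (z + 2) / \<delta>"
  have q: "0 \<le> q" "q * \<delta> = z + 2" using \<delta> \<open>0 \<le> a\<close> z by (simp_all add: q_def)
  obtain n where n: "0 < n" "T / real n < \<eta>" "cumulant q * (T / real n) \<le> 1"
    using large_mesh[OF T \<eta>(1), of "cumulant q"] by blast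
  define h where "h = T / real n"
  have h: "0 < h" using T n(1) by (simp add: h_def)
  define u where "u i = mesh_point T n i" for i
  have u_step: "u (Suc i) - u i = h" for i
    by (simp add: u_def mesh_point_def h_def add_divide_distrib distrib_right)
  have u_range: "u i \<in> {0..T}" if "i \<le> n" for i
  proof -
    have "real i * T \<le> real n * T" using that T by (intro mult_right_mono) auto
    then show ?thesis using T n(1) by (simp add: u_def mesh_point_def field_simps)
  qed
  have u0: "u 0 = 0" and un: "u n = T" using n(1) by (simp_all add: u_def mesh_point_def)
  define D where "D i = g (u (Suc i)) - g (u i)" for i
  define J where "J i k = \<lfloor>real k * g (u (Suc i))\<rfloor> - \<lfloor>real k * g (u i)\<rfloor>" for i k
  have J: "(\<lambda>k. of_int (J i k) / real k) \<longlonglongrightarrow> D i" for i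
  proof -
    have "(\<lambda>k. of_int \<lfloor>real k * g (u (Suc i))\<rfloor> / real k - of_int \<lfloor>real k * g (u i)\<rfloor> / real k) \<longlonglongrightarrow> D i"
      unfolding D_def by (intro tendsto_diff floor_scaled_tendsto)
    then show ?thesis by (simp add: J_def diff_divide_distrib)
  qed
  have "\<forall>i. \<exists>e. e \<longlonglongrightarrow> - (h * rate_density (D i / h)) \<and>
    (\<forall>\<^sub>F k in sequentially. \<forall>p j. grid_semigroup k p \<longrightarrow> exp (real k * e k) \<le> p h (node k j) (node k (j + J i k)))"
    by (intro allI transition_lower_asymptotic[OF J h])
  from choice[OF this] obtain e where "\<forall>i. e i \<longlonglongrightarrow> - (h * rate_density (D i / h)) \<and>
    (\<forall>\<^sub>F k in sequentially. \<forall>p j. grid_semigroup k p \<longrightarrow> exp (real k * e i k) \<le> p h (node k j) (node k (j + J i k)))"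
    by (rule exE)
  then have e: "\<And>i. e i \<longlonglongrightarrow> - (h * rate_density (D i / h))"
    "\<And>i. \<forall>\<^sub>F k in sequentially. \<forall>p j. grid_semigroup k p \<longrightarrow> exp (real k * e i k) \<le> p h (node k j) (node k (j + J i k))"
    by simp_all
  have cost: "(\<Sum>i<n. h * rate_density (D i / h)) \<le> a"
  proof -
    have "(\<Sum>i<n. h * rate_density (D i / h)) \<le> (\<Sum>i<n. A (u (Suc i)) - A (u i))"
    proof (rule sum_mono)
      fix i assume "i \<in> {..<n}"
      then have "0 \<le> u i" "u i < u (Suc i)" "u (Suc i) \<le> T"
        using u_range[of i] u_range[of "Suc i"] u_step[of i] h by auto
      from action_majorant_rate_density[OF A(1) this]
      show "h * rate_density (D i / h) \<le> A (u (Suc i)) - A (u i)" by (simp add: u_step D_def)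
    qed
    also have "\<dots> = a" using sum_lessThan_telescope[of "\<lambda>i. A (u i)" n] A u0 un by simp
    finally show ?thesis .
  qed
  define \<epsilon> where "\<epsilon> = (z - a) / 2"
  have \<epsilon>: "0 < \<epsilon>" using z by (simp add: \<epsilon>_def)
  have "(\<lambda>k. \<Sum>i<n. e i k) \<longlonglongrightarrow> (\<Sum>i<n. - (h * rate_density (D i / h)))"
    by (intro tendsto_sum e)
  moreover have "- (z - \<epsilon>) < (\<Sum>i<n. - (h * rate_density (D i / h)))"
    using cost z by (simp add: sum_negf \<epsilon>_def field_simps)
  ultimately have ev_sum: "\<forall>\<^sub>F k in sequentially. - (z - \<epsilon>) < (\<Sum>i<n. e i k)"
    by (rule order_tendstoD)
  have ev_trans: "\<forall>\<^sub>F k in sequentially. \<forall>i\<in>{..<n}. \<forall>p j. grid_semigroup k p \<longrightarrow>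
      exp (real k * e i k) \<le> p h (node k j) (node k (j + J i k))"
    by (intro eventually_ball_finite ballI e(2)) simp
  obtain K where K: "1 / \<delta> < real K" using reals_Archimedean2 by blast
  show "\<forall>\<^sub>F k in sequentially. exp (- (real k * z)) \<le> measure (P k) U"
    using eventually_ge_at_top[of "max 1 K"] ev_sum ev_trans exp_dominates[OF \<epsilon>, of z "2 * real n"]
  proof eventually_elim
    case (elim k)
    then have kK: "1 \<le> k" "K \<le> k" by simp_all
    have k\<delta>: "1 / real k \<le> \<delta>"
    proof -
      have "real K \<le> real k" using kK(2) by simp
      then have "1 / \<delta> < real k" using K by linarith
      then show ?thesis using \<delta> kK(1) by (simp add: field_simps)
    qed
    obtain p where "grid_walk k p (M k) T (node k \<lfloor>real k * Rep_circle x\<^sub>0\<rfloor>) (X k)" using walk kK(1) by blast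
    then interpret grid_walk k p "M k" T "node k \<lfloor>real k * Rep_circle x\<^sub>0\<rfloor>" "X k" .
    define c where "c i = node k \<lfloor>real k * g (u i)\<rfloor>" for i
    have "exp (- (real k * (z - \<epsilon>))) \<le> exp (real k * (\<Sum>i<n. e i k))"
    proof -
      have "real k * (- (z - \<epsilon>)) \<le> real k * (\<Sum>i<n. e i k)" using elim(2) by (intro mult_left_mono) auto
      then show ?thesis by (simp add: right_diff_distrib)
    qed
    also have "\<dots> = (\<Prod>i<n. exp (real k * e i k))" by (simp add: sum_distrib_left exp_sum)
    also have "\<dots> \<le> (\<Prod>i<n. p h (c i) (c (Suc i)))"
    proof (rule prod_mono)
      fix i assume i: "i \<in> {..<n}"
      have "c (Suc i) = node k (\<lfloor>real k * g (u i)\<rfloor> + J i k)" by (simp add: c_def J_def)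
      then show "0 \<le> exp (real k * e i k) \<and> exp (real k * e i k) \<le> p h (c i) (c (Suc i))"
        using elim(3) i grid_semigroup_axioms by (simp add: c_def)
    qed
    finally have "exp (- (real k * z)) \<le> (\<Prod>i<n. p h (c i) (c (Suc i))) - 2 * real n * exp (- (real k * (z + 1)))"
      using elim(4) by linarith
    also have "\<dots> \<le> measure (distr (M k) (skorohod_borel T) (X k)) U"
      unfolding h_def
    proof (rule prob_neighbourhood_ge[OF Us n(1) less_imp_le[OF \<delta>] q(1)])
      show "z + 1 + cumulant q * (T / real n) \<le> q * \<delta>" using q(2) n(3) by simp
      show "c i \<in> grid k" for i unfolding c_def by (rule node_in_grid[OF kK(1)])
      show "c 0 = node k \<lfloor>real k * Rep_circle x\<^sub>0\<rfloor>" by (simp add: c_def u0 g0)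
      show "dist (c i) (\<gamma> (mesh_point T n i)) \<le> \<delta>" if "i \<le> n" for i
        using dist_node_floor_le[OF kK(1), of "g (u i)"] k\<delta> lift[OF u_range[OF that]]
        by (simp add: c_def u_def)
      show "\<eta> \<in> U" if "\<eta> \<in> cadlag_paths T" "\<And>t. t \<in> {0..T} \<Longrightarrow> dist (\<gamma> t) (\<eta> t) \<le> 3 * \<delta>" for \<eta>
        using that by (rule ball)
      fix i t assume i: "i < n" and t: "t \<in> {mesh_point T n i..mesh_point T n (Suc i)}"
      have t': "t \<in> {0..T}" "dist t (u i) < \<eta>"
        using t u_range[of i] u_range[of "Suc i"] i u_step[of i] n(2)
        unfolding dist_real_def u_def[symmetric] h_def[symmetric] by simp_all
      have ui: "u i \<in> {0..T}" using u_range i by simp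
      have "dist (g t) (g (u i)) < \<delta>" using \<eta>(2) t' ui by blast
      then show "dist (\<gamma> (mesh_point T n i)) (\<gamma> t) \<le> \<delta>"
        using dist_circle_of_real_le[of "g (u i)" "g t"] lift[OF ui] lift[OF t'(1)]
        by (simp add: u_def dist_real_def abs_minus_commute)
    qed
    finally show ?case using P[OF kK(1)] by simp
  qed
qed

theorem theorem1:
  fixes T :: real and x\<^sub>0 :: circle
    and M :: "nat \<Rightarrow> 'a measure" and X :: "nat \<Rightarrow> 'a \<Rightarrow> real \<Rightarrow> circle"
    and P :: "nat \<Rightarrow> (real \<Rightarrow> circle) measure"
  assumes "0 < T"
    and "\<And>k. 1 \<le> k \<Longrightarrow>
           random_walk T k (circle_of_real (\<lfloor>real k * Rep_circle x\<^sub>0\<rfloor> / real k)) (M k) (X k)"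
    and "\<And>k. 1 \<le> k \<Longrightarrow> P k = distr (M k) (skorohod_borel T) (X k)"
  shows "(\<forall>C. closedin (skorohod_topology T) C \<longrightarrow>
            limsup (\<lambda>k. ereal (1 / real k) * log_prob (measure (P k) C))
              \<le> - (INF \<gamma>\<in>C. rate_function T x\<^sub>0 \<gamma>))
       \<and> (\<forall>U. openin (skorohod_topology T) U \<longrightarrow>
            liminf (\<lambda>k. ereal (1 / real k) * log_prob (measure (P k) U))
              \<ge> - (INF \<gamma>\<in>U. rate_function T x\<^sub>0 \<gamma>))"
proof -
  have walk: "\<exists>p. grid_walk k p (M k) T (node k \<lfloor>real k * Rep_circle x\<^sub>0\<rfloor>) (X k)" if k: "1 \<le> k" for k
  proof -
    have rw: "random_walk T k (node k \<lfloor>real k * Rep_circle x\<^sub>0\<rfloor>) (M k) (X k)"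
      using assms(2)[OF k] by (simp add: node_def)
    then obtain p where p: "markov_semigroup (grid k) p"
      "has_generator (grid k) p (\<lambda>f y. real k * grid_laplacian k f y)"
      "markov_process_from T (grid k) p (node k \<lfloor>real k * Rep_circle x\<^sub>0\<rfloor>) (M k) (X k)"
      unfolding random_walk_def by blast
    have "grid_walk k p (M k) T (node k \<lfloor>real k * Rep_circle x\<^sub>0\<rfloor>) (X k)"
      using rw p k assms(1) node_in_grid[OF k] unfolding random_walk_def
      by (intro grid_walk.intro grid_semigroup.intro grid_walk_axioms.intro) blast+
    then show ?thesis by blast
  qed
  have lower: "- (INF \<gamma>\<in>U. rate_function T x\<^sub>0 \<gamma>) \<le> liminf (\<lambda>k. ereal (1 / real k) * log_prob (measure (P k) U))"
    (is "_ \<le> ?l") if U: "openin (skorohod_topology T) U" for U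
  proof -
    have "- ?l \<le> rate_function T x\<^sub>0 \<gamma>" if \<gamma>: "\<gamma> \<in> U" for \<gamma>
    proof (cases "rate_function T x\<^sub>0 \<gamma>")
      case (real a)
      show ?thesis
      proof (rule ccontr)
        assume "\<not> ?thesis"
        then have "ereal a < - ?l" using real by simp
        then obtain z where z: "ereal a < ereal z" "ereal z < - ?l" using ereal_dense2 by blast
        have "- ereal z \<le> ?l"
          using z(1) by (intro lower_bound_at[OF assms(1) walk assms(3) U \<gamma> real]) simp_all
        then have "- ?l \<le> ereal z" by (simp add: ereal_uminus_le_reorder)
        then show False using z(2) by simp
      qed
    next
      case MInf
      moreover have "0 \<le> rate_function T x\<^sub>0 \<gamma>"
        by (simp add: rate_function_def action_def)
      ultimately show ?thesis by simp
    qed simp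
    then have "- ?l \<le> (INF \<gamma>\<in>U. rate_function T x\<^sub>0 \<gamma>)" by (rule INF_greatest)
    then show ?thesis by (simp add: ereal_uminus_le_reorder)
  qed
  show ?thesis
    using upper_bound[OF assms(1) walk assms(3)] lower by blast
qed

end
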